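(* Let $D_1,D_2\subset\mathbb{R}^2$ be disjoint, simply connected, bounded domains with smooth boundaries $\partial D_1,\partial D_2$, let $D=D_1\cup D_2$, and suppose that $D_1$ and $D_2$ are strictly convex. Then the polynomial nonlinearity $F$ is uniquely determined by the reconstruction $f_{CT}$. Precisely: let $h,\tilde h\in C_0^\infty(\mathbb{R}^2)$ and let $F(t)=\sum_{j=2}^{J}a_jt^j$ and $\tilde F(t)=\sum_{j=2}^{\tilde J}\tilde a_jt^j$ be polynomials with constant coefficients $a_j,\tilde a_j\in\mathbb{C}$. Put $$f_{CT}=h+\chi_D+R^*I^{-1}\big(F(R\chi_D)\big),\qquad \tilde f_{CT}=\tilde h+\chi_D+R^*I^{-1}\big(\tilde F(R\chi_D)\big).$$ If $f_{CT}=\tilde f_{CT}$, then $F=\tilde F$.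
   Context: $\chi_D=\chi_{D_1}+\chi_{D_2}$ is the characteristic function of $D$. Let $M=\mathbb{R}\times(-\pi,\pi)$ with coordinates $(s,\phi)$. The Radon transform is $Rf(s,\phi)=\int_{x_1\cos\phi+x_2\sin\phi=s}f(x)\,dx$ (integration with respect to arc length on the line), and $R^*$ is its adjoint, $R^*g(x)=\int_{-\pi}^{\pi}g(x_1\cos\phi+x_2\sin\phi,\phi)\,d\phi$. $I^{-1}$ is the Riesz potential, i.e. the Fourier multiplier in the variable $s$ with multiplier a positive constant times $|\sigma|$ ($\sigma$ dual to $s$), normalized so that the filtered back-projection formula $R^*I^{-1}Rf=f$ holds. The attenuation coefficient is $f=h+\chi_D$, the CT data are $P=Rf+F(R\chi_D)$, and the reconstruction is $f_{CT}=R^*I^{-1}P=f+R^*I^{-1}(F(R\chi_D))$. Strict convexity of a domain with smooth boundary is understood in the sense that the curvature of the boundary is strictly positive everywhere. *)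

theory Defs
  imports "HOL-Analysis.Analysis" "HOL-Computational_Algebra.Polynomial"
begin

text \<open>These are meant for open \<open>S\<close>, where the Frechet derivative is unique.\<close>

primrec Ck_on :: "nat \<Rightarrow> ('a::euclidean_space \<Rightarrow> 'b::real_normed_vector) \<Rightarrow> 'a set \<Rightarrow> bool" where
  "Ck_on 0 f S \<longleftrightarrow> continuous_on S f"
| "Ck_on (Suc k) f S \<longleftrightarrow>
     (\<forall>x\<in>S. f differentiable at x) \<and> (\<forall>v. Ck_on k (\<lambda>x. frechet_derivative f (at x) v) S)"

definition smooth_on :: "('a::euclidean_space \<Rightarrow> 'b::real_normed_vector) \<Rightarrow> 'a set \<Rightarrow> bool" where
  "smooth_on f S \<longleftrightarrow> (\<forall>k. Ck_on k f S)"

definition test_function :: "('a::euclidean_space \<Rightarrow> complex) \<Rightarrow> bool" where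
  "test_function f \<longleftrightarrow> smooth_on f UNIV \<and> compact (closure {x. f x \<noteq> 0})"

type_synonym plane = "real \<times> real"

definition smooth_boundary :: "plane set \<Rightarrow> bool" where
  "smooth_boundary D \<longleftrightarrow>
     (\<forall>p\<in>frontier D. \<exists>U (\<rho> :: plane \<Rightarrow> real).
        open U \<and> p \<in> U \<and> smooth_on \<rho> U \<and>
        (\<forall>x\<in>U. frechet_derivative \<rho> (at x) \<noteq> (\<lambda>v. 0)) \<and>
        D \<inter> U = {x\<in>U. \<rho> x < 0})"

definition curvature :: "(real \<Rightarrow> plane) \<Rightarrow> real \<Rightarrow> real" where
  "curvature \<gamma> t =
     (let d1 = vector_derivative \<gamma> (at t);
          d2 = vector_derivative (\<lambda>r. vector_derivative \<gamma> (at r)) (at t)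
      in (fst d1 * snd d2 - snd d1 * fst d2) / norm d1 ^ 3)"

text \<open>A regular parametrization of the boundary near \<open>p = \<gamma> 0\<close>. The last conjunct says that
  \<open>D\<close> lies to the left of \<open>\<gamma>\<close>, i.e. in the direction of the velocity turned by \<open>\<pi>/2\<close>; this
  fixes the sign of the curvature so that discs have positive curvature.\<close>

definition boundary_param :: "plane set \<Rightarrow> plane \<Rightarrow> (real \<Rightarrow> plane) \<Rightarrow> bool" where
  "boundary_param D p \<gamma> \<longleftrightarrow>
     (\<exists>\<epsilon>>0. smooth_on \<gamma> {-\<epsilon><..<\<epsilon>} \<and> \<gamma> ` {-\<epsilon><..<\<epsilon>} \<subseteq> frontier D \<and>
        (\<forall>t\<in>{-\<epsilon><..<\<epsilon>}. vector_derivative \<gamma> (at t) \<noteq> 0)) \<and>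
     \<gamma> 0 = p \<and>
     (let d1 = vector_derivative \<gamma> (at 0)
      in \<forall>\<^sub>F r in at_right 0. p + r *\<^sub>R (- snd d1, fst d1) \<in> D)"

text \<open>For a domain with smooth boundary such a parametrization exists at every boundary point,
  and the curvature at \<open>p\<close> does not depend on its choice.\<close>

definition strictly_convex :: "plane set \<Rightarrow> bool" where
  "strictly_convex D \<longleftrightarrow> (\<forall>p\<in>frontier D. \<exists>\<gamma>. boundary_param D p \<gamma> \<and> curvature \<gamma> 0 > 0)"

definition smooth_sc_domain :: "plane set \<Rightarrow> bool" where
  "smooth_sc_domain D \<longleftrightarrow>
     D \<noteq> {} \<and> open D \<and> connected D \<and> simply_connected D \<and> bounded D \<and> smooth_boundary D"

text \<open>Functions on \<open>M = \<real> \<times> (-\<pi>, \<pi>)\<close> take pairs \<open>(s, \<phi>)\<close>.\<close>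

definition M_dom :: "(real \<times> real) set" where
  "M_dom = UNIV \<times> {-pi<..<pi}"

text \<open>The line \<open>x\<^sub>1 cos \<phi> + x\<^sub>2 sin \<phi> = s\<close> is parametrized by arc length.\<close>

definition radon :: "(plane \<Rightarrow> complex) \<Rightarrow> real \<times> real \<Rightarrow> complex" where
  "radon f = (\<lambda>(s, \<phi>). LINT t|lborel. f (s * cos \<phi> - t * sin \<phi>, s * sin \<phi> + t * cos \<phi>))"

definition fourier_s :: "(real \<times> real \<Rightarrow> complex) \<Rightarrow> real \<times> real \<Rightarrow> complex" where
  "fourier_s w = (\<lambda>(\<sigma>, \<phi>). LINT s|lborel. w (s, \<phi>) * cis (- (\<sigma> * s)))"

text \<open>The multiplier is \<open>\<bar>\<sigma>\<bar> / (4 \<pi>)\<close>, and \<open>1 / (2 \<pi>)\<close> comes from the inverse Fourier transform.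
  The constant is the one in the filtered back-projection formula: in the Fourier inversion
  formula on the plane, \<open>\<xi> = \<sigma> (cos \<phi>, sin \<phi>)\<close> with \<open>\<sigma> \<in> \<real>\<close> and \<open>\<phi> \<in> (-\<pi>, \<pi>)\<close> covers the
  plane twice, with Jacobian \<open>\<bar>\<sigma>\<bar>\<close>, whence the multiplier
  \<open>\<bar>\<sigma>\<bar> (1/2) (2 \<pi>)\<^sup>-\<^sup>2 (2 \<pi>)\<close>.\<close>

definition riesz :: "(real \<times> real \<Rightarrow> complex) \<Rightarrow> real \<times> real \<Rightarrow> complex" where
  "riesz w = (\<lambda>(s, \<phi>). 1 / (2 * pi) *
     (LINT \<sigma>|lborel. complex_of_real (\<bar>\<sigma>\<bar> / (4 * pi)) * fourier_s w (\<sigma>, \<phi>) * cis (\<sigma> * s)))"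

text \<open>\<open>I\<^sup>-\<^sup>1(F(R \<chi>\<^sub>D))\<close> is in general not given by a pointwise Fourier integral, so \<open>I\<^sup>-\<^sup>1\<close> and \<open>R\<^sup>*\<close>
  act on distributions, by transposition: \<open>\<langle>I\<^sup>-\<^sup>1 v, w\<rangle> = \<langle>v, I\<^sup>-\<^sup>1 w\<rangle>\<close> (the multiplier is even) and
  \<open>\<langle>R\<^sup>* v, \<psi>\<rangle> = \<langle>v, R \<psi>\<rangle>\<close>. For a function \<open>g\<close> on \<open>M\<close> the latter is the pairing of \<open>\<psi>\<close> with
  \<open>x \<mapsto> \<integral>\<^bsub>-\<pi>\<^esub>\<^bsup>\<pi>\<^esup> g(x\<^sub>1 cos \<phi> + x\<^sub>2 sin \<phi>, \<phi>) d\<phi>\<close>. Pairings are bilinear, without conjugation.\<close>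

type_synonym functional = "(real \<times> real \<Rightarrow> complex) \<Rightarrow> complex"

definition distr_on :: "(real \<times> real) set \<Rightarrow> (real \<times> real \<Rightarrow> complex) \<Rightarrow> functional" where
  "distr_on A g = (\<lambda>\<psi>. set_lebesgue_integral lborel A (\<lambda>x. g x * \<psi> x))"

definition riesz_distr :: "functional \<Rightarrow> functional" where
  "riesz_distr v = (\<lambda>w. v (riesz w))"

definition radon_adjoint :: "functional \<Rightarrow> functional" where
  "radon_adjoint v = (\<lambda>\<psi>. v (radon \<psi>))"

definition same_distribution :: "functional \<Rightarrow> functional \<Rightarrow> bool" where
  "same_distribution u v \<longleftrightarrow> (\<forall>\<psi>. test_function \<psi> \<longrightarrow> u \<psi> = v \<psi>)"

definition f_CT :: "plane set \<Rightarrow> (plane \<Rightarrow> complex) \<Rightarrow> complex poly \<Rightarrow> functional" where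
  "f_CT D h F = (\<lambda>\<psi>. distr_on UNIV (\<lambda>x. h x + indicator D x) \<psi>
     + radon_adjoint (riesz_distr (distr_on M_dom (\<lambda>m. poly F (radon (indicator D) m)))) \<psi>)"

end

theory Submission
  imports Defs "HOL-Probability.Sinc_Integral"
begin

text \<open>
  Put \<open>G = F - F'\<close> and \<open>H = h' - h\<close>, and let \<open>\<ell>\<close> be the Radon transform of \<open>\<chi>\<^sub>D\<close>, the chord length.
  Let \<open>w\<close> denote \<open>I\<^sup>-\<^sup>1\<close> applied to the Radon transform of a test function \<open>\<psi>\<close>. Equality of the two
  reconstructions says that, for every \<open>\<psi>\<close>, the integral of \<open>G(\<ell>) w\<close> over \<open>M\<close> equals the integral of \<open>H \<psi>\<close>
  over the plane. Radial functions \<open>\<psi>(x) = P(|x|\<^sup>2)\<close> already decide the matter, because for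
  them \<open>w\<close> is explicit: it depends on \<open>s\<close> only, and
  \<open>w(s) = |s| / (2 \<pi>)\<close> times the integral of \<open>P'(v) / sqrt (s\<^sup>2 - v)\<close> over \<open>v < s\<^sup>2\<close> (\<open>riesz_radial\<close>).
  Although the filter \<open>I\<^sup>-\<^sup>1\<close> is not local, \<open>w(s)\<close> sees \<open>\<psi>\<close> only in the disc of radius \<open>|s|\<close>; this is
  finite speed of propagation, since \<open>w(s)\<close> is, up to the factor \<open>2 \<pi>\<close>, the value at the origin and at time \<open>s\<close>
  of the wave with initial position \<open>\<psi>\<close> and initial velocity \<open>0\<close>. Moreover \<open>w(s) \<ge> P(s\<^sup>2) / (2 \<pi>)\<close> as
  long as \<open>P\<close> increases on \<open>v < s\<^sup>2\<close>.

  Let \<open>R\<close> be the radius of the smallest disc about the origin that contains \<open>D\<close>, so that \<open>\<ell> = 0\<close> for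
  \<open>|s| \<ge> R\<close>. If \<open>\<psi>\<close> vanishes in this disc, then \<open>w = 0\<close> on \<open>|s| \<le> R\<close>, hence the integral of \<open>H \<psi>\<close> is
  \<open>0\<close>. The integral of \<open>H(l x) \<psi>(x)\<close>, for a \<open>\<psi>\<close> that vanishes in the unit disc, is therefore a smooth
  function of \<open>l\<close> that vanishes for \<open>l \<ge> R\<close>; consequently it is \<open>O(\<tau>\<^sup>n)\<close> at \<open>l = R - \<tau>\<close>, for each \<open>n\<close>
  (\<open>radial_mean_decay\<close>).

  Suppose \<open>G \<noteq> 0\<close> and let \<open>g t\<^sup>k\<close> be its term of lowest order. Take \<open>\<psi>\<close> to rise steeply from \<open>0\<close> to \<open>1\<close>
  near \<open>|x| = R - \<tau>\<close>. Only chords with \<open>|s| > R - \<tau>\<close> contribute, these are short, and so \<open>G(\<ell>)\<close> is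
  nearly \<open>g \<ell>\<^sup>k\<close>: there is no cancellation. Near a point of the closure of \<open>D\<close> at distance \<open>R\<close> from the
  origin, smoothness of the boundary puts into \<open>D\<close> a disc whose radius and whose distance from that
  point are comparable to \<open>\<tau>\<close> (\<open>balls_near_farthest_point\<close>). Its chords make the left-hand side at least a
  constant times \<open>\<tau>\<^sup>k\<^sup>+\<^sup>2\<close>, which contradicts the bound \<open>O(\<tau>\<^sup>k\<^sup>+\<^sup>3)\<close> when \<open>\<tau>\<close> is small.
\<close>

section \<open>Smooth functions on Euclidean space and radial test functions\<close>

lemma Ck_on_SucI:
  assumes "\<And>x. (f has_derivative f' x) (at x)" "\<And>v. Ck_on k (\<lambda>x. f' x v) UNIV"
  shows "Ck_on (Suc k) f UNIV"
proof -
  have "frechet_derivative f (at x) = f' x" for x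
    using frechet_derivative_at[OF assms(1)] by simp
  then show ?thesis using assms by (auto simp: differentiable_def)
qed

lemma Ck_on_SucD:
  assumes "Ck_on (Suc k) f UNIV"
  shows "(f has_derivative frechet_derivative f (at x)) (at x)"
    and "Ck_on k (\<lambda>x. frechet_derivative f (at x) v) UNIV"
  using assms by (simp_all add: frechet_derivative_works[symmetric])

lemma Ck_on_Suc_imp: "Ck_on (Suc k) f S \<Longrightarrow> Ck_on k f S"
proof (induction k arbitrary: f)
  case 0
  then show ?case
    by (auto intro!: continuous_at_imp_continuous_on differentiable_imp_continuous_within)
next
  case (Suc k)
  have "f differentiable at x" if "x \<in> S" for x using Suc.prems that by simp
  moreover have "Ck_on k (\<lambda>x. frechet_derivative f (at x) v) S" for v
    using Suc.IH Suc.prems by simp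
  ultimately show ?case by simp
qed

lemma Ck_on_const: "Ck_on k (\<lambda>x. c) UNIV"
proof (induction k arbitrary: c)
  case (Suc k)
  show ?case by (rule Ck_on_SucI[OF has_derivative_const Suc])
qed simp

lemma Ck_on_bounded_linear:
  assumes "bounded_linear L" shows "Ck_on k L UNIV"
proof (cases k)
  case 0
  then show ?thesis using assms by (simp add: linear_continuous_on)
next
  case (Suc k)
  show ?thesis unfolding Suc
    by (rule Ck_on_SucI[OF bounded_linear_imp_has_derivative[OF assms] Ck_on_const])
qed

lemma Ck_on_bounded_linear_compose:
  assumes "bounded_linear L" "Ck_on k f UNIV" shows "Ck_on k (\<lambda>x. L (f x)) UNIV"
  using assms(2)
proof (induction k arbitrary: f)
  case 0
  then show ?case using assms(1) by (simp add: bounded_linear.continuous_on)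
next
  case (Suc k)
  show ?case
    by (rule Ck_on_SucI[OF bounded_linear.has_derivative[OF assms(1) Ck_on_SucD(1)[OF Suc.prems]]
          Suc.IH[OF Ck_on_SucD(2)[OF Suc.prems]]])
qed

lemma Ck_on_add:
  assumes "Ck_on k f UNIV" "Ck_on k g UNIV" shows "Ck_on k (\<lambda>x. f x + g x) UNIV"
  using assms
proof (induction k arbitrary: f g)
  case (Suc k)
  show ?case
    by (rule Ck_on_SucI[OF has_derivative_add[OF Ck_on_SucD(1)[OF Suc.prems(1)] Ck_on_SucD(1)[OF Suc.prems(2)]]
          Suc.IH[OF Ck_on_SucD(2)[OF Suc.prems(1)] Ck_on_SucD(2)[OF Suc.prems(2)]]])
qed (simp add: continuous_on_add)

lemma Ck_on_mult:
  fixes f g :: "'a::euclidean_space \<Rightarrow> real"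
  assumes "Ck_on k f UNIV" "Ck_on k g UNIV" shows "Ck_on k (\<lambda>x. f x * g x) UNIV"
  using assms
proof (induction k arbitrary: f g)
  case (Suc k)
  show ?case
    by (rule Ck_on_SucI[OF has_derivative_mult[OF Ck_on_SucD(1)[OF Suc.prems(1)] Ck_on_SucD(1)[OF Suc.prems(2)]]])
      (intro Ck_on_add Suc.IH Ck_on_Suc_imp[OF Suc.prems(1)] Ck_on_Suc_imp[OF Suc.prems(2)]
        Ck_on_SucD(2)[OF Suc.prems(1)] Ck_on_SucD(2)[OF Suc.prems(2)])
qed (simp add: continuous_on_mult)

text \<open>The factor \<open>f' \<circ> g\<close> in the chain rule is again a composition with the same inner function, so the
  induction has to generalise over the outer function only.\<close>

lemma Ck_on_compose:
  fixes f :: "real \<Rightarrow> real" and g :: "'a::euclidean_space \<Rightarrow> real"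
  assumes "Ck_on k f UNIV" "Ck_on k g UNIV" shows "Ck_on k (\<lambda>x. f (g x)) UNIV"
  using assms
proof (induction k arbitrary: f)
  case 0
  then show ?case by (auto intro: continuous_on_compose2)
next
  case (Suc k)
  define f' where "f' u = frechet_derivative f (at u) 1" for u
  have d: "((\<lambda>x. f (g x)) has_derivative (\<lambda>v. frechet_derivative g (at x) v * f' (g x))) (at x)" for x
  proof -
    have "frechet_derivative f (at u) h = h * f' u" for u h
      using linear_scale[OF has_derivative_linear[OF Ck_on_SucD(1)[OF Suc.prems(1)]], of u h 1]
      unfolding f'_def by simp
    then show ?thesis
      using has_derivative_compose[OF Ck_on_SucD(1)[OF Suc.prems(2)] Ck_on_SucD(1)[OF Suc.prems(1)], of x] by simp
  qed
  have f': "Ck_on k f' UNIV"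
    unfolding f'_def by (rule Ck_on_SucD(2)[OF Suc.prems(1)])
  show ?case
    by (rule Ck_on_SucI[OF d], rule Ck_on_mult[OF Ck_on_SucD(2)[OF Suc.prems(2)]],
        rule Suc.IH[OF f' Ck_on_Suc_imp[OF Suc.prems(2)]])
qed

lemma smooth_derivative:
  fixes f :: "real \<Rightarrow> real"
  assumes "smooth_on f UNIV"
  obtains f' where "\<And>u. (f has_real_derivative f' u) (at u)" "smooth_on f' UNIV"
proof
  define f' where "f' u = frechet_derivative f (at u) 1" for u
  have "Ck_on (Suc k) f UNIV" for k using assms by (simp add: smooth_on_def del: Ck_on.simps)
  note D = Ck_on_SucD[OF this]
  show "smooth_on f' UNIV" unfolding smooth_on_def f'_def using D(2) by blast
  show "(f has_real_derivative f' u) (at u)" for u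
  proof -
    have "frechet_derivative f (at u) = (\<lambda>h. f' u * h)"
    proof
      fix h :: real
      show "frechet_derivative f (at u) h = f' u * h"
        using linear_scale[OF has_derivative_linear[OF D(1)], of u h 1]
        unfolding f'_def by simp
    qed
    then show ?thesis unfolding has_field_derivative_def using D(1)[of u] by simp
  qed
qed

text \<open>For \<open>Q = 1\<close> this is \<open>exp (-1/x)\<close>, continued by \<open>0\<close>. The polynomial is a parameter because the
  derivatives of this function are of the same form.\<close>

definition flat :: "real poly \<Rightarrow> real \<Rightarrow> real" where
  "flat Q x = (if x \<le> 0 then 0 else poly Q (1 / x) * exp (- (1 / x)))"

lemma poly_times_exp_tendsto_0:
  fixes Q :: "real poly"
  shows "((\<lambda>y. poly Q y * exp (- y)) \<longlongrightarrow> 0) at_top"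
proof -
  have "((\<lambda>y. \<Sum>i\<le>degree Q. coeff Q i * (y ^ i / exp y)) \<longlongrightarrow> (\<Sum>i\<le>degree Q. coeff Q i * 0)) at_top"
    by (intro tendsto_sum tendsto_mult tendsto_const tendsto_power_div_exp_0)
  moreover have "(\<Sum>i\<le>degree Q. coeff Q i * (y ^ i / exp y)) = poly Q y * exp (- y)" for y
    by (simp add: poly_altdef sum_distrib_right exp_minus divide_inverse mult.assoc)
  ultimately show ?thesis by simp
qed

text \<open>In the variable \<open>y = 1/x\<close> the function is \<open>Q(y) exp (-y)\<close>, whose derivative with respect to \<open>x\<close> is
  \<open>y\<^sup>2 (Q - Q')(y) exp (-y)\<close>. At \<open>0\<close> the difference quotient from the right is \<open>y Q(y) exp (-y)\<close>, which tends to \<open>0\<close>.\<close>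

lemma flat_has_derivative:
  "(flat Q has_real_derivative flat ([:0, 0, 1:] * (Q - pderiv Q)) x) (at x)"
proof -
  consider "x < 0" | "x = 0" | "x > 0" by linarith
  then show ?thesis
  proof cases
    case 1
    have "((\<lambda>x. 0) has_real_derivative flat ([:0, 0, 1:] * (Q - pderiv Q)) x) (at x)"
      using 1 by (simp add: flat_def)
    then show ?thesis
      by (rule has_field_derivative_transform_within_open[where S="{..<0}"]) (use 1 in \<open>auto simp: flat_def\<close>)
  next
    case 3
    have "((\<lambda>x. poly Q (1 / x) * exp (- (1 / x))) has_real_derivative flat ([:0, 0, 1:] * (Q - pderiv Q)) x) (at x)"
      using 3 by (auto intro!: derivative_eq_intros poly_DERIV[THEN DERIV_chain2] simp: flat_def field_simps power2_eq_square)
    then show ?thesis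
      by (rule has_field_derivative_transform_within_open[where S="{0<..}"]) (use 3 in \<open>auto simp: flat_def\<close>)
  next
    case 2
    have "((\<lambda>y. poly (pCons 0 Q) y * exp (- y)) \<longlongrightarrow> 0) at_top" by (rule poly_times_exp_tendsto_0)
    then have "((\<lambda>h. poly (pCons 0 Q) (inverse h) * exp (- inverse h)) \<longlongrightarrow> 0) (at_right 0)"
      by (rule filterlim_compose[OF _ filterlim_inverse_at_top_right])
    then have r: "((\<lambda>h. (flat Q h - flat Q 0) / (h - 0)) \<longlongrightarrow> 0) (at_right 0)"
      by (rule Lim_transform_eventually)
        (auto simp: eventually_at_filter flat_def field_simps intro!: always_eventually)
    have l: "((\<lambda>h. (flat Q h - flat Q 0) / (h - 0)) \<longlongrightarrow> 0) (at_left 0)"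
      by (rule Lim_transform_eventually[OF tendsto_const])
        (auto simp: eventually_at_filter flat_def intro!: always_eventually)
    have "((\<lambda>h. (flat Q h - flat Q 0) / (h - 0)) \<longlongrightarrow> 0) (at 0)"
      using l r by (rule filterlim_split_at)
    then show ?thesis unfolding 2 has_field_derivative_iff by (simp add: flat_def)
  qed
qed

lemma Ck_on_flat: "Ck_on k (flat Q) UNIV"
proof (induction k arbitrary: Q)
  case 0
  then show ?case by (auto intro!: DERIV_continuous_on[OF has_field_derivative_at_within[OF flat_has_derivative]])
next
  case (Suc k)
  show ?case
    by (rule Ck_on_SucI[OF flat_has_derivative[unfolded has_field_derivative_def]])
      (intro Ck_on_mult Ck_on_const Suc.IH)
qed

text \<open>Applying \<open>exp (-1/t)\<close> twice gives a step without a quotient or a primitive: for \<open>t \<ge> 1\<close> the inner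
  value is at least \<open>exp (-1)\<close>, so the outer argument is not positive.\<close>

definition smooth_step :: "real \<Rightarrow> real" where
  "smooth_step t = 1 - exp 1 * flat 1 (1 - exp 1 * flat 1 t)"

lemma Ck_on_affine: 
  fixes f :: "'a::euclidean_space \<Rightarrow> real"
  assumes "Ck_on k f UNIV" shows "Ck_on k (\<lambda>x. a + b * f x) UNIV"
  by (intro Ck_on_add Ck_on_mult Ck_on_const assms)

lemma smooth_step_smooth: "Ck_on k smooth_step UNIV"
proof -
  have "smooth_step = (\<lambda>t. 1 + (- exp 1) * flat 1 (1 + (- exp 1) * flat 1 t))"
    by (auto simp: smooth_step_def)
  moreover have "Ck_on k (\<lambda>t. 1 + (- exp 1) * flat 1 (1 + (- exp 1) * flat 1 t)) UNIV"
    by (rule Ck_on_affine, rule Ck_on_compose[OF Ck_on_flat], rule Ck_on_affine, rule Ck_on_flat)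
  ultimately show ?thesis by simp
qed

lemma flat_1_mono: "mono (flat 1)"
proof (rule monoI)
  fix x y :: real assume "x \<le> y"
  then show "flat 1 x \<le> flat 1 y" by (auto simp: flat_def field_simps)
qed

lemma smooth_step_mono: "mono smooth_step"
proof (rule monoI)
  fix x y :: real assume "x \<le> y"
  then have "flat 1 x \<le> flat 1 y" using flat_1_mono by (simp add: monoD)
  then have "flat 1 (1 - exp 1 * flat 1 y) \<le> flat 1 (1 - exp 1 * flat 1 x)"
    by (intro monoD[OF flat_1_mono]) simp
  then show "smooth_step x \<le> smooth_step y" by (simp add: smooth_step_def)
qed

lemma smooth_step_0: "t \<le> 0 \<Longrightarrow> smooth_step t = 0"
  by (simp add: smooth_step_def flat_def exp_minus)

lemma smooth_step_1: assumes "t \<ge> 1" shows "smooth_step t = 1"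
proof -
  have "flat 1 1 \<le> flat 1 t" using flat_1_mono assms by (simp add: monoD)
  then have "1 \<le> exp 1 * flat 1 t" by (simp add: flat_def[of 1 1] exp_minus field_simps)
  then show ?thesis by (simp add: smooth_step_def flat_def[of 1 "1 - _"])
qed

lemma smooth_step_bounds: "0 \<le> smooth_step t" "smooth_step t \<le> 1"
proof -
  show "0 \<le> smooth_step t" using monoD[OF smooth_step_mono, of "min 0 t" t] smooth_step_0 by simp
  show "smooth_step t \<le> 1" using monoD[OF smooth_step_mono, of t "max 1 t"] smooth_step_1 by simp
qed

lemma radial_test_function:
  fixes P :: "real \<Rightarrow> real"
  assumes "smooth_on P UNIV" "\<And>u. u \<ge> b \<Longrightarrow> P u = 0"
  shows "test_function (\<lambda>x::plane. complex_of_real (P ((norm x)\<^sup>2)))"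
proof -
  have n: "(norm x)\<^sup>2 = fst x * fst x + snd x * snd x" for x :: plane
    by (cases x) (simp add: norm_Pair power2_eq_square)
  have "Ck_on k (\<lambda>x::plane. complex_of_real (P ((norm x)\<^sup>2))) UNIV" for k
    unfolding n
  proof (rule Ck_on_bounded_linear_compose[OF bounded_linear_of_real],
      rule Ck_on_compose[where f=P and g="\<lambda>x::plane. fst x * fst x + snd x * snd x"])
    show "Ck_on k P UNIV" using assms(1) unfolding smooth_on_def by blast
    show "Ck_on k (\<lambda>x::plane. fst x * fst x + snd x * snd x) UNIV"
      by (intro Ck_on_add Ck_on_mult Ck_on_bounded_linear bounded_linear_fst bounded_linear_snd)
  qed
  moreover have "bounded {x::plane. complex_of_real (P ((norm x)\<^sup>2)) \<noteq> 0}"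
  proof (rule boundedI)
    fix x :: plane assume "x \<in> {x. complex_of_real (P ((norm x)\<^sup>2)) \<noteq> 0}"
    then have "P ((norm x)\<^sup>2) \<noteq> 0" by simp
    then have "(norm x)\<^sup>2 \<le> \<bar>b\<bar>" using assms(2) by (smt (verit))
    then show "norm x \<le> sqrt \<bar>b\<bar>" using real_le_rsqrt by blast
  qed
  ultimately show ?thesis by (simp add: test_function_def smooth_on_def)
qed

text \<open>The variable \<open>u\<close> stands for the square of \<open>|x|\<close>, and \<open>\<delta>\<close> controls how steeply the function rises at the unit
  circle. It descends only after \<open>u = 4\<close>: scaled by a factor of at least \<open>R / 2\<close>, the circle \<open>u = 4\<close>
  encloses the disc of radius \<open>R\<close>.\<close>

definition annulus_profile :: "real \<Rightarrow> real \<Rightarrow> real" where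
  "annulus_profile \<delta> u = smooth_step ((u - 1) / \<delta>) - smooth_step (u - 4)"

lemma annulus_profile_props:
  assumes "0 < \<delta>" "\<delta> \<le> 1"
  shows "u \<le> 1 \<Longrightarrow> annulus_profile \<delta> u = 0" "u \<ge> 5 \<Longrightarrow> annulus_profile \<delta> u = 0"
    "1 + \<delta> \<le> u \<Longrightarrow> u \<le> 4 \<Longrightarrow> annulus_profile \<delta> u = 1"
    "\<bar>annulus_profile \<delta> u\<bar> \<le> 1" "u \<le> 4 \<Longrightarrow> annulus_profile \<delta> u \<ge> 0"
    "u \<le> u' \<Longrightarrow> u' \<le> 4 \<Longrightarrow> annulus_profile \<delta> u \<le> annulus_profile \<delta> u'"
    "smooth_on (annulus_profile \<delta>) UNIV"
proof -
  show "annulus_profile \<delta> u = 0" if "u \<le> 1"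
    using that assms by (simp add: annulus_profile_def smooth_step_0 divide_nonpos_pos)
  show "annulus_profile \<delta> u = 0" if "u \<ge> 5"
    using that assms by (simp add: annulus_profile_def smooth_step_1 field_simps)
  show "annulus_profile \<delta> u = 1" if "1 + \<delta> \<le> u" "u \<le> 4"
    using that assms by (simp add: annulus_profile_def smooth_step_0 smooth_step_1 field_simps)
  show "\<bar>annulus_profile \<delta> u\<bar> \<le> 1"
    using smooth_step_bounds[of "(u - 1) / \<delta>"] smooth_step_bounds[of "u - 4"] by (simp add: annulus_profile_def)
  show "annulus_profile \<delta> u \<ge> 0" if "u \<le> 4"
    using that smooth_step_bounds by (simp add: annulus_profile_def smooth_step_0)
  show "annulus_profile \<delta> u \<le> annulus_profile \<delta> u'" if "u \<le> u'" "u' \<le> 4"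
    using that assms by (simp add: annulus_profile_def smooth_step_0) (intro monoD[OF smooth_step_mono] divide_right_mono, auto)
  have "Ck_on k (\<lambda>u. smooth_step (- (1 / \<delta>) + (1 / \<delta>) * u) + (- 1) * smooth_step (- 4 + 1 * u)) UNIV" for k
    by (intro Ck_on_add Ck_on_mult Ck_on_const)
      (rule Ck_on_compose[OF smooth_step_smooth], rule Ck_on_affine, rule Ck_on_bounded_linear, rule bounded_linear_ident)+
  moreover have "(\<lambda>u. smooth_step (- (1 / \<delta>) + (1 / \<delta>) * u) + (- 1) * smooth_step (- 4 + 1 * u)) = annulus_profile \<delta>"
    by (auto simp: annulus_profile_def fun_eq_iff diff_divide_distrib)
  ultimately show "smooth_on (annulus_profile \<delta>) UNIV" by (simp add: smooth_on_def)
qed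

lemma smooth_rescale:
  fixes f :: "real \<Rightarrow> real"
  assumes "smooth_on f UNIV" shows "smooth_on (\<lambda>u. f (u / c)) UNIV"
proof -
  have "Ck_on k (\<lambda>u. f (0 + (1/c) * u)) UNIV" for k
  proof (rule Ck_on_compose[where f=f and g="\<lambda>u. 0 + (1/c) * u"])
    show "Ck_on k f UNIV" using assms unfolding smooth_on_def by blast
    show "Ck_on k (\<lambda>u. 0 + (1/c) * u) UNIV"
      by (rule Ck_on_affine, rule Ck_on_bounded_linear, rule bounded_linear_ident)
  qed
  then show ?thesis by (simp add: smooth_on_def)
qed

section \<open>Iterated differences of dilations\<close>

text \<open>Forward differences replace derivatives of the function \<open>l \<mapsto> \<integral> H(l x) \<psi>(x) dx\<close>: they commute with
  the integral by linearity.\<close>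

fun diff_iter :: "nat \<Rightarrow> real \<Rightarrow> (real \<Rightarrow> complex) \<Rightarrow> real \<Rightarrow> complex" where
  "diff_iter 0 \<tau> f l = f l"
| "diff_iter (Suc n) \<tau> f l = diff_iter n \<tau> f (l + \<tau>) - diff_iter n \<tau> f l"

lemma diff_iter_linear:
  "diff_iter n \<tau> (\<lambda>l. a * f l + b * g l) l = a * diff_iter n \<tau> f l + b * diff_iter n \<tau> g l"
  by (induction n arbitrary: l) (auto simp: algebra_simps)

lemma diff_iter_has_vector_derivative:
  assumes "\<And>l. (f has_vector_derivative f' l) (at l)"
  shows "(diff_iter n \<tau> f has_vector_derivative diff_iter n \<tau> f' l) (at l)"
proof (induction n arbitrary: l)
  case 0
  have "diff_iter 0 \<tau> f = f" by auto
  then show ?case using assms by simp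
next
  case (Suc n)
  have "((\<lambda>l. diff_iter n \<tau> f (l + \<tau>)) has_vector_derivative 1 *\<^sub>R diff_iter n \<tau> f' (l + \<tau>)) (at l)"
    by (rule vector_diff_chain_at[unfolded o_def, where f="\<lambda>l. l + \<tau>"])
      (auto intro!: derivative_eq_intros Suc)
  from has_vector_derivative_diff[OF this Suc]
  show ?case by (simp add: fun_eq_iff[symmetric]) 
qed

lemma diff_iter_vanishing:
  assumes "\<And>l. l \<ge> l0 + \<tau> \<Longrightarrow> f l = 0" "\<tau> \<ge> 0" "l \<ge> l0 + \<tau>"
  shows "diff_iter n \<tau> f l = 0"
  using assms(3) by (induction n arbitrary: l) (use assms in auto)

text \<open>Every node of the difference except \<open>l0\<close> itself lies where \<open>f\<close> vanishes.\<close>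

lemma norm_diff_iter_eq:
  assumes "\<And>l. l \<ge> l0 + \<tau> \<Longrightarrow> f l = 0" "\<tau> \<ge> 0"
  shows "norm (diff_iter n \<tau> f l0) = norm (f l0)"
proof (induction n)
  case (Suc n)
  have "diff_iter n \<tau> f (l0 + \<tau>) = 0" by (rule diff_iter_vanishing[OF assms(1) assms(2)]) auto
  then show ?case using Suc by simp
qed simp

text \<open>By the mean value inequality each difference gains a factor \<open>\<tau>\<close> and costs a derivative of \<open>l \<mapsto> H(l x)\<close>. That derivative
  is \<open>x\<^sub>1 (\<partial>\<^sub>1 H)(l x) + x\<^sub>2 (\<partial>\<^sub>2 H)(l x)\<close>, to which the induction hypothesis applies. The interval
  for \<open>l\<close> has to grow by \<open>1 \<ge> \<tau>\<close> in each step.\<close>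

lemma diff_iter_dilation_bound:
  fixes H :: "plane \<Rightarrow> complex"
  assumes "smooth_on H UNIV" 
  shows "\<exists>C. \<forall>x l \<tau>. norm x \<le> X \<longrightarrow> 0 \<le> l \<longrightarrow> l \<le> L \<longrightarrow> 0 \<le> \<tau> \<longrightarrow> \<tau> \<le> 1 \<longrightarrow>
     norm (diff_iter n \<tau> (\<lambda>l. H (l *\<^sub>R x)) l) \<le> C * \<tau> ^ n"
  using assms
proof (induction n arbitrary: H L)
  case 0
  have "continuous_on (cball 0 (\<bar>L\<bar> * \<bar>X\<bar>)) H"
  proof -
    have "Ck_on 0 H UNIV" using 0 unfolding smooth_on_def by blast
    then have "continuous_on UNIV H" by simp
    then show ?thesis using continuous_on_subset by blast
  qed
  then have "bounded (H ` cball 0 (\<bar>L\<bar> * \<bar>X\<bar>))"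
    by (intro compact_imp_bounded compact_continuous_image compact_cball)
  then obtain C where C: "\<And>y. norm y \<le> \<bar>L\<bar> * \<bar>X\<bar> \<Longrightarrow> norm (H y) \<le> C"
    unfolding bounded_iff by (metis imageI mem_cball_0)
  have "norm (H (l *\<^sub>R x)) \<le> C" if "norm x \<le> X" "0 \<le> l" "l \<le> L" for x l
    by (rule C) (use that in \<open>auto intro!: mult_mono\<close>)
  then show ?case by (intro exI[of _ C]) (simp del: split_paired_All)
next
  case (Suc n)
  have Ck: "Ck_on (Suc k) H UNIV" for k using Suc.prems by (simp add: smooth_on_def del: Ck_on.simps)
  define H1 where "H1 x = frechet_derivative H (at x) (1, 0)" for x
  define H2 where "H2 x = frechet_derivative H (at x) (0, 1)" for x
  have "smooth_on H1 UNIV" "smooth_on H2 UNIV"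
    using Ck unfolding smooth_on_def H1_def H2_def Ck_on.simps(2) by blast+
  from Suc.IH[OF this(1), of "L+1"] Suc.IH[OF this(2), of "L+1"]
  obtain C1 C2 where
    C1: "\<And>x l \<tau>. norm x \<le> X \<Longrightarrow> 0 \<le> l \<Longrightarrow> l \<le> L+1 \<Longrightarrow> 0 \<le> \<tau> \<Longrightarrow> \<tau> \<le> 1 \<Longrightarrow>
       norm (diff_iter n \<tau> (\<lambda>l. H1 (l *\<^sub>R x)) l) \<le> C1 * \<tau> ^ n" and
    C2: "\<And>x l \<tau>. norm x \<le> X \<Longrightarrow> 0 \<le> l \<Longrightarrow> l \<le> L+1 \<Longrightarrow> 0 \<le> \<tau> \<Longrightarrow> \<tau> \<le> 1 \<Longrightarrow>
       norm (diff_iter n \<tau> (\<lambda>l. H2 (l *\<^sub>R x)) l) \<le> C2 * \<tau> ^ n" by blast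
  have "norm (diff_iter (Suc n) \<tau> (\<lambda>l. H (l *\<^sub>R x)) l) \<le> (X * C1 + X * C2) * \<tau> ^ Suc n"
    if x: "norm x \<le> X" and l: "0 \<le> l" "l \<le> L" and \<tau>: "0 \<le> \<tau>" "\<tau> \<le> 1" for x :: plane and l \<tau>
  proof -
    define f' where "f' l = of_real (fst x) * H1 (l *\<^sub>R x) + of_real (snd x) * H2 (l *\<^sub>R x)" for l
    have "((\<lambda>l. H (l *\<^sub>R x)) has_vector_derivative f' l) (at l)" for l
    proof -
      let ?D = "frechet_derivative H (at (l *\<^sub>R x))"
      have D: "(H has_derivative ?D) (at (l *\<^sub>R x))"
        using Ck[of 0] unfolding Ck_on.simps(2) frechet_derivative_works by blast
      have "((\<lambda>l. H (l *\<^sub>R x)) has_derivative (\<lambda>h. ?D (h *\<^sub>R x))) (at l)"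
        by (rule has_derivative_compose[where g=H and f="\<lambda>l. l *\<^sub>R x" and g'="?D" and x=l and s=UNIV, OF _ D]) (auto intro!: derivative_eq_intros)
      moreover have "?D (h *\<^sub>R x) = h *\<^sub>R f' l" for h
      proof -
        have lin: "linear ?D" using D by (rule has_derivative_linear)
        have xx: "x = fst x *\<^sub>R (1,0) + snd x *\<^sub>R (0,1)" by (cases x) simp
        have "?D x = fst x *\<^sub>R ?D (1,0) + snd x *\<^sub>R ?D (0,1)"
          by (subst (2) xx) (simp only: linear_add[OF lin] linear_scale[OF lin])
        then show ?thesis unfolding linear_scale[OF lin] f'_def H1_def H2_def
          by (simp add: scaleR_conv_of_real)
      qed
      ultimately show ?thesis by (simp add: has_vector_derivative_def)
    qed
    note D = diff_iter_has_vector_derivative[OF this, of n \<tau>]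
    have C0: "0 \<le> X" using x norm_ge_zero order_trans by blast
    have b: "norm (diff_iter n \<tau> f' u) \<le> (X * C1 + X * C2) * \<tau> ^ n" if "u \<in> {l..l+\<tau>}" for u
    proof -
      have "norm (diff_iter n \<tau> f' u) \<le> \<bar>fst x\<bar> * norm (diff_iter n \<tau> (\<lambda>l. H1 (l *\<^sub>R x)) u)
          + \<bar>snd x\<bar> * norm (diff_iter n \<tau> (\<lambda>l. H2 (l *\<^sub>R x)) u)"
        unfolding f'_def diff_iter_linear by (rule order_trans[OF norm_triangle_ineq]) (simp add: norm_mult)
      also have "\<dots> \<le> X * (C1 * \<tau> ^ n) + X * (C2 * \<tau> ^ n)"
        using that l \<tau> x C0 norm_fst_le[of "fst x" "snd x"] norm_snd_le[of "snd x" "fst x"]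
        by (intro add_mono mult_mono C1 C2) auto
      finally show ?thesis by (simp add: algebra_simps)
    qed
    have "norm (diff_iter n \<tau> (\<lambda>l. H (l *\<^sub>R x)) (l + \<tau>) - diff_iter n \<tau> (\<lambda>l. H (l *\<^sub>R x)) l)
        \<le> ((X * C1 + X * C2) * \<tau> ^ n) * norm (l + \<tau> - l)"
    proof (rule differentiable_bound[where S="{l..l+\<tau>}"])
      fix u assume u: "u \<in> {l..l+\<tau>}"
      show "(diff_iter n \<tau> (\<lambda>l. H (l *\<^sub>R x)) has_derivative (\<lambda>h. h *\<^sub>R diff_iter n \<tau> f' u)) (at u within {l..l+\<tau>})"
        using D[of u] has_derivative_at_withinI unfolding has_vector_derivative_def by blast
      show "onorm (\<lambda>h. h *\<^sub>R diff_iter n \<tau> f' u) \<le> (X * C1 + X * C2) * \<tau> ^ n"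
        using b[OF u] by (intro onorm_le) (auto simp: mult.commute intro!: mult_left_mono)
    qed (use \<tau> in auto)
    then show ?thesis using \<tau> by (simp add: algebra_simps)
  qed
  then show ?case by blast
qed

section \<open>Chords of a domain near its farthest boundary point\<close>

text \<open>Where the derivative of \<open>\<rho>\<close> does not vanish, \<open>\<rho> < 0\<close> holds in a truncated open cone with vertex \<open>p\<close>; a
  ball inscribed in the cone stays in it when it is shrunk towards \<open>p\<close>.\<close>

lemma balls_below_boundary_point:
  fixes \<rho> :: "'a::real_normed_vector \<Rightarrow> real"
  assumes U: "open U" "p \<in> U" and \<rho>: "\<rho> differentiable at p" "frechet_derivative \<rho> (at p) \<noteq> (\<lambda>v. 0)"
    and p: "\<rho> p \<le> 0" and D: "{x\<in>U. \<rho> x < 0} \<subseteq> D"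
  obtains c r0 where "0 < c" "c \<le> 1" "0 < r0"
    "\<And>r. 0 < r \<Longrightarrow> r < r0 \<Longrightarrow> \<exists>x. norm (x - p) \<le> r \<and> ball x (c * r) \<subseteq> D"
proof -
  define g where "g = frechet_derivative \<rho> (at p)"
  have g: "(\<rho> has_derivative g) (at p)" using \<rho>(1) unfolding g_def frechet_derivative_works .
  interpret g: bounded_linear g using g by (rule has_derivative_bounded_linear)
  obtain v0 where "g v0 \<noteq> 0" using \<rho>(2) g_def by auto
  then obtain v1 where v1: "g v1 < 0" by (metis g.neg neg_less_0_iff_less linorder_neqE_linordered_idom)
  define v where "v = v1 /\<^sub>R norm v1"
  have "v1 \<noteq> 0" using v1 g.zero by auto
  then have v: "norm v = 1" "g v < 0" using v1 by (auto simp: v_def g.scaleR mult_less_0_iff)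
  define m where "m = - g v"
  have m: "m > 0" using v m_def by simp
  obtain K where K: "K > 0" "\<And>x. \<bar>g x\<bar> \<le> norm x * K" using g.pos_bounded by auto
  obtain d where d: "d > 0" "\<And>y. norm (y - p) < d \<Longrightarrow> norm (\<rho> y - \<rho> p - g (y - p)) \<le> m / 8 * norm (y - p)"
    using g m unfolding has_derivative_at_alt by (meson divide_pos_pos zero_less_numeral)
  obtain e where e: "e > 0" "ball p e \<subseteq> U" using U open_contains_ball by blast
  define c where "c = min 1 (m / (4 * K))"
  define r0 where "r0 = min d e / 2"
  have c: "0 < c" "c \<le> 1" "K * c \<le> m / 4"
    using m K(1) by (auto simp: c_def min_def field_simps)
  have r0: "r0 > 0" using d(1) e(1) by (simp add: r0_def)
  have "\<exists>x. norm (x - p) \<le> r \<and> ball x (c * r) \<subseteq> D" if r: "0 < r" "r < r0" for r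
  proof (intro exI conjI)
    show "norm (p + r *\<^sub>R v - p) \<le> r" using v r by simp
    show "ball (p + r *\<^sub>R v) (c * r) \<subseteq> D"
    proof
      fix y assume "y \<in> ball (p + r *\<^sub>R v) (c * r)"
      then have y: "norm (y - (p + r *\<^sub>R v)) < c * r" by (simp add: dist_norm norm_minus_commute)
      define w where "w = y - (p + r *\<^sub>R v)"
      have yp: "y - p = r *\<^sub>R v + w" by (simp add: w_def)
      have cr: "c * r \<le> r" using c r by (simp add: mult_left_le_one_le)
      have n: "norm (y - p) \<le> 2 * r"
        unfolding yp 
      proof -
        have "norm (r *\<^sub>R v) = r" "norm w < c * r" using v r y by (simp_all add: w_def)
        then show "norm (r *\<^sub>R v + w) \<le> 2 * r" using norm_triangle_ineq[of "r *\<^sub>R v" w] cr by linarith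
      qed
      have "norm (y - p) < d" "norm (y - p) < e" using n r by (auto simp: r0_def)
      then have "y \<in> ball p e" "\<bar>\<rho> y - \<rho> p - g (y - p)\<bar> \<le> m / 8 * norm (y - p)"
        using d(2)[of y] by (auto simp: dist_norm norm_minus_commute)
      then have yU: "y \<in> U" and "\<rho> y \<le> \<rho> p + g (y - p) + m / 8 * norm (y - p)"
        using e(2) by (blast, linarith)
      moreover have "m / 8 * norm (y - p) \<le> m / 4 * r" using n m by simp
      moreover have "g (y - p) \<le> - m * r + m / 4 * r"
      proof -
        have "g w \<le> norm w * K" using K(2)[of w] by simp
        also have "\<dots> \<le> (c * r) * K" using y K(1) by (simp add: w_def)
        also have "\<dots> = (K * c) * r" by simp
        also have "\<dots> \<le> m / 4 * r" using c(3) r by (intro mult_right_mono) auto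
        finally show ?thesis unfolding yp g.add g.scaleR by (simp add: m_def algebra_simps)
      qed
      ultimately have "\<rho> y \<le> - m * r + m / 4 * r + m / 4 * r" using p by linarith
      also have "\<dots> < 0" using m r by (simp add: field_simps)
      finally show "y \<in> D" using yU D by auto
    qed
  qed
  then show ?thesis using that[OF c(1,2) r0] by blast
qed

text \<open>A point of the closure of \<open>D\<close> at maximal distance \<open>R\<close> from the origin is a boundary point of \<open>D1\<close>
  or of \<open>D2\<close>, and the balls inside \<open>D\<close> that shrink towards it approach the circle of radius \<open>R\<close> linearly.\<close>

lemma balls_near_farthest_point:
  assumes D1: "smooth_sc_domain D1" and D2: "smooth_sc_domain D2" and D: "D = D1 \<union> D2"
  obtains R c r0 where "0 < R" "D \<subseteq> cball 0 R" "0 < c" "c \<le> 1" "0 < r0"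
    "\<And>r. 0 < r \<Longrightarrow> r < r0 \<Longrightarrow> \<exists>x. R - r \<le> norm x \<and> norm x \<le> R \<and> ball x (c * r) \<subseteq> D"
proof -
  note sd = D1[unfolded smooth_sc_domain_def] D2[unfolded smooth_sc_domain_def]
  have oD: "open D" and bD: "bounded D" and neD: "D \<noteq> {}" using sd D by auto
  have "compact (closure D)" using bD by (simp add: compact_closure)
  moreover have "closure D \<noteq> {}" using neD by simp
  ultimately obtain p where p: "p \<in> closure D" "\<And>x. x \<in> closure D \<Longrightarrow> norm x \<le> norm p"
    using continuous_attains_sup[of "closure D" norm] continuous_on_norm_id by blast
  define R where "R = norm p"
  have DR: "D \<subseteq> cball 0 R" using p(2) closure_subset[of D] by (auto simp: R_def)
  have pD: "x \<notin> D" if x: "norm x = R" for x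
  proof
    assume "x \<in> D"
    then obtain e where e: "e > 0" "cball x e \<subseteq> D" using oD open_contains_cball by blast
    \<comment> \<open>A point of \<open>D\<close> farther from the origin than \<open>x\<close>.\<close>
    define y where "y = (if x = 0 then (e, 0) else x + (e / norm x) *\<^sub>R x)"
    have "y \<in> cball x e" using e(1) by (auto simp: y_def dist_norm)
    then have "norm y \<le> R" using e(2) DR by (metis mem_cball_0 subsetD)
    moreover have "norm y > R"
    proof (cases "x = 0")
      case True then show ?thesis using e(1) x by (simp add: y_def norm_Pair)
    next
      case False
      have "y = (1 + e / norm x) *\<^sub>R x" using False by (simp add: y_def algebra_simps)
      then have "norm y = (1 + e / norm x) * norm x" using e(1) by simp
      then show ?thesis using False e(1) x by (simp add: algebra_simps split: if_splits) (use x in auto)?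
    qed
    ultimately show False by simp
  qed
  have Rpos: "R > 0"
  proof (rule ccontr)
    assume "\<not> R > 0"
    then have "R = 0" by (simp add: R_def)
    then have "D \<subseteq> {0}" using DR by auto
    then show False using neD pD[of 0] \<open>R = 0\<close> by auto
  qed
  obtain E where E: "E \<subseteq> D" "open E" "smooth_boundary E" "p \<in> closure E"
  proof -
    consider "p \<in> closure D1" | "p \<in> closure D2" using p(1) unfolding D closure_Un by blast
    then show ?thesis by cases (use that[of D1] that[of D2] sd D in auto)
  qed
  have "p \<in> frontier E" using E pD[of p] by (auto simp: frontier_def R_def interior_open)
  then obtain U and \<rho> :: "plane \<Rightarrow> real" where U: "open U" "p \<in> U" and sm: "smooth_on \<rho> U"
      and nz: "\<forall>x\<in>U. frechet_derivative \<rho> (at x) \<noteq> (\<lambda>v. 0)" and EU: "E \<inter> U = {x\<in>U. \<rho> x < 0}"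
    using E(3) unfolding smooth_boundary_def by blast
  have "Ck_on (Suc 0) \<rho> U" using sm unfolding smooth_on_def by blast
  then have diff: "\<rho> differentiable at p" using U(2) by simp
  have rp: "\<rho> p \<le> 0"
  proof (rule ccontr)
    assume "\<not> \<rho> p \<le> 0"
    moreover have "isCont \<rho> p" using diff by (rule differentiable_imp_continuous_within)
    ultimately have "\<forall>\<^sub>F x in nhds p. \<rho> x > 0"
      unfolding continuous_at tendsto_at_iff_tendsto_nhds by (intro order_tendstoD(1)) auto
    then obtain S where S: "open S" "p \<in> S" "\<And>x. x \<in> S \<Longrightarrow> \<rho> x > 0" by (auto simp: eventually_nhds)
    then have "E \<inter> (S \<inter> U) \<noteq> {}"
      using E(4) U open_Int by (metis IntI Int_commute closure_iff_nhds_not_empty order_refl)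
    then obtain x where "x \<in> E \<inter> U" "x \<in> S" by auto
    then have "\<rho> x < 0" "\<rho> x > 0" using EU S(3)[of x] by blast+
    then show False by simp
  qed
  obtain c r0 where c: "0 < c" "c \<le> 1" "0 < r0"
    "\<And>r. 0 < r \<Longrightarrow> r < r0 \<Longrightarrow> \<exists>x. norm (x - p) \<le> r \<and> ball x (c * r) \<subseteq> D"
  proof (rule balls_below_boundary_point[where D=D, OF U diff])
    show "\<rho> p \<le> 0" by (rule rp)
    show "frechet_derivative \<rho> (at p) \<noteq> (\<lambda>v. 0)" using nz U(2) by blast
    show "{x \<in> U. \<rho> x < 0} \<subseteq> D" using EU E(1) by blast
  qed blast
  have "\<exists>x. R - r \<le> norm x \<and> norm x \<le> R \<and> ball x (c * r) \<subseteq> D" if r: "0 < r" "r < r0" for r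
  proof -
    obtain x where x: "norm (x - p) \<le> r" "ball x (c * r) \<subseteq> D" using c(4)[OF r] by blast
    have "x \<in> D" using x(2) c(1) r(1) by (auto simp: subset_eq)
    moreover have "R - r \<le> norm x" using x(1) norm_triangle_ineq2[of p x] by (simp add: R_def norm_minus_commute)
    moreover have "norm x \<le> R" using \<open>x \<in> D\<close> DR by (metis mem_cball_0 subsetD)
    ultimately show ?thesis using x(2) by blast
  qed
  then show ?thesis using that[OF Rpos DR c(1-3)] by blast
qed

text \<open>The Radon transform of the characteristic function as a real number, so that chord lengths can
  be compared.\<close>

definition chord :: "plane set \<Rightarrow> real \<times> real \<Rightarrow> real" where
  "chord D = (\<lambda>(s, \<phi>). LINT t|lborel. indicator D (s * cos \<phi> - t * sin \<phi>, s * sin \<phi> + t * cos \<phi>))"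

lemma norm_line_point:
  fixes s t \<phi> :: real
  shows "(norm (s * cos \<phi> - t * sin \<phi>, s * sin \<phi> + t * cos \<phi>))\<^sup>2 = s\<^sup>2 + t\<^sup>2"
proof -
  have "(norm (s * cos \<phi> - t * sin \<phi>, s * sin \<phi> + t * cos \<phi>))\<^sup>2 = (s\<^sup>2 + t\<^sup>2) * ((sin \<phi>)\<^sup>2 + (cos \<phi>)\<^sup>2)"
  proof -
    have "(s * cos \<phi> - t * sin \<phi>)\<^sup>2 + (s * sin \<phi> + t * cos \<phi>)\<^sup>2 = (s\<^sup>2 + t\<^sup>2) * ((sin \<phi>)\<^sup>2 + (cos \<phi>)\<^sup>2)"
      by algebra
    then show ?thesis by (simp add: norm_Pair)
  qed
  then show ?thesis by simp
qed

lemma radon_indicator: "radon (indicator D) m = complex_of_real (chord D m)"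
proof (cases m)
  case (Pair s \<phi>)
  have "(indicator D x :: complex) = of_real (indicator D x)" for x :: plane by (simp add: indicator_def)
  then show ?thesis unfolding Pair radon_def chord_def by simp
qed

lemma borel_measurable_chord [measurable]:
  assumes "open D" shows "chord D \<in> borel_measurable borel"
proof -
  have [measurable]: "D \<in> sets borel" using assms by simp
  have "(\<lambda>(m, t). indicator D (fst m * cos (snd m) - t * sin (snd m), fst m * sin (snd m) + t * cos (snd m)) :: real)
      \<in> borel_measurable (borel \<Otimes>\<^sub>M lborel)"
    unfolding borel_prod[symmetric] by measurable
  then have "(\<lambda>m. LINT t|lborel. indicator D (fst m * cos (snd m) - t * sin (snd m), fst m * sin (snd m) + t * cos (snd m)) :: real)
      \<in> borel_measurable borel"
    by (rule lborel.borel_measurable_lebesgue_integral)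
  then show ?thesis by (simp add: chord_def case_prod_unfold)
qed

lemma chord_nonneg: "chord D m \<ge> 0"
  unfolding chord_def by (auto simp: case_prod_unfold intro!: integral_nonneg_AE)

lemma line_integrable:
  fixes s \<phi> R :: real
  assumes "open D" "D \<subseteq> cball 0 R"
  shows "integrable lborel (\<lambda>t. indicator D (s * cos \<phi> - t * sin \<phi>, s * sin \<phi> + t * cos \<phi>) :: real)"
proof -
  have [measurable]: "D \<in> sets borel" using assms by simp
  have z: "t \<in> {-\<bar>R\<bar>..\<bar>R\<bar>}" if "(s * cos \<phi> - t * sin \<phi>, s * sin \<phi> + t * cos \<phi>) \<in> D" for t :: real
  proof -
    have "norm (s * cos \<phi> - t * sin \<phi>, s * sin \<phi> + t * cos \<phi>) \<le> R" using that assms by auto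
    then have "s\<^sup>2 + t\<^sup>2 \<le> R\<^sup>2" using norm_line_point by (metis norm_ge_zero power_mono)
    then have "t\<^sup>2 \<le> R\<^sup>2" using zero_le_power2[of s] by linarith
    then have "\<bar>t\<bar> \<le> \<bar>R\<bar>" unfolding abs_le_square_iff .
    then show ?thesis by auto
  qed
  show ?thesis
  proof (rule Bochner_Integration.integrable_bound)
    show "integrable lborel (indicator {-\<bar>R\<bar>..\<bar>R\<bar>} :: real \<Rightarrow> real)" by simp
    show "AE t in lborel. norm (indicator D (s * cos \<phi> - t * sin \<phi>, s * sin \<phi> + t * cos \<phi>) :: real)
       \<le> norm (indicator {-\<bar>R\<bar>..\<bar>R\<bar>} t :: real)"
      using z by (auto simp: indicator_def)
    have "(\<lambda>t. (s * cos \<phi> - t * sin \<phi>, s * sin \<phi> + t * cos \<phi>)) \<in> borel_measurable borel"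
      by (intro borel_measurable_continuous_onI continuous_intros)
    from measurable_compose[OF this, of "indicator D :: plane \<Rightarrow> real" borel]
    show "(\<lambda>t. indicator D (s * cos \<phi> - t * sin \<phi>, s * sin \<phi> + t * cos \<phi>) :: real) \<in> borel_measurable lborel"
      by simp
  qed
qed

lemma chord_le:
  assumes D: "open D" "D \<subseteq> cball 0 R" and R: "R \<ge> 0"
  shows "chord D (s, \<phi>) \<le> 2 * sqrt (max 0 (R\<^sup>2 - s\<^sup>2))"
proof -
  let ?a = "sqrt (max 0 (R\<^sup>2 - s\<^sup>2))"
  have "chord D (s, \<phi>) \<le> (LINT t|lborel. indicator {-?a..?a} t)"
    unfolding chord_def prod.case
  proof (rule integral_mono[OF line_integrable[OF D]])
    show "integrable lborel (indicator {-?a..?a} :: real \<Rightarrow> real)" by simp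
    fix t :: real
    have "t \<in> {-?a..?a}" if "(s * cos \<phi> - t * sin \<phi>, s * sin \<phi> + t * cos \<phi>) \<in> D"
    proof -
      have "norm (s * cos \<phi> - t * sin \<phi>, s * sin \<phi> + t * cos \<phi>) \<le> R" using that assms by auto
      then have "s\<^sup>2 + t\<^sup>2 \<le> R\<^sup>2" using norm_line_point by (metis norm_ge_zero power_mono)
      then have "t\<^sup>2 \<le> max 0 (R\<^sup>2 - s\<^sup>2)" by simp
      then have "\<bar>t\<bar> \<le> ?a" using real_le_rsqrt[of "\<bar>t\<bar>"] by simp
      then show ?thesis by auto
    qed
    then show "indicator D (s * cos \<phi> - t * sin \<phi>, s * sin \<phi> + t * cos \<phi>) \<le> (indicator {-?a..?a} t :: real)"
      by (auto simp: indicator_def)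
  qed
  then show ?thesis by simp
qed

lemma chord_eq_0:
  assumes D: "open D" "D \<subseteq> cball 0 R" and R: "R \<ge> 0" and s: "\<bar>s\<bar> \<ge> R"
  shows "chord D (s, \<phi>) = 0"
proof -
  have "R\<^sup>2 \<le> s\<^sup>2" using R s power_mono[of R "\<bar>s\<bar>" 2] by simp
  then show ?thesis using chord_le[OF D R, of s \<phi>] chord_nonneg[of D "(s, \<phi>)"] by simp
qed

text \<open>A square of side \<open>d\<close> that is centred at the centre of the ball and has two sides parallel to the
  line is contained in the ball.\<close>

lemma chord_ge:
  assumes D: "open D" "D \<subseteq> cball 0 R" and x: "ball (x1, x2) d \<subseteq> D" and d: "d > 0"
    and s: "\<bar>s - (x1 * cos \<phi> + x2 * sin \<phi>)\<bar> \<le> d / 2"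
  shows "d \<le> chord D (s, \<phi>)"
proof -
  define t0 where "t0 = - x1 * sin \<phi> + x2 * cos \<phi>"
  define s0 where "s0 = x1 * cos \<phi> + x2 * sin \<phi>"
  have "(LINT t|lborel. indicator {t0 - d/2..t0 + d/2} t) \<le> chord D (s, \<phi>)"
    unfolding chord_def prod.case
  proof (rule integral_mono[OF _ line_integrable[OF D]])
    show "integrable lborel (indicator {t0 - d/2..t0 + d/2} :: real \<Rightarrow> real)"
      by (rule integrable_real_indicator) (auto simp: emeasure_lborel_Icc_eq)
    fix t :: real
    have "(s * cos \<phi> - t * sin \<phi>, s * sin \<phi> + t * cos \<phi>) \<in> D" if t: "t \<in> {t0 - d/2..t0 + d/2}"
    proof -
      have x: "x1 = s0 * cos \<phi> - t0 * sin \<phi>" "x2 = s0 * sin \<phi> + t0 * cos \<phi>"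
      proof -
        have "s0 * cos \<phi> - t0 * sin \<phi> = x1 * ((sin \<phi>)\<^sup>2 + (cos \<phi>)\<^sup>2)"
          unfolding s0_def t0_def by (simp only: power2_eq_square) algebra
        then show "x1 = s0 * cos \<phi> - t0 * sin \<phi>" by simp
        have "s0 * sin \<phi> + t0 * cos \<phi> = x2 * ((sin \<phi>)\<^sup>2 + (cos \<phi>)\<^sup>2)"
          unfolding s0_def t0_def by (simp only: power2_eq_square) algebra
        then show "x2 = s0 * sin \<phi> + t0 * cos \<phi>" by simp
      qed
      have "(s * cos \<phi> - t * sin \<phi>, s * sin \<phi> + t * cos \<phi>) - (x1, x2)
          = ((s - s0) * cos \<phi> - (t - t0) * sin \<phi>, (s - s0) * sin \<phi> + (t - t0) * cos \<phi>)"
        unfolding x by (simp add: algebra_simps)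
      then have "(norm ((s * cos \<phi> - t * sin \<phi>, s * sin \<phi> + t * cos \<phi>) - (x1, x2)))\<^sup>2 = (s - s0)\<^sup>2 + (t - t0)\<^sup>2"
        by (simp only: norm_line_point)
      also have "\<dots> \<le> (d/2)\<^sup>2 + (d/2)\<^sup>2"
      proof (rule add_mono)
        show "(s - s0)\<^sup>2 \<le> (d/2)\<^sup>2" using s d unfolding s0_def abs_le_square_iff[symmetric] by simp
        show "(t - t0)\<^sup>2 \<le> (d/2)\<^sup>2" 
        proof -
          have "\<bar>t - t0\<bar> \<le> \<bar>d / 2\<bar>" using t d unfolding atLeastAtMost_iff by linarith
          then show "(t - t0)\<^sup>2 \<le> (d/2)\<^sup>2" unfolding abs_le_square_iff .
        qed
      qed
      also have "\<dots> < d\<^sup>2" using d by (simp add: power2_eq_square)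
      finally have "norm ((s * cos \<phi> - t * sin \<phi>, s * sin \<phi> + t * cos \<phi>) - (x1, x2)) < d"
        using d by (simp add: power_less_imp_less_base)
      then have "(s * cos \<phi> - t * sin \<phi>, s * sin \<phi> + t * cos \<phi>) \<in> ball (x1, x2) d"
        by (simp only: mem_ball dist_norm norm_minus_commute)
      then show ?thesis using assms(3) by blast
    qed
    then show "(indicator {t0 - d/2..t0 + d/2} t :: real) \<le> indicator D (s * cos \<phi> - t * sin \<phi>, s * sin \<phi> + t * cos \<phi>)"
      by (auto simp: indicator_def)
  qed
  then show ?thesis using d by simp
qed

section \<open>Decay of Fourier transforms and the regularised filter kernel\<close>

lemma integrable_compact_support:
  fixes f :: "'a::euclidean_space \<Rightarrow> 'b::euclidean_space"
  assumes "continuous_on UNIV f" "\<And>x. x \<notin> cbox a b \<Longrightarrow> f x = 0"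
  shows "integrable lborel f"
proof -
  have "integrable lborel (\<lambda>x. indicator (cbox a b) x *\<^sub>R f x)"
    using assms(1) by (intro borel_integrable_compact compact_cbox) (rule continuous_on_subset, auto)
  moreover have "(\<lambda>x. indicator (cbox a b) x *\<^sub>R f x) = f" using assms(2) by (auto simp: indicator_def)
  ultimately show ?thesis by simp
qed

lemma integrable_compact_support_real:
  fixes f :: "real \<Rightarrow> 'b::euclidean_space"
  assumes "continuous_on UNIV f" "\<And>x. \<bar>x\<bar> > L \<Longrightarrow> f x = 0"
  shows "integrable lborel f"
  by (rule integrable_compact_support[where a="-\<bar>L\<bar>" and b="\<bar>L\<bar>"]) (use assms in \<open>auto simp: abs_if split: if_splits\<close>)

lemma fourier_derivative:
  fixes f f' :: "real \<Rightarrow> real"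
  assumes d: "\<And>x. (f has_real_derivative f' x) (at x)" and c: "continuous_on UNIV f'"
    and z: "\<And>x. \<bar>x\<bar> \<ge> L \<Longrightarrow> f x = 0" "\<And>x. \<bar>x\<bar> \<ge> L \<Longrightarrow> f' x = 0" and L: "L \<ge> 0"
  shows "(LINT s|lborel. f' s * cis (- (\<sigma> * s))) = \<i> * \<sigma> * (LINT s|lborel. f s * cis (- (\<sigma> * s)))"
proof -
  have cf: "continuous_on UNIV f" using d by (intro DERIV_continuous_on) (auto simp: has_field_derivative_at_within)
  define F where "F s = complex_of_real (f s) * cis (- (\<sigma> * s))" for s
  define F' where "F' s = complex_of_real (f' s) * cis (- (\<sigma> * s)) - \<i> * \<sigma> * (complex_of_real (f s) * cis (- (\<sigma> * s)))" for s
  have cis': "((\<lambda>s. cis (- (\<sigma> * s))) has_vector_derivative (- \<i> * \<sigma> * cis (- (\<sigma> * s)))) (at s within S)" for s S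
  proof -
    have "((\<lambda>w. exp (\<i> * (- (\<sigma> * w)))) has_field_derivative (- \<i> * \<sigma> * cis (- (\<sigma> * s)))) (at (complex_of_real s))"
      by (auto intro!: derivative_eq_intros simp: cis_conv_exp)
    from has_vector_derivative_real_field[OF this] show ?thesis by (simp add: cis_conv_exp)
  qed
  have F: "(F has_vector_derivative F' s) (at s within S)" for s S
  proof -
    have "((\<lambda>s. complex_of_real (f s)) has_vector_derivative complex_of_real (f' s)) (at s within S)"
      using has_vector_derivative_of_real[OF d] has_vector_derivative_at_within by blast
    from has_vector_derivative_mult[OF this cis'[of s S]]
    show ?thesis unfolding F_def F'_def by (rule has_vector_derivative_eq_rhs) (simp add: algebra_simps)
  qed
  have cc: "continuous_on UNIV (\<lambda>s. complex_of_real (f s) * cis (- (\<sigma> * s)))"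
      "continuous_on UNIV (\<lambda>s. complex_of_real (f' s) * cis (- (\<sigma> * s)))"
    using c cf by (auto intro!: continuous_intros simp: cis_conv_exp)
  have i: "integrable lborel (\<lambda>s. complex_of_real (f s) * cis (- (\<sigma> * s)))"
      "integrable lborel (\<lambda>s. complex_of_real (f' s) * cis (- (\<sigma> * s)))"
    by (rule integrable_compact_support_real[where L=L, OF cc(1)], use z in simp,
        rule integrable_compact_support_real[where L=L, OF cc(2)], use z in simp)
  have cF': "continuous_on UNIV F'" unfolding F'_def by (intro continuous_on_diff continuous_on_mult_left cc)
  have "(LINT s|lborel. F' s) = (LINT s|lborel. indicator {-L..L} s *\<^sub>R F' s)"
    by (rule Bochner_Integration.integral_cong) (auto simp: F'_def z indicator_def abs_if split: if_splits)
  also have "\<dots> = F L - F (- L)"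
    using L F continuous_on_subset[OF cF'] by (intro integral_FTC_Icc) auto
  also have "\<dots> = 0" using z(1)[of L] z(1)[of "- L"] L by (simp add: F_def)
  finally show ?thesis unfolding F'_def using i by simp
qed

lemma norm_fourier_le:
  fixes f :: "real \<Rightarrow> real"
  assumes c: "continuous_on UNIV f" and z: "\<And>x. \<bar>x\<bar> \<ge> L \<Longrightarrow> f x = 0" and b: "\<And>x. \<bar>f x\<bar> \<le> B" and L: "L \<ge> 0"
  shows "norm (LINT s|lborel. f s * cis (- (\<sigma> * s))) \<le> 2 * L * B"
proof -
  have "norm (LINT s|lborel. f s * cis (- (\<sigma> * s))) \<le> (LINT s|lborel. norm (f s * cis (- (\<sigma> * s))))"
    by (rule integral_norm_bound)
  also have "\<dots> \<le> (LINT s|lborel. B * indicator {-L..L} s)"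
  proof (rule integral_mono)
    show "integrable lborel (\<lambda>s. norm (f s * cis (- (\<sigma> * s))))"
      using c z by (auto intro!: integrable_compact_support_real[where L=L] continuous_intros simp: norm_mult)
    fix s show "norm (f s * cis (- (\<sigma> * s))) \<le> B * indicator {-L..L} s"
    proof (cases "s \<in> {-L..L}")
      case True then show ?thesis using b[of s] by (simp add: norm_mult)
    next
      case False
      then have "f s = 0" using z[of s] by auto
      then show ?thesis using False by simp
    qed
    show "integrable lborel (\<lambda>s. B * indicator {-L..L} s)"
      by (intro integrable_mult_right integrable_real_indicator) (auto simp: emeasure_lborel_Icc_eq)
  qed
  finally show ?thesis using L by (simp add: mult.commute)
qed

text \<open>One and three integrations by parts. The bound is integrable in \<open>\<sigma>\<close>, and this makes the Fourier
  integral that defines the Riesz potential absolutely convergent.\<close>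

lemma fourier_decay:
  fixes f0 f1 f2 f3 :: "real \<Rightarrow> real"
  assumes d: "\<And>x. (f0 has_real_derivative f1 x) (at x)" "\<And>x. (f1 has_real_derivative f2 x) (at x)"
     "\<And>x. (f2 has_real_derivative f3 x) (at x)" and c: "continuous_on UNIV f3"
    and z: "\<And>x. \<bar>x\<bar> \<ge> L \<Longrightarrow> f0 x = 0" "\<And>x. \<bar>x\<bar> \<ge> L \<Longrightarrow> f1 x = 0" "\<And>x. \<bar>x\<bar> \<ge> L \<Longrightarrow> f2 x = 0"
       "\<And>x. \<bar>x\<bar> \<ge> L \<Longrightarrow> f3 x = 0" 
    and b: "\<And>x. \<bar>f1 x\<bar> \<le> B" "\<And>x. \<bar>f3 x\<bar> \<le> B" and L: "L \<ge> 0"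
  shows "\<bar>\<sigma>\<bar> * norm (LINT s|lborel. f0 s * cis (- (\<sigma> * s))) \<le> 4 * L * B / (1 + \<sigma>\<^sup>2)"
proof -
  have c': "continuous_on UNIV f1" "continuous_on UNIV f2"
    using d by (auto intro!: DERIV_continuous_on simp: has_field_derivative_at_within)
  define A where "A f = (LINT s|lborel. complex_of_real (f s) * cis (- (\<sigma> * s)))" for f
  have "A f1 = \<i> * \<sigma> * A f0" "A f2 = \<i> * \<sigma> * A f1" "A f3 = \<i> * \<sigma> * A f2"
    unfolding A_def by (rule fourier_derivative[where L=L]; use d c c' z L in auto)+
  then have n: "norm (A f1) = \<bar>\<sigma>\<bar> * norm (A f0)" "norm (A f3) = \<sigma>\<^sup>2 * (\<bar>\<sigma>\<bar> * norm (A f0))"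
    by (simp_all add: norm_mult power2_eq_square)
  have "norm (A f1) \<le> 2 * L * B" "norm (A f3) \<le> 2 * L * B"
    unfolding A_def by (rule norm_fourier_le[where L=L]; use c c' z b L in auto)+
  then have "(1 + \<sigma>\<^sup>2) * (\<bar>\<sigma>\<bar> * norm (A f0)) \<le> 4 * L * B"
    unfolding n by (simp add: algebra_simps)
  moreover have "1 + \<sigma>\<^sup>2 > 0" by (simp add: add_pos_nonneg)
  ultimately show ?thesis unfolding A_def by (simp add: pos_le_divide_eq mult.commute)
qed

lemma integrable_inverse_1_plus_square': "integrable lborel (\<lambda>x::real. 1 / (1 + x\<^sup>2))"
  using integrable_inverse_1_plus_square
  by (simp add: set_integrable_def inverse_eq_divide)

lemma laplace_identity:
  fixes a :: complex assumes a: "Re a > 0"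
  shows "set_integrable lborel {0..} (\<lambda>x. of_real x * exp (- (a * of_real x)))"
    and "(LINT x:{0..}|lborel. of_real x * exp (- (a * of_real x))) = 1 / a\<^sup>2"
proof -
  define F where "F x = - (of_real x / a + 1 / a\<^sup>2) * exp (- (a * of_real x))" for x :: real
  define f where "f x = of_real x * exp (- (a * of_real x))" for x :: real
  have a0: "a \<noteq> 0" using a by auto
  have F: "(F has_vector_derivative f x) (at x within S)" for x S
  proof -
    have "((\<lambda>w. - (w / a + 1 / a\<^sup>2) * exp (- (a * w))) has_field_derivative f x) (at (of_real x))"
      unfolding f_def using a0 by (auto intro!: derivative_eq_intros simp: field_simps power2_eq_square)
    from has_vector_derivative_real_field[OF this] show ?thesis unfolding F_def .
  qed
  have xe: "x * exp (- (Re a * x)) \<le> 2 / Re a * exp (- (x * (Re a / 2)))" if "x \<ge> 0" for x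
  proof -
    have "Re a * x / 2 \<le> exp (Re a * x / 2)" using exp_ge_add_one_self[of "Re a * x / 2"] by linarith
    then have "x \<le> 2 / Re a * exp (Re a * x / 2)" using a by (simp add: field_simps)
    then have "x * exp (- (Re a * x)) \<le> 2 / Re a * exp (Re a * x / 2) * exp (- (Re a * x))"
      by (intro mult_right_mono) auto
    then show ?thesis by (simp add: mult.assoc exp_add[symmetric] algebra_simps)
  qed
  have nf: "norm (f x) = x * exp (- (Re a * x))" if "x \<ge> 0" for x
    using that by (simp add: f_def norm_mult)
  have si: "set_integrable lborel {0..} f"
  proof -
    have "set_integrable lborel {0<..} (\<lambda>x. 2 / Re a * exp (- (x * (Re a / 2))))"
      by (intro set_integrable_mult_right) (use integrable_I0i_exp_mscale[of "Re a / 2"] a in simp)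
    then show ?thesis
      unfolding set_integrable_def
    proof (rule Bochner_Integration.integrable_bound)
      show "(\<lambda>x. indicat_real {0..} x *\<^sub>R f x) \<in> borel_measurable lborel" unfolding f_def by measurable
      have "norm (indicat_real {0..} x *\<^sub>R f x) \<le> norm (indicat_real {0<..} x *\<^sub>R (2 / Re a * exp (- (x * (Re a / 2)))))" for x
        using xe[of x] nf[of x] a by (auto simp: indicator_def f_def)
      then show "AE x in lborel. norm (indicat_real {0..} x *\<^sub>R f x)
         \<le> norm (indicat_real {0<..} x *\<^sub>R (2 / Re a * exp (- (x * (Re a / 2)))))" by simp
    qed
  qed
  have lim: "(F \<longlongrightarrow> 0) at_top"
  proof -
    have "((\<lambda>x. (2 / Re a / cmod a) * exp (- (x * (Re a / 2))) + 1 / (cmod a)\<^sup>2 * exp (- (x * Re a)))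
        \<longlongrightarrow> (2 / Re a / cmod a) * 0 + 1 / (cmod a)\<^sup>2 * 0) at_top"
    proof -
      have "((\<lambda>x. exp (- (x * k))) \<longlongrightarrow> 0) at_top" if "k > 0" for k :: real
        by (rule filterlim_compose[OF exp_at_bot])
          (use filterlim_at_top_mult_tendsto_pos[OF tendsto_const that filterlim_ident] in \<open>simp add: filterlim_uminus_at_bot\<close>)
      from this[of "Re a / 2"] this[of "Re a"] show ?thesis
        using a by (intro tendsto_add tendsto_mult tendsto_const) auto
    qed
    then have "((\<lambda>x. (2 / Re a / cmod a) * exp (- (x * (Re a / 2))) + 1 / (cmod a)\<^sup>2 * exp (- (x * Re a))) \<longlongrightarrow> 0) at_top"
      by simp
    then have "((\<lambda>x. norm (F x)) \<longlongrightarrow> 0) at_top"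
    proof (rule tendsto_sandwich[OF _ _ tendsto_const, rotated 2])
      show "\<forall>\<^sub>F x in at_top. norm (F x) \<le> (2 / Re a / cmod a) * exp (- (x * (Re a / 2))) + 1 / (cmod a)\<^sup>2 * exp (- (x * Re a))"
        using eventually_ge_at_top[of 0]
      proof eventually_elim
        case (elim x)
        have "norm (of_real x / a + 1 / a\<^sup>2) \<le> x / cmod a + 1 / (cmod a)\<^sup>2"
          using norm_triangle_ineq[of "of_real x / a" "1 / a\<^sup>2"] elim by (simp add: norm_divide norm_power)
        then have "norm (F x) \<le> (x / cmod a + 1 / (cmod a)\<^sup>2) * exp (- (Re a * x))"
          unfolding F_def norm_mult norm_minus_cancel by simp
        also have "\<dots> = (x * exp (- (Re a * x))) / cmod a + 1 / (cmod a)\<^sup>2 * exp (- (x * Re a))"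
          by (simp add: algebra_simps)
        also have "\<dots> \<le> (2 / Re a * exp (- (x * (Re a / 2)))) / cmod a + 1 / (cmod a)\<^sup>2 * exp (- (x * Re a))"
          by (intro add_right_mono divide_right_mono xe elim) auto
        finally show ?case by simp
      qed
    qed auto
    then show ?thesis by (simp add: tendsto_norm_zero_iff)
  qed
  show "set_integrable lborel {0..} (\<lambda>x. of_real x * exp (- (a * of_real x)))" using si unfolding f_def .
  have sie: "set_integrable lborel (einterval 0 \<infinity>) f"
    by (rule set_integrable_subset[OF si]) (auto simp: einterval_iff)
  have "(LBINT x=0..\<infinity>. f x) = 0 - F 0"
  proof (rule interval_integral_FTC_integrable[where F=F])
    have "isCont F 0" using F[of 0 UNIV] by (rule has_vector_derivative_continuous)
    then have "(F \<longlongrightarrow> F 0) (at_right 0)" unfolding isCont_def by (rule tendsto_within_subset) auto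
    then show "((F \<circ> real_of_ereal) \<longlongrightarrow> F 0) (at_right 0)"
      by (simp add: zero_ereal_def ereal_tendsto_simps)
    show "((F \<circ> real_of_ereal) \<longlongrightarrow> 0) (at_left \<infinity>)"
      using lim by (simp add: ereal_tendsto_simps)
    show "isCont f x" for x unfolding f_def by (intro continuous_intros)
  qed (use F sie in auto)
  moreover have "(LBINT x=0..\<infinity>. f x) = (LINT x:{0..}|lborel. f x)"
    unfolding zero_ereal_def interval_integral_to_infinity_eq set_lebesgue_integral_def
    by (rule Bochner_Integration.integral_cong) (auto simp: indicator_def f_def)
  ultimately show "(LINT x:{0..}|lborel. of_real x * exp (- (a * of_real x))) = 1 / a\<^sup>2"
    by (simp add: f_def F_def)
qed

text \<open>The factor \<open>exp (- \<epsilon> |\<sigma>|)\<close> turns the multiplier \<open>|\<sigma>|\<close> into an honest convolution kernel. The two half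
  lines contribute complex conjugates, each of them a Laplace integral.\<close>

lemma poisson_kernel:
  assumes e: "\<epsilon> > 0"
  shows "integrable lborel (\<lambda>\<sigma>. of_real (\<bar>\<sigma>\<bar> * exp (- (\<epsilon> * \<bar>\<sigma>\<bar>))) * cis (\<sigma> * x))" (is "integrable _ ?f")
    and "(LINT \<sigma>|lborel. of_real (\<bar>\<sigma>\<bar> * exp (- (\<epsilon> * \<bar>\<sigma>\<bar>))) * cis (\<sigma> * x))
       = of_real (- 2 * Re (1 / (Complex x \<epsilon>)\<^sup>2))"
proof -
  define a where "a = Complex \<epsilon> (- x)"
  define a' where "a' = Complex \<epsilon> x"
  have Re: "Re a > 0" "Re a' > 0" using e by (auto simp: a_def a'_def)
  note A = laplace_identity[OF Re(1)] and A' = laplace_identity[OF Re(2)]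
  have r: "indicator {0..} \<sigma> *\<^sub>R (of_real \<sigma> * exp (- (a * of_real \<sigma>))) = indicator {0..} \<sigma> *\<^sub>R ?f \<sigma>" for \<sigma>
    by (auto simp: indicator_def a_def cis_conv_exp exp_of_real exp_add[symmetric] mult.assoc Complex_eq algebra_simps simp flip: exp_of_real)
  have l: "indicator {0..} (-\<sigma>) *\<^sub>R (of_real (-\<sigma>) * exp (- (a' * of_real (-\<sigma>)))) = indicator {..0} \<sigma> *\<^sub>R ?f \<sigma>" for \<sigma>
    by (auto simp: indicator_def a'_def cis_conv_exp exp_of_real exp_add[symmetric] mult.assoc Complex_eq algebra_simps simp flip: exp_of_real)
  have ir: "integrable lborel (\<lambda>\<sigma>. indicator {0..} \<sigma> *\<^sub>R ?f \<sigma>)"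
    and vr: "(LINT \<sigma>|lborel. indicator {0..} \<sigma> *\<^sub>R ?f \<sigma>) = 1 / a\<^sup>2"
    using A unfolding set_integrable_def set_lebesgue_integral_def r by auto
  have il: "integrable lborel (\<lambda>\<sigma>. indicator {..0} \<sigma> *\<^sub>R ?f \<sigma>)"
    using lborel_integrable_real_affine[OF A'(1)[unfolded set_integrable_def], of "-1" 0]
    by (simp only: l[symmetric]) simp
  have vl: "(LINT \<sigma>|lborel. indicator {..0} \<sigma> *\<^sub>R ?f \<sigma>) = 1 / a'\<^sup>2"
    using A'(2)[unfolded set_lebesgue_integral_def]
      lborel_integral_real_affine[of "-1" "\<lambda>\<sigma>. indicator {0..} \<sigma> *\<^sub>R (of_real \<sigma> * exp (- (a' * of_real \<sigma>)))" 0]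
    by (simp only: l[symmetric]) simp
  have f: "?f = (\<lambda>\<sigma>. indicator {0..} \<sigma> *\<^sub>R ?f \<sigma> + indicator {..0} \<sigma> *\<^sub>R ?f \<sigma>)"
    by (auto simp: indicator_def)
  show "integrable lborel ?f" by (subst f) (rule Bochner_Integration.integrable_add[OF ir il])
  have "integral\<^sup>L lborel ?f = 1 / a\<^sup>2 + 1 / a'\<^sup>2"
    by (subst f) (simp only: Bochner_Integration.integral_add[OF ir il] vr vl)
  also have "\<dots> = of_real (- 2 * Re (1 / (Complex x \<epsilon>)\<^sup>2))"
  proof -
    have "a = - \<i> * Complex x \<epsilon>" "a' = cnj a" by (auto simp: a_def a'_def complex_eq_iff)
    then have e: "a\<^sup>2 = - (Complex x \<epsilon>)\<^sup>2" "1 / a'\<^sup>2 = cnj (1 / a\<^sup>2)" by (auto simp: power_mult_distrib)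
    have s: "1 / a\<^sup>2 + 1 / a'\<^sup>2 = of_real (2 * Re (1 / a\<^sup>2))" unfolding e(2) by (rule complex_add_cnj)
    have r: "1 / a\<^sup>2 = - (1 / (Complex x \<epsilon>)\<^sup>2)" unfolding e(1) by simp
    have t: "2 * Re (1 / a\<^sup>2) = - 2 * Re (1 / (Complex x \<epsilon>)\<^sup>2)" unfolding r by simp
    show ?thesis unfolding s t ..
  qed
  finally show "integral\<^sup>L lborel ?f = of_real (- 2 * Re (1 / (Complex x \<epsilon>)\<^sup>2))" .
qed

section \<open>The semicircle integral\<close>

text \<open>The equation is quadratic in \<open>\<zeta>\<close> and its two roots have product \<open>1\<close>. If they were on the unit circle,
  they would be conjugate to each other, and their sum \<open>-2 z / c\<close> would be real, contrary to \<open>Im z > 0\<close>.\<close>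

lemma unit_disc_root:
  fixes z :: complex and c :: real
  assumes "Im z > 0" "c > 0"
  obtains \<zeta> where "norm \<zeta> < 1" "\<zeta> \<noteq> 0" "of_real c * (1 + \<zeta>\<^sup>2) = - 2 * z * \<zeta>"
proof -
  define w where "w = csqrt (z\<^sup>2 - of_real c ^ 2)"
  define r1 where "r1 = (- z + w) / of_real c"
  define r2 where "r2 = (- z - w) / of_real c"
  have w2: "w\<^sup>2 = z\<^sup>2 - of_real c ^ 2" by (simp add: w_def)
  have c0: "complex_of_real c \<noteq> 0" using assms by simp
  have prod: "r1 * r2 = 1"
  proof -
    have "(-z + w) * (-z - w) = of_real c ^ 2" using w2 by (simp add: algebra_simps power2_eq_square)
    then show ?thesis using c0 by (simp add: r1_def r2_def power2_eq_square)
  qed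
  have sum: "of_real c * (r1 + r2) = - 2 * z"
    using c0 by (simp add: r1_def r2_def field_simps)
  have eq1: "of_real c * (1 + r1\<^sup>2) = - 2 * z * r1"
  proof -
    have "of_real c * (1 + r1\<^sup>2) = of_real c * (r1 * r2 + r1 * r1)" using prod by (simp add: power2_eq_square)
    also have "\<dots> = (of_real c * (r1 + r2)) * r1" by (simp add: algebra_simps)
    finally show ?thesis using sum by simp
  qed
  have eq2: "of_real c * (1 + r2\<^sup>2) = - 2 * z * r2"
  proof -
    have "of_real c * (1 + r2\<^sup>2) = of_real c * (r1 * r2 + r2 * r2)" using prod by (simp add: power2_eq_square)
    also have "\<dots> = (of_real c * (r1 + r2)) * r2" by (simp add: algebra_simps)
    finally show ?thesis using sum by simp
  qed
  have ne1: "norm r1 \<noteq> 1"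
  proof
    assume n: "norm r1 = 1"
    have "r1 * cnj r1 = 1" using n by (simp add: complex_norm_square [symmetric])
    then have "r2 = cnj r1" using prod
      by (metis mult.commute mult.left_commute mult_1_right)
    then have "Im (r1 + r2) = 0" by simp
    moreover have "Im (of_real c * (r1 + r2)) = - 2 * Im z" using sum by simp
    ultimately show False using assms by simp
  qed
  have nprod: "norm r1 * norm r2 = 1" using prod by (metis norm_mult norm_one)
  have nz: "r1 \<noteq> 0" "r2 \<noteq> 0" using prod by auto
  show ?thesis
  proof (cases "norm r1 < 1")
    case True then show ?thesis using that eq1 nz by blast
  next
    case False
    then have "norm r1 > 1" using ne1 by simp
    then have "norm r2 < 1" using nprod
      by (smt (verit) mult_less_cancel_right1 norm_ge_zero nz(2) zero_less_norm_iff mult_le_cancel_right1)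
    then show ?thesis using that eq2 nz by blast
  qed
qed

text \<open>Put \<open>c = sqrt v\<close>, \<open>t = - c cos \<alpha>\<close>, and parametrise \<open>z = m (1 + \<zeta>\<^sup>2)\<close>, \<open>c = - 2 m \<zeta>\<close> with \<open>|\<zeta>| < 1\<close>. Then
  \<open>z - t = m (1 - \<zeta> e\<^sup>i\<^sup>\<alpha>) (1 - \<zeta> e\<^sup>-\<^sup>i\<^sup>\<alpha>)\<close>, which yields an elementary antiderivative and the value
  \<open>2 \<pi> (X - 1)\<close> with \<open>X = (1 + \<zeta>\<^sup>2) / (1 - \<zeta>\<^sup>2)\<close>. Now \<open>X\<^sup>2 = L\<close>, and \<open>Re X > 0\<close> since \<open>|\<zeta>| < 1\<close>. The
  identity \<open>2 (Re X)\<^sup>2 = |X\<^sup>2| + Re (X\<^sup>2)\<close> therefore determines \<open>Re X\<close>, and no branch of \<open>sqrt L\<close> has to be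
  followed.\<close>

lemma semicircle_integral:
  fixes z :: complex and v :: real
  assumes z: "Im z > 0" and v: "v > 0"
  defines "L \<equiv> z\<^sup>2 / (z\<^sup>2 - of_real v)"
  shows "Re (LINT t|lborel. of_real (2 * sqrt (max 0 (v - t\<^sup>2))) / (z - of_real t)\<^sup>2)
           = 2 * pi * (sqrt ((norm L + Re L) / 2) - 1)"
proof -
  define c where "c = sqrt v"
  have c: "c > 0" "c\<^sup>2 = v" using v by (auto simp: c_def)
  obtain \<zeta> where \<zeta>: "norm \<zeta> < 1" "\<zeta> \<noteq> 0" "of_real c * (1 + \<zeta>\<^sup>2) = - 2 * z * \<zeta>"
    using unit_disc_root[OF z c(1)] .
  \<comment> \<open>The value of \<open>sqrt L\<close> with positive real part.\<close>
  define X where "X = (1 + \<zeta>\<^sup>2) / (1 - \<zeta>\<^sup>2)"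
  define m where "m = - of_real c / (2 * \<zeta>)"
  have m0: "m \<noteq> 0" using \<zeta>(2) c(1) by (simp add: m_def)
  have z_eq: "z = m * (1 + \<zeta>\<^sup>2)"
    using \<zeta> by (simp add: m_def field_simps)
  have c_eq: "of_real c = - 2 * m * \<zeta>"
    using \<zeta>(2) by (simp add: m_def)
  have n2: "norm (\<zeta>\<^sup>2) < 1" using \<zeta>(1) by (simp add: norm_power power_less_one_iff)
  have ne: "1 - \<zeta>\<^sup>2 \<noteq> 0"  using n2 by auto
  have den: "z + of_real c * cos w \<noteq> 0" if "w = complex_of_real a" for w a
  proof
    assume "z + of_real c * cos w = 0"
    then have "Im (z + of_real c * cos w) = 0" by simp
    then show False using z that by (simp add: cos_of_real)
  qed
  have XL: "X\<^sup>2 = L"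
  proof -
    have vc: "complex_of_real v = (of_real c)\<^sup>2" by (simp flip: c(2))
    have e: "z\<^sup>2 - of_real v = (m * (1 - \<zeta>\<^sup>2))\<^sup>2"
      unfolding vc c_eq z_eq by (simp add: algebra_simps power2_eq_square)
    show ?thesis unfolding L_def e X_def unfolding z_eq using m0 by (simp add: power_divide power_mult_distrib)
  qed
  have ReX: "Re X > 0"
  proof -
    define u where "u = \<zeta>\<^sup>2"
    have "(Re u)\<^sup>2 + (Im u)\<^sup>2 < 1"
      using n2 unfolding u_def[symmetric] cmod_power2[symmetric] by (simp add: power_less_one_iff)
    then have "(1 + Re u) * (1 - Re u) - Im u * Im u > 0" by (simp add: algebra_simps power2_eq_square)
    moreover have "(1 - Re u)\<^sup>2 + (Im u)\<^sup>2 > 0"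
      using ne unfolding u_def[symmetric] by (auto simp: complex_eq_iff sum_power2_gt_zero_iff)
    ultimately show ?thesis unfolding X_def u_def[symmetric] by (simp add: Re_divide)
  qed
  have ReX2: "Re X = sqrt ((norm L + Re L) / 2)"
  proof -
    have "(Re X)\<^sup>2 = (norm L + Re L) / 2"
      unfolding XL[symmetric] norm_power cmod_power2 by (simp add: power2_eq_square)
    then show ?thesis using ReX by (metis less_imp_le real_sqrt_unique)
  qed
  \<comment> \<open>The first two terms come from integrating \<open>2 c\<^sup>2 sin\<^sup>2 \<alpha> / (z + c cos \<alpha>)\<^sup>2\<close> by parts, the third one from
    \<open>2 z / (z + c cos \<alpha>)\<close>, which is left over.\<close>
  define A where "A w = 2 * of_real c * sin w / (z + of_real c * cos w) - 2 * w
     + 2 * X * (w + \<i> * (Ln (1 - \<zeta> * exp (\<i> * w)) - Ln (1 - \<zeta> * exp (- \<i> * w))))" for w :: complex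
  define f where "f y = of_real (2 * sqrt (max 0 (v - y\<^sup>2))) / (z - of_real y)\<^sup>2" for y :: real
  define g where "g a = 2 * of_real v * (of_real (sin a))\<^sup>2 / (z + of_real c * of_real (cos a))\<^sup>2" for a :: real
  have zy: "z - of_real y \<noteq> 0" for y
  proof
    assume "z - of_real y = 0" 
    then have "Im (z - of_real y) = 0" by simp
    then show False using z by simp
  qed
  have A': "((\<lambda>a. A (of_real a)) has_vector_derivative g a) (at a within S)" for a S
  proof (rule has_vector_derivative_real_field)
    let ?w = "complex_of_real a"
    let ?E = "exp (\<i> * ?w)" let ?F = "exp (- \<i> * ?w)"
    have nE: "norm (\<zeta> * ?E) < 1" "norm (\<zeta> * ?F) < 1"
      using \<zeta>(1) by (auto simp: norm_mult)
    have re: "Re (1 - \<zeta> * ?E) > 0" "Re (1 - \<zeta> * ?F) > 0"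
      using nE complex_Re_le_cmod[of "\<zeta> * ?E"] complex_Re_le_cmod[of "\<zeta> * ?F"] by auto
    have nR: "1 - \<zeta> * ?E \<notin> \<real>\<^sub>\<le>\<^sub>0" "1 - \<zeta> * ?F \<notin> \<real>\<^sub>\<le>\<^sub>0"
      using re by (auto simp: complex_nonpos_Reals_iff)
    have nz: "1 - \<zeta> * ?E \<noteq> 0" "1 - \<zeta> * ?F \<noteq> 0" using nE by (auto simp del: norm_mult)
    have EF: "?E * ?F = 1" by (simp add: exp_add [symmetric])
    have cosw: "cos ?w = (?E + ?F) / 2" by (simp add: cos_exp_eq)
    have main: "1 + \<i> * ((- (\<zeta> * (?E * \<i>))) / (1 - \<zeta> * ?E) - (- (\<zeta> * (?F * - \<i>))) / (1 - \<zeta> * ?F))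
         = (1 - \<zeta>\<^sup>2) / ((1 - \<zeta> * ?E) * (1 - \<zeta> * ?F))" (is "?l = _")
    proof -
      have "?l = 1 + \<zeta> * ?E / (1 - \<zeta> * ?E) + \<zeta> * ?F / (1 - \<zeta> * ?F)"
        by (simp add: algebra_simps diff_divide_distrib add_divide_distrib)
      also have "\<dots> = (1 - \<zeta>\<^sup>2 * (?E * ?F)) / ((1 - \<zeta> * ?E) * (1 - \<zeta> * ?F))"
        using nz by (simp add: divide_simps power2_eq_square) (simp add: algebra_simps)
      finally show ?thesis using EF by simp
    qed
    have zc: "z + of_real c * cos ?w = m * ((1 - \<zeta> * ?E) * (1 - \<zeta> * ?F))"
    proof -
      have "(1 - \<zeta> * ?E) * (1 - \<zeta> * ?F) = 1 + \<zeta>\<^sup>2 * (?E * ?F) - \<zeta> * (?E + ?F)"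
        by (simp add: algebra_simps power2_eq_square)
      also have "\<dots> = 1 + \<zeta>\<^sup>2 - 2 * \<zeta> * cos ?w" unfolding EF cosw by simp
      finally have e: "(1 - \<zeta> * ?E) * (1 - \<zeta> * ?F) = 1 + \<zeta>\<^sup>2 - 2 * \<zeta> * cos ?w" .
      show ?thesis unfolding e z_eq c_eq by (simp add: algebra_simps)
    qed
    have main2: "X * ((1 - \<zeta>\<^sup>2) / ((1 - \<zeta> * ?E) * (1 - \<zeta> * ?F))) = z / (z + of_real c * cos ?w)"
    proof -
      have "z / (z + of_real c * cos ?w) = (1 + \<zeta>\<^sup>2) / ((1 - \<zeta> * ?E) * (1 - \<zeta> * ?F))"
        unfolding zc by (subst z_eq) (use m0 in simp)
      then show ?thesis unfolding X_def using ne by simp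
    qed
    let ?d = "z + of_real c * cos ?w"
    have d: "?d \<noteq> 0" using den by blast
    have "(A has_field_derivative
        (2 * of_real c * cos ?w * ?d - 2 * of_real c * sin ?w * (of_real c * - sin ?w)) / (?d * ?d)
        - 2 + 2 * X * (1 + \<i> * ((- (\<zeta> * (?E * \<i>))) / (1 - \<zeta> * ?E) - (- (\<zeta> * (?F * - \<i>))) / (1 - \<zeta> * ?F)))) (at ?w)"
    proof -
      have D1: "((\<lambda>w. 2 * of_real c * sin w / (z + of_real c * cos w)) has_field_derivative
        (2 * of_real c * cos ?w * ?d - 2 * of_real c * sin ?w * (of_real c * - sin ?w)) / (?d * ?d)) (at ?w)"
        using d by (auto intro!: derivative_eq_intros)
      have D2: "((\<lambda>w. Ln (1 - \<zeta> * exp (\<i> * w))) has_field_derivative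
         (- (\<zeta> * (?E * \<i>))) / (1 - \<zeta> * ?E)) (at ?w)"
        using nR(1) nz(1) by (auto intro!: derivative_eq_intros simp: divide_simps)
      have D3: "((\<lambda>w. Ln (1 - \<zeta> * exp (- \<i> * w))) has_field_derivative
         (- (\<zeta> * (?F * - \<i>))) / (1 - \<zeta> * ?F)) (at ?w)"
        using nR(2) nz(2) by (auto intro!: derivative_eq_intros simp: divide_simps)
      show ?thesis unfolding A_def
        using DERIV_add[OF DERIV_diff[OF D1 DERIV_cmult[OF DERIV_ident, of 2]]
          DERIV_cmult[OF DERIV_add[OF DERIV_ident DERIV_cmult[OF DERIV_diff[OF D2 D3], of \<i>]], of "2 * X"]]
        by simp
    qed
    also have "(2 * of_real c * cos ?w * ?d - 2 * of_real c * sin ?w * (of_real c * - sin ?w)) / (?d * ?d)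
        - 2 + 2 * X * (1 + \<i> * ((- (\<zeta> * (?E * \<i>))) / (1 - \<zeta> * ?E) - (- (\<zeta> * (?F * - \<i>))) / (1 - \<zeta> * ?F)))
        = (2 * of_real c * cos ?w * ?d - 2 * of_real c * sin ?w * (of_real c * - sin ?w)) / (?d * ?d)
        - 2 + 2 * (z / ?d)"
      unfolding main main2[symmetric] by simp
    also have "\<dots> = 2 * (of_real c)\<^sup>2 * (sin ?w)\<^sup>2 / ?d\<^sup>2"
      using d by (simp add: divide_simps power2_eq_square) (simp add: algebra_simps)
    also have "\<dots> = g a" unfolding g_def c(2)[symmetric] by (simp add: sin_of_real cos_of_real)
    finally show "(A has_field_derivative g a) (at ?w)" .
  qed
  have Api: "A (of_real pi) = of_real (- 2 * pi) + 2 * X * of_real pi"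
  proof -
    have s: "sin (complex_of_real pi) = 0" by (subst sin_of_real) simp
    have e: "exp (\<i> * complex_of_real pi) = -1" "exp (- \<i> * complex_of_real pi) = -1"
      by (simp_all add: exp_minus)
    show ?thesis unfolding A_def s e by simp
  qed
  have A0: "A (of_real 0) = 0" unfolding A_def by simp
  have den': "z + of_real c * complex_of_real (cos a) \<noteq> 0" for a
    using den[OF refl, of a] by (simp add: cos_of_real)
  have cg: "continuous_on {0..pi} g"
    unfolding g_def by (intro continuous_intros) (metis den' power_eq_0_iff)
  have I1: "(LBINT a=0..pi. g a) = A (of_real pi) - A (of_real 0)"
    using interval_integral_FTC_finite[where a=0 and b=pi and f=g and F="\<lambda>a. A (of_real a)"]
      cg A' by (simp add: zero_ereal_def)
  have "(LBINT y=- c * cos 0..- c * cos pi. f y) = (LBINT a=0..pi. (c * sin a) *\<^sub>R f (- c * cos a))"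
    unfolding zero_ereal_def
    by (rule interval_integral_substitution_finite[symmetric])
      (auto intro!: derivative_eq_intros continuous_intros simp: f_def zy den')
  also have "\<dots> = (LBINT a=0..pi. g a)"
  proof (rule interval_integral_cong)
    fix a assume "a \<in> einterval (min 0 (ereal pi)) (max 0 (ereal pi))"
    then have a: "0 < a" "a < pi" by (auto simp: einterval_iff min_def max_def split: if_splits)
    have "max 0 (v - (- c * cos a)\<^sup>2) = (c * sin a)\<^sup>2"
      using c(2) by (simp add: power_mult_distrib sin_squared_eq algebra_simps max_def) (smt (verit, best) cos_squared_eq mult_nonneg_nonneg v zero_le_power2 mult_left_le abs_square_le_1 abs_cos_le_one)
    then have "sqrt (max 0 (v - (- c * cos a)\<^sup>2)) = c * sin a"
      using a c(1) sin_gt_zero[of a] by simp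
    then show "(c * sin a) *\<^sub>R f (- c * cos a) = g a"
      unfolding f_def g_def c(2)[symmetric] by (simp add: scaleR_conv_of_real power2_eq_square)
  qed
  finally have I2: "(LBINT y=-c..c. f y) = of_real (- 2 * pi) + 2 * X * of_real pi"
    using I1 A0 Api by simp
  have "(LBINT y=-c..c. f y) = (LINT y:{-c..c}|lborel. f y)"
    using c(1) by (subst interval_integral_Icc) auto
  also have "\<dots> = (LINT y|lborel. f y)"
    unfolding set_lebesgue_integral_def
  proof (rule Bochner_Integration.integral_cong[OF refl])
    fix y 
    have "f y = 0" if "y \<notin> {-c..c}"
    proof -
      have "y < - c \<or> c < y" using that by auto
      then have "\<bar>c\<bar> < \<bar>y\<bar>" using c(1) by linarith
      then have "c\<^sup>2 < y\<^sup>2" by (simp add: power2_strict_mono)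
      then show ?thesis unfolding f_def c(2) by simp
    qed
    then show "indicat_real {- c..c} y *\<^sub>R f y = f y" by (auto simp: indicator_def)
  qed
  finally have "(LINT y|lborel. f y) = of_real (- 2 * pi) + 2 * X * of_real pi" using I2 by simp
  then have "Re (LINT y|lborel. f y) = Re (of_real (- 2 * pi) + 2 * X * of_real pi)" by simp
  then have "Re (LINT y|lborel. f y) = 2 * pi * (Re X - 1)" by (simp add: algebra_simps)
  then show ?thesis unfolding f_def ReX2 .
qed

section \<open>Filtering the Radon transform of a radial function\<close>

lemma integrable_inverse_sqrt:
  "integrable lborel (\<lambda>x::real. indicator {-c..c} x / sqrt \<bar>x\<bar>)"
proof (cases "c \<ge> 0")
  case True
  have "(\<lambda>x. 1 / sqrt \<bar>x\<bar>) integrable_on {0..c}"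
  proof -
    have "(\<lambda>x. x powr (-1/2)) integrable_on {0..c}"
      by (rule has_integral_integrable, rule has_integral_powr_from_0) (use True in auto)
    then show ?thesis
    proof (rule integrable_eq)
      fix x assume "x \<in> {0..c}"
      then show "x powr (-1/2) = 1 / sqrt \<bar>x\<bar>"
        using powr_minus_divide[of x "1/2"] powr_half_sqrt[of x] by simp
    qed
  qed
  then have "(\<lambda>x. 1 / sqrt \<bar>x\<bar>) absolutely_integrable_on {0..c}"
    by (rule nonnegative_absolutely_integrable_1) auto
  moreover define f where "f = (\<lambda>x. indicator {0..c} x *\<^sub>R (1 / sqrt \<bar>x\<bar>))"
  ultimately have "integrable lebesgue f" unfolding set_integrable_def by simp
  moreover have "f \<in> borel_measurable lborel" unfolding f_def by measurable
  ultimately have "integrable lborel f" by (simp add: integrable_completion)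
  then have i: "integrable lborel (\<lambda>x::real. indicator {0..c} x / sqrt \<bar>x\<bar>)" by (simp add: f_def)
  have "integrable lborel (\<lambda>x::real. indicator {0..c} x / sqrt \<bar>x\<bar> + indicator {0..c} (-x) / sqrt \<bar>x\<bar>)"
    using i lborel_integrable_real_affine[OF i, of "-1" 0] by (intro Bochner_Integration.integrable_add) auto
  moreover have "(\<lambda>x::real. indicator {0..c} x / sqrt \<bar>x\<bar> + indicator {0..c} (-x) / sqrt \<bar>x\<bar>)
      = (\<lambda>x. indicator {-c..c} x / sqrt \<bar>x\<bar>)"
    using True by (auto simp: indicator_def fun_eq_iff)
  ultimately show ?thesis by simp
next
  case False
  then have "{-c..c} = {}" by auto
  then show ?thesis by simp
qed

text \<open>Integrable majorant for the passage to the limit \<open>\<epsilon> \<rightarrow> 0\<close> in \<open>riesz_radial\<close>.\<close>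

lemma integrable_inverse_sqrt_shift:
  "integrable lborel (\<lambda>v::real. indicator {0..b} v / sqrt \<bar>m - v\<bar>)"
proof -
  define c where "c = \<bar>m\<bar> + \<bar>b\<bar>"
  have "integrable lborel (\<lambda>v::real. indicator {-c..c} (m - v) / sqrt \<bar>m - v\<bar>)"
    using lborel_integrable_real_affine[OF integrable_inverse_sqrt[of c], of "-1" m] by simp
  then show ?thesis
  proof (rule Bochner_Integration.integrable_bound)
    have "norm (indicator {0..b} v / sqrt \<bar>m - v\<bar>) \<le> norm (indicator {-c..c} (m - v) / sqrt \<bar>m - v\<bar>)" for v :: real
      by (auto simp: indicator_def c_def)
    then show "AE v in lborel. norm (indicator {0..b} v / sqrt \<bar>m - v\<bar>) \<le> norm (indicator {-c..c} (m - v) / sqrt \<bar>m - v\<bar>)"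
      by simp
  qed measurable
qed

lemma continuous_compact_support_bounded:
  fixes f :: "'a::euclidean_space \<Rightarrow> 'b::real_normed_vector"
  assumes "continuous_on UNIV f" "\<And>x. x \<notin> cbox a b \<Longrightarrow> f x = 0"
  obtains B where "B \<ge> 0" "\<And>x. norm (f x) \<le> B"
proof -
  have "bounded (f ` cbox a b)"
    by (intro compact_imp_bounded compact_continuous_image compact_cbox continuous_on_subset[OF assms(1)]) auto
  then obtain B where B: "\<And>x. x \<in> cbox a b \<Longrightarrow> norm (f x) \<le> B" unfolding bounded_iff by (metis imageI)
  have "norm (f x) \<le> max 0 B" for x using B[of x] assms(2)[of x] by (cases "x \<in> cbox a b") auto
  then show ?thesis using that[of "max 0 B"] by simp
qed

lemma borel_measurable_cis [measurable]: "cis \<in> borel_measurable borel"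
  by (intro borel_measurable_continuous_onI) (auto simp: cis_conv_exp intro!: continuous_intros)

text \<open>The radial function is \<open>P(|x|\<^sup>2)\<close>; it vanishes near the origin because \<open>a > 0\<close>. Three derivatives of \<open>P\<close> are
  what \<open>fourier_decay\<close> consumes.\<close>

locale radial_profile =
  fixes P p p1 p2 :: "real \<Rightarrow> real" and a b :: real
  assumes dP: "\<And>u. (P has_real_derivative p u) (at u)"
    and dp: "\<And>u. (p has_real_derivative p1 u) (at u)"
    and dp1: "\<And>u. (p1 has_real_derivative p2 u) (at u)"
    and cp2: "continuous_on UNIV p2"
    and P0: "\<And>u. u < a \<Longrightarrow> P u = 0" "\<And>u. u > b \<Longrightarrow> P u = 0"
    and ab: "0 < a" "a < b"
begin

definition \<psi> :: "plane \<Rightarrow> complex" where "\<psi> x = of_real (P ((norm x)\<^sup>2))"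
definition q :: "real \<Rightarrow> real" where "q s = (LINT t|lborel. P (s\<^sup>2 + t\<^sup>2))"
definition L where "L = b + 1"

lemma derivative_vanishes:
  assumes "\<And>u. (f has_real_derivative g u) (at u)" "\<And>u. u < a \<or> u > b \<Longrightarrow> f u = 0" "u < a \<or> u > b"
  shows "g u = (0::real)"
proof -
  have "((\<lambda>u. 0) has_real_derivative g u) (at u)"
    by (rule has_field_derivative_transform_within_open[OF assms(1), where S="{..<a} \<union> {b<..}"])
      (use assms(2,3) in auto)
  then show ?thesis by (metis DERIV_const DERIV_unique)
qed

lemma vanish: "u < a \<or> u > b \<Longrightarrow> P u = 0" "u < a \<or> u > b \<Longrightarrow> p u = 0"
    "u < a \<or> u > b \<Longrightarrow> p1 u = 0" "u < a \<or> u > b \<Longrightarrow> p2 u = 0"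
proof -
  have 0: "P u = 0" if "u < a \<or> u > b" for u using that P0 by auto
  have 1: "p u = 0" if "u < a \<or> u > b" for u by (rule derivative_vanishes[OF dP 0 that])
  have 2: "p1 u = 0" if "u < a \<or> u > b" for u by (rule derivative_vanishes[OF dp 1 that])
  have 3: "p2 u = 0" if "u < a \<or> u > b" for u by (rule derivative_vanishes[OF dp1 2 that])
  show "u < a \<or> u > b \<Longrightarrow> P u = 0" "u < a \<or> u > b \<Longrightarrow> p u = 0"
    "u < a \<or> u > b \<Longrightarrow> p1 u = 0" "u < a \<or> u > b \<Longrightarrow> p2 u = 0" using 0 1 2 3 by auto
qed

lemma cont: "continuous_on UNIV P" "continuous_on UNIV p" "continuous_on UNIV p1"
  using dP dp dp1 by (auto intro!: DERIV_continuous_on simp: has_field_derivative_at_within)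

lemma meas [measurable]: "P \<in> borel_measurable borel" "p \<in> borel_measurable borel"
  using cont by (auto intro: borel_measurable_continuous_onI)

lemma L: "L > 1" "L > 0" "\<bar>s\<bar> \<ge> L \<Longrightarrow> s\<^sup>2 > b"
proof -
  show l: "L > 1" using ab by (simp add: L_def)
  then show "L > 0" by simp
  assume "\<bar>s\<bar> \<ge> L"
  then have "L\<^sup>2 \<le> s\<^sup>2" using l power_mono[of L "\<bar>s\<bar>" 2] by simp
  moreover have "L\<^sup>2 > b" using ab by (simp add: L_def power2_eq_square algebra_simps add_pos_pos)
  ultimately show "s\<^sup>2 > b" by simp
qed

lemma big: "\<bar>s\<bar> \<ge> L \<or> \<bar>t\<bar> \<ge> L \<Longrightarrow> s\<^sup>2 + t\<^sup>2 < a \<or> s\<^sup>2 + t\<^sup>2 > b"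
  using L(3)[of s] L(3)[of t] zero_le_power2[of s] zero_le_power2[of t] by linarith

lemma out: "(s, t) \<notin> cbox (-L, -L) (L, L) \<Longrightarrow> s\<^sup>2 + t\<^sup>2 < a \<or> s\<^sup>2 + t\<^sup>2 > b"
  by (rule big) (auto simp: cbox_Pair_eq)

lemma radon_\<psi>: "radon \<psi> (s, \<phi>) = of_real (q s)"
  unfolding radon_def q_def \<psi>_def prod.case norm_line_point by simp

lemma integrable_P2: "integrable lborel (\<lambda>(s, t). P (s\<^sup>2 + t\<^sup>2))"
proof (rule integrable_compact_support)
  show "continuous_on UNIV (\<lambda>(s, t). P (s\<^sup>2 + t\<^sup>2))"
    by (auto simp: case_prod_unfold intro!: continuous_intros continuous_on_compose2[OF cont(1)])
  show "(case x of (s, t) \<Rightarrow> P (s\<^sup>2 + t\<^sup>2)) = 0" if "x \<notin> cbox (-L, -L) (L, L)" for x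
    using that out vanish(1) by (cases x) auto
qed

lemma integrable_q: "integrable lborel q"
  using lborel_pair.integrable_fst[of "\<lambda>s t. P (s\<^sup>2 + t\<^sup>2)"] integrable_P2
  unfolding q_def lborel_prod by simp

definition q_hat :: "real \<Rightarrow> complex" where "q_hat \<sigma> = (LINT s|lborel. q s * cis (- (\<sigma> * s)))"

lemma fourier_\<psi>: "fourier_s (radon \<psi>) (\<sigma>, \<phi>) = q_hat \<sigma>"
  by (simp add: fourier_s_def q_hat_def radon_\<psi>)

lemma q_hat_Fubini: "q_hat \<sigma> = (LINT t|lborel. LINT s|lborel. P (s\<^sup>2 + t\<^sup>2) * cis (- (\<sigma> * s)))"
proof -
  have "integrable (lborel \<Otimes>\<^sub>M lborel) (\<lambda>(s, t). complex_of_real (P (s\<^sup>2 + t\<^sup>2)) * cis (- (\<sigma> * s)))"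
    unfolding lborel_prod
  proof (rule integrable_compact_support)
    show "continuous_on UNIV (\<lambda>(s, t). complex_of_real (P (s\<^sup>2 + t\<^sup>2)) * cis (- (\<sigma> * s)))"
      by (auto simp: case_prod_unfold cis_conv_exp intro!: continuous_intros continuous_on_compose2[OF cont(1)])
    show "(case x of (s, t) \<Rightarrow> complex_of_real (P (s\<^sup>2 + t\<^sup>2)) * cis (- (\<sigma> * s))) = 0"
      if "x \<notin> cbox (-L, -L) (L, L)" for x
      using that out vanish(1) by (cases x) auto
  qed
  from lborel_pair.Fubini_integral[OF this]
  show ?thesis unfolding q_hat_def q_def by simp
qed

text \<open>The decay estimate is applied to \<open>s \<mapsto> P(s\<^sup>2 + t\<^sup>2)\<close> for each fixed \<open>t\<close>, with a bound on
  its derivatives that is uniform in \<open>t\<close>; so \<open>q\<close> need not be differentiated.\<close>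

lemma q_hat_decay: obtains C where "C \<ge> 0" "\<And>\<sigma>. \<bar>\<sigma>\<bar> * norm (q_hat \<sigma>) \<le> C / (1 + \<sigma>\<^sup>2)"
proof -
  \<comment> \<open>The first three derivatives of \<open>s \<mapsto> P(s\<^sup>2 + t\<^sup>2)\<close>.\<close>
  define f1 where "f1 = (\<lambda>(s, t). 2 * s * p (s\<^sup>2 + t\<^sup>2))"
  define f2 where "f2 = (\<lambda>(s, t). 2 * p (s\<^sup>2 + t\<^sup>2) + 4 * s\<^sup>2 * p1 (s\<^sup>2 + t\<^sup>2))"
  define f3 where "f3 = (\<lambda>(s, t). 12 * s * p1 (s\<^sup>2 + t\<^sup>2) + 8 * s ^ 3 * p2 (s\<^sup>2 + t\<^sup>2))"
  have c: "continuous_on UNIV f1" "continuous_on UNIV f3"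
    unfolding f1_def f3_def case_prod_unfold
    by (intro continuous_intros continuous_on_compose2[OF cont(2)] continuous_on_compose2[OF cont(3)]
        continuous_on_compose2[OF cp2]; simp)+
  have d: "((\<lambda>s. P (s\<^sup>2 + t\<^sup>2)) has_real_derivative f1 (s, t)) (at s)"
    "((\<lambda>s. f1 (s, t)) has_real_derivative f2 (s, t)) (at s)"
    "((\<lambda>s. f2 (s, t)) has_real_derivative f3 (s, t)) (at s)" for s t
  proof -
    have D: "((\<lambda>s. s\<^sup>2 + t\<^sup>2) has_real_derivative 2 * s) (at s)" "((\<lambda>s. 4 * s\<^sup>2) has_real_derivative 8 * s) (at s)"
      by (auto intro!: derivative_eq_intros)
    note DP = DERIV_chain2[OF dP D(1)] and Dp = DERIV_chain2[OF dp D(1)] and Dp1 = DERIV_chain2[OF dp1 D(1)]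
    show "((\<lambda>s. P (s\<^sup>2 + t\<^sup>2)) has_real_derivative f1 (s, t)) (at s)"
      using DP by (rule DERIV_cong) (simp add: f1_def)
    show "((\<lambda>s. f1 (s, t)) has_real_derivative f2 (s, t)) (at s)"
      unfolding f1_def f2_def prod.case
      by (rule DERIV_cong[OF DERIV_mult[OF DERIV_cmult[OF DERIV_ident, of 2] Dp]])
        (simp add: power2_eq_square)
    show "((\<lambda>s. f2 (s, t)) has_real_derivative f3 (s, t)) (at s)"
      unfolding f2_def f3_def prod.case
      by (rule DERIV_cong[OF DERIV_add[OF DERIV_cmult[OF Dp, of 2] DERIV_mult[OF D(2) Dp1]]])
        (simp add: power2_eq_square power3_eq_cube)
  qed
  have z: "f1 (s, t) = 0" "f2 (s, t) = 0" "f3 (s, t) = 0" if "\<bar>s\<bar> \<ge> L \<or> \<bar>t\<bar> \<ge> L" for s t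
    using big[OF that] vanish by (auto simp: f1_def f2_def f3_def)
  have zc: "f1 x = 0" "f3 x = 0" if "x \<notin> cbox (-L, -L) (L, L)" for x
    using z[of "fst x" "snd x"] that by (cases x; auto simp: cbox_Pair_eq abs_if split: if_splits)+
  obtain B1 where B1: "B1 \<ge> 0" "\<And>x. norm (f1 x) \<le> B1"
    using continuous_compact_support_bounded[OF c(1) zc(1)] by metis
  obtain B3 where B3: "B3 \<ge> 0" "\<And>x. norm (f3 x) \<le> B3"
    using continuous_compact_support_bounded[OF c(2) zc(2)] by metis
  define B where "B = max B1 B3"
  have B: "B \<ge> 0" using B1(1) by (simp add: B_def)
  have fB: "\<bar>f1 x\<bar> \<le> B" "\<bar>f3 x\<bar> \<le> B" for x
    using B3(2)[of x] B1(2)[of x] unfolding B_def real_norm_def by linarith+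
  define C where "C = 8 * L * L * B"
  have "\<bar>\<sigma>\<bar> * norm (q_hat \<sigma>) \<le> C / (1 + \<sigma>\<^sup>2)" for \<sigma>
  proof -
    let ?F = "\<lambda>t. LINT s|lborel. complex_of_real (P (s\<^sup>2 + t\<^sup>2)) * cis (- (\<sigma> * s))"
    have F0: "?F t = 0" if "\<bar>t\<bar> \<ge> L" for t
      using big[of _ t] that vanish(1) by simp
    have F: "\<bar>\<sigma>\<bar> * norm (?F t) \<le> 4 * L * B / (1 + \<sigma>\<^sup>2) * indicator {-L..L} t" for t
    proof (cases "t \<in> {-L..L}")
      case True
      have "\<bar>\<sigma>\<bar> * norm (?F t) \<le> 4 * L * B / (1 + \<sigma>\<^sup>2)"
      proof (rule fourier_decay[where ?f1.0="\<lambda>s. f1 (s, t)" and ?f2.0="\<lambda>s. f2 (s, t)" and ?f3.0="\<lambda>s. f3 (s, t)"])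
        show "continuous_on UNIV (\<lambda>s. f3 (s, t))"
          by (rule continuous_on_compose2[OF c(2)]) (auto intro!: continuous_intros)
      qed (use d z B fB L(2) big vanish(1) in auto)
      then show ?thesis using True by simp
    next
      case False
      then have "\<bar>t\<bar> \<ge> L" by auto
      then show ?thesis using F0[of t] False by simp
    qed
    have "\<bar>\<sigma>\<bar> * norm (q_hat \<sigma>) \<le> \<bar>\<sigma>\<bar> * (LINT t|lborel. norm (?F t))"
      unfolding q_hat_Fubini by (intro mult_left_mono integral_norm_bound) auto
    also have "\<dots> = (LINT t|lborel. \<bar>\<sigma>\<bar> * norm (?F t))" by simp
    also have "\<dots> \<le> (LINT t|lborel. 4 * L * B / (1 + \<sigma>\<^sup>2) * indicator {-L..L} t)"
    proof (rule integral_mono')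
      show "integrable lborel (\<lambda>t. 4 * L * B / (1 + \<sigma>\<^sup>2) * indicator {-L..L} t)"
        by (intro integrable_mult_right integrable_real_indicator) (auto simp: emeasure_lborel_Icc_eq)
      show "\<bar>\<sigma>\<bar> * norm (?F t) \<le> 4 * L * B / (1 + \<sigma>\<^sup>2) * indicator {-L..L} t" for t by (rule F)
      show "0 \<le> 4 * L * B / (1 + \<sigma>\<^sup>2) * indicator {-L..L} t" for t :: real
        using B L(2) by (intro mult_nonneg_nonneg divide_nonneg_nonneg) auto
    qed
    also have "\<dots> = 4 * L * B / (1 + \<sigma>\<^sup>2) * (2 * L)" using L by simp
    finally show ?thesis by (simp add: C_def mult.commute mult.left_commute)
  qed
  moreover have "C \<ge> 0" using L B by (simp add: C_def)
  ultimately show ?thesis using that by blast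
qed

lemma measurable_q [measurable]: "q \<in> borel_measurable borel"
  using integrable_q borel_measurable_integrable by fastforce

lemma measurable_q_hat [measurable]: "q_hat \<in> borel_measurable borel"
  unfolding q_hat_def by measurable

lemma integrable_q_hat: "integrable lborel (\<lambda>\<sigma>. \<bar>\<sigma>\<bar> * norm (q_hat \<sigma>))"
proof -
  obtain C where C: "C \<ge> 0" "\<And>\<sigma>. \<bar>\<sigma>\<bar> * norm (q_hat \<sigma>) \<le> C / (1 + \<sigma>\<^sup>2)" using q_hat_decay by blast
  have "integrable lborel (\<lambda>\<sigma>. C * (1 / (1 + \<sigma>\<^sup>2)))"
    by (intro integrable_mult_right integrable_inverse_1_plus_square')
  then show ?thesis
    by (rule Bochner_Integration.integrable_bound) (use C in \<open>auto simp: abs_mult\<close>)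
qed

lemma riesz_eq: "riesz (radon \<psi>) (s, \<phi>)
    = 1 / (8 * of_real pi ^ 2) * (LINT \<sigma>|lborel. of_real \<bar>\<sigma>\<bar> * q_hat \<sigma> * cis (\<sigma> * s))"
proof -
  have "riesz (radon \<psi>) (s, \<phi>) = 1 / (2 * of_real pi) * (LINT \<sigma>|lborel. (1 / (4 * of_real pi)) * (of_real \<bar>\<sigma>\<bar> * q_hat \<sigma> * cis (\<sigma> * s)))"
    unfolding riesz_def fourier_\<psi> prod.case by (simp add: field_simps)
  then show ?thesis by (simp add: power2_eq_square)
qed

lemma riesz_bounded: "\<exists>C. \<forall>m. norm (riesz (radon \<psi>) m) \<le> C"
proof (intro exI allI)
  fix m :: "real \<times> real"
  obtain s \<phi> where m: "m = (s, \<phi>)" by (cases m)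
  have "norm (LINT \<sigma>|lborel. of_real \<bar>\<sigma>\<bar> * q_hat \<sigma> * cis (\<sigma> * s)) \<le> (LINT \<sigma>|lborel. norm (of_real \<bar>\<sigma>\<bar> * q_hat \<sigma> * cis (\<sigma> * s)))"
    by (rule integral_norm_bound)
  also have "\<dots> = (LINT \<sigma>|lborel. \<bar>\<sigma>\<bar> * norm (q_hat \<sigma>))" by (simp add: norm_mult)
  finally show "norm (riesz (radon \<psi>) m) \<le> 1 / (8 * pi\<^sup>2) * (LINT \<sigma>|lborel. \<bar>\<sigma>\<bar> * norm (q_hat \<sigma>))"
    unfolding m riesz_eq by (simp add: norm_mult norm_divide norm_power divide_right_mono)
qed

text \<open>The Fourier transform of \<open>|\<sigma>| exp (- \<epsilon> |\<sigma>|)\<close> at \<open>s - t\<close>.\<close>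

definition poisson where "poisson s \<epsilon> t = - 2 * Re (1 / (Complex s \<epsilon> - of_real t)\<^sup>2)"

text \<open>By Fubini, the multiplier \<open>|\<sigma>| exp (- \<epsilon> |\<sigma>|)\<close> acts on \<open>q\<close> as convolution with its Fourier transform.\<close>

lemma regularised:
  assumes e: "\<epsilon> > 0"
  shows "(LINT \<sigma>|lborel. of_real (\<bar>\<sigma>\<bar> * exp (- (\<epsilon> * \<bar>\<sigma>\<bar>))) * q_hat \<sigma> * cis (\<sigma> * s))
    = of_real (LINT t|lborel. q t * poisson s \<epsilon> t)"
proof -
  define k where "k \<sigma> = \<bar>\<sigma>\<bar> * exp (- (\<epsilon> * \<bar>\<sigma>\<bar>))" for \<sigma> :: real
  have ik: "integrable lborel k"
    using integrable_norm[OF poisson_kernel(1)[OF e, of 0]] by (simp add: k_def[abs_def] norm_mult)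
  have [measurable]: "k \<in> borel_measurable borel" unfolding k_def by measurable
  have int: "integrable (lborel \<Otimes>\<^sub>M lborel) (\<lambda>(\<sigma>, t). of_real (q t) * (of_real (k \<sigma>) * cis (\<sigma> * (s - t))))"
  proof (rule lborel_pair.Fubini_integrable)
    show "(\<lambda>(\<sigma>, t). complex_of_real (q t) * (of_real (k \<sigma>) * cis (\<sigma> * (s - t)))) \<in> borel_measurable (lborel \<Otimes>\<^sub>M lborel)"
      by measurable
    have n: "norm (complex_of_real (q t) * (of_real (k \<sigma>) * cis (\<sigma> * (s - t)))) = \<bar>k \<sigma>\<bar> * \<bar>q t\<bar>" for \<sigma> t
      by (simp add: norm_mult)
    show "integrable lborel (\<lambda>\<sigma>. LINT t|lborel. norm (case (\<sigma>, t) of (\<sigma>, t) \<Rightarrow> complex_of_real (q t) * (of_real (k \<sigma>) * cis (\<sigma> * (s - t)))))"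
      unfolding prod.case n using ik by (auto intro!: integrable_mult_left)
    show "AE \<sigma> in lborel. integrable lborel (\<lambda>t. case (\<sigma>, t) of (\<sigma>, t) \<Rightarrow> complex_of_real (q t) * (of_real (k \<sigma>) * cis (\<sigma> * (s - t))))"
    proof (rule AE_I2, unfold prod.case)
      fix \<sigma>
      have "integrable lborel (\<lambda>t. \<bar>k \<sigma>\<bar> * \<bar>q t\<bar>)" using integrable_q by auto
      then show "integrable lborel (\<lambda>t. complex_of_real (q t) * (of_real (k \<sigma>) * cis (\<sigma> * (s - t))))"
        by (rule Bochner_Integration.integrable_bound) (auto simp: norm_mult)
    qed
  qed
  have "(LINT \<sigma>|lborel. of_real (k \<sigma>) * q_hat \<sigma> * cis (\<sigma> * s))
     = (LINT \<sigma>|lborel. LINT t|lborel. of_real (q t) * (of_real (k \<sigma>) * cis (\<sigma> * (s - t))))"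
  proof (rule Bochner_Integration.integral_cong[OF refl])
    fix \<sigma>
    have "of_real (k \<sigma>) * q_hat \<sigma> * cis (\<sigma> * s) = (LINT t|lborel. of_real (k \<sigma>) * cis (\<sigma> * s) * (q t * cis (- (\<sigma> * t))))"
      unfolding q_hat_def by simp
    also have "\<dots> = (LINT t|lborel. of_real (q t) * (of_real (k \<sigma>) * cis (\<sigma> * (s - t))))"
    proof (rule Bochner_Integration.integral_cong[OF refl])
      fix t
      have "cis (\<sigma> * (s - t)) = cis (\<sigma> * s) * cis (- (\<sigma> * t))" by (simp add: cis_mult algebra_simps)
      then show "of_real (k \<sigma>) * cis (\<sigma> * s) * (q t * cis (- (\<sigma> * t))) = of_real (q t) * (of_real (k \<sigma>) * cis (\<sigma> * (s - t)))"
        by simp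
    qed
    finally show "of_real (k \<sigma>) * q_hat \<sigma> * cis (\<sigma> * s) = (LINT t|lborel. of_real (q t) * (of_real (k \<sigma>) * cis (\<sigma> * (s - t))))" .
  qed
  also have "\<dots> = (LINT t|lborel. LINT \<sigma>|lborel. of_real (q t) * (of_real (k \<sigma>) * cis (\<sigma> * (s - t))))"
    by (rule lborel_pair.Fubini_integral[OF int, symmetric])
  also have "\<dots> = (LINT t|lborel. of_real (q t * poisson s \<epsilon> t))"
  proof (rule Bochner_Integration.integral_cong[OF refl])
    fix t
    have "(LINT \<sigma>|lborel. of_real (q t) * (of_real (k \<sigma>) * cis (\<sigma> * (s - t)))) = of_real (q t) * (LINT \<sigma>|lborel. of_real (k \<sigma>) * cis (\<sigma> * (s - t)))"
      by simp
    also have "(LINT \<sigma>|lborel. of_real (k \<sigma>) * cis (\<sigma> * (s - t))) = of_real (- 2 * Re (1 / (Complex (s - t) \<epsilon>)\<^sup>2))"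
      unfolding k_def by (rule poisson_kernel(2)[OF e])
    also have "Complex (s - t) \<epsilon> = Complex s \<epsilon> - of_real t" by (simp add: complex_eq_iff)
    finally show "(LINT \<sigma>|lborel. of_real (q t) * (of_real (k \<sigma>) * cis (\<sigma> * (s - t)))) = of_real (q t * poisson s \<epsilon> t)"
      by (simp add: poisson_def)
  qed
  finally show ?thesis unfolding k_def by (simp only: integral_complex_of_real)
qed

text \<open>Layer-cake formula: the radial function is a superposition, with weight \<open>- p v\<close>, of the indicator functions of
  the discs \<open>|x|\<^sup>2 \<le> v\<close>.\<close>

lemma P_layer: "P u = - (LINT v|lborel. p v * indicator {u..} v)"
proof -
  define c where "c = max u b + 1"
  have "(LINT v|lborel. indicator {u..c} v *\<^sub>R p v) = P c - P u"
    using dP continuous_on_subset[OF cont(2)]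
    by (intro integral_FTC_Icc) (auto simp: c_def has_real_derivative_iff_has_vector_derivative has_vector_derivative_at_within)
  moreover have c: "b < c" "u < c" by (auto simp: c_def)
  then have "P c = 0" using vanish(1)[of c] by simp
  moreover have "(LINT v|lborel. indicator {u..c} v *\<^sub>R p v) = (LINT v|lborel. p v * indicator {u..} v)"
    by (rule Bochner_Integration.integral_cong) (use vanish(2) c in \<open>auto simp: indicator_def\<close>)
  ultimately show ?thesis by simp
qed

text \<open>The Radon transform of the disc \<open>|x|\<^sup>2 \<le> v\<close> is the semicircle \<open>2 sqrt (v - t\<^sup>2)\<close>.\<close>

lemma q_layer: "q t = - (LINT v|lborel. p v * (2 * sqrt (max 0 (v - t\<^sup>2))))"
proof -
  obtain B where B: "B \<ge> 0" "\<And>x. norm (p x) \<le> B"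
    using continuous_compact_support_bounded[OF cont(2), of a b] vanish(2) by (metis atLeastAtMost_iff box_real(2) not_le)
  have int: "integrable (lborel \<Otimes>\<^sub>M lborel) (\<lambda>(y, v). p v * indicator {t\<^sup>2 + y\<^sup>2..} v)"
    unfolding lborel_prod
  proof (rule Bochner_Integration.integrable_bound)
    show "integrable lborel (\<lambda>x::real \<times> real. B * indicator (cbox (-L, 0) (L, b)) x)"
      by (intro integrable_mult_right integrable_real_indicator[OF _ emeasure_lborel_cbox_finite]) auto
    have "norm (p v * indicator {t\<^sup>2 + y\<^sup>2..} v) \<le> norm (B * indicator (cbox (-L, 0) (L, b)) (y, v))" for y v
    proof (cases "p v = 0 \<or> v < t\<^sup>2 + y\<^sup>2")
      case True then show ?thesis by (auto simp: indicator_def)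
    next
      case False
      then have v: "a \<le> v" "v \<le> b" "t\<^sup>2 + y\<^sup>2 \<le> v"
        unfolding not_less[symmetric] using vanish(2)[of v] by blast+
      then have "\<not> y\<^sup>2 > b" using zero_le_power2[of t] by linarith
      then have "\<bar>y\<bar> \<le> L" using L(3)[of y] by linarith
      then have "(y, v) \<in> cbox (-L, 0) (L, b)" using v ab by (auto simp: cbox_Pair_eq)
      then show ?thesis using B(1) B(2)[of v] by (auto simp: indicator_def)
    qed
    then show "AE x in lborel. norm (case x of (y, v) \<Rightarrow> p v * indicator {t\<^sup>2 + y\<^sup>2..} v) \<le> norm (B * indicator (cbox (-L, 0) (L, b)) x)"
      by auto
    have "(\<lambda>(y, v). p v * indicator {x. x \<ge> t\<^sup>2 + y\<^sup>2} v) \<in> borel_measurable (borel \<Otimes>\<^sub>M borel)"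
      by measurable
    then show "(\<lambda>(y, v). p v * indicator {t\<^sup>2 + y\<^sup>2..} v) \<in> borel_measurable lborel"
      unfolding borel_prod by (simp add: atLeast_def)
  qed
  have "q t = - (LINT y|lborel. LINT v|lborel. p v * indicator {t\<^sup>2 + y\<^sup>2..} v)"
    unfolding q_def P_layer[of "t\<^sup>2 + _"] by simp
  also have "\<dots> = - (LINT v|lborel. LINT y|lborel. p v * indicator {t\<^sup>2 + y\<^sup>2..} v)"
    using lborel_pair.Fubini_integral[OF int] by simp
  also have "\<dots> = - (LINT v|lborel. p v * (2 * sqrt (max 0 (v - t\<^sup>2))))"
  proof (intro arg_cong[where f=uminus] Bochner_Integration.integral_cong[OF refl])
    fix v
    define r where "r = sqrt (max 0 (v - t\<^sup>2))"
    have "(LINT y|lborel. indicator {t\<^sup>2 + y\<^sup>2..} v) = (LINT y|lborel. (indicator {-r..r} y :: real))"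
    proof (cases "v \<ge> t\<^sup>2")
      case True
      have "(indicator {t\<^sup>2 + y\<^sup>2..} v :: real) = indicator {-r..r} y" for y
      proof -
        have "t\<^sup>2 + y\<^sup>2 \<le> v \<longleftrightarrow> y\<^sup>2 \<le> r\<^sup>2" using True by (auto simp: r_def)
        also have "\<dots> \<longleftrightarrow> \<bar>y\<bar> \<le> r" using abs_le_square_iff[of y r] by (simp add: r_def)
        finally show ?thesis by (auto simp: indicator_def)
      qed
      then show ?thesis by simp
    next
      case False
      then have "r = 0" by (simp add: r_def)
      moreover have "(indicator {t\<^sup>2 + y\<^sup>2..} v :: real) = 0" for y
      proof -
        have "\<not> t\<^sup>2 + y\<^sup>2 \<le> v" using False zero_le_power2[of y] by linarith
        then show ?thesis by (simp add: indicator_def)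
      qed
      ultimately show ?thesis by simp
    qed
    then show "(LINT y|lborel. p v * indicator {t\<^sup>2 + y\<^sup>2..} v) = p v * (2 * sqrt (max 0 (v - t\<^sup>2)))"
      by (simp add: r_def)
  qed
  finally show ?thesis .
qed

text \<open>The nonnegative real part of a square root of \<open>z\<^sup>2 / (z\<^sup>2 - v)\<close> at \<open>z = s + i \<epsilon>\<close>.\<close>

definition reg_kernel where "reg_kernel s \<epsilon> v = sqrt ((norm ((Complex s \<epsilon>)\<^sup>2 / ((Complex s \<epsilon>)\<^sup>2 - of_real v))
   + Re ((Complex s \<epsilon>)\<^sup>2 / ((Complex s \<epsilon>)\<^sup>2 - of_real v))) / 2)"

lemma p_total: "integrable lborel p" "(LINT v|lborel. p v) = 0"
proof -
  show "integrable lborel p"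
    by (rule integrable_compact_support[OF cont(2), of a b]) (use vanish(2) in auto)
  have "(LINT v|lborel. p v) = (LINT v|lborel. p v * indicator {0..} v)"
    by (rule Bochner_Integration.integral_cong) (use vanish(2) ab in \<open>auto simp: indicator_def\<close>)
  also have "\<dots> = - P 0" using P_layer[of 0] by simp
  finally show "(LINT v|lborel. p v) = 0" using vanish(1)[of 0] ab by simp
qed

lemma continuous_poisson: "\<epsilon> > 0 \<Longrightarrow> continuous_on UNIV (poisson s \<epsilon>)"
proof -
  assume e: "\<epsilon> > 0"
  have "Complex s \<epsilon> - of_real t \<noteq> 0" for t using e by (auto simp: complex_eq_iff)
  then show ?thesis unfolding poisson_def by (intro continuous_intros) auto
qed

lemma semicircle_kernel:
  assumes "\<epsilon> > 0" "v > 0"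
  shows "(LINT t|lborel. 2 * sqrt (max 0 (v - t\<^sup>2)) * poisson s \<epsilon> t) = - 4 * pi * (reg_kernel s \<epsilon> v - 1)"
proof -
  have nz: "Complex s \<epsilon> - of_real t \<noteq> 0" for t using assms by (auto simp: complex_eq_iff)
  define f where "f t = complex_of_real (2 * sqrt (max 0 (v - t\<^sup>2))) / (Complex s \<epsilon> - of_real t)\<^sup>2" for t
  have fI: "integrable lborel f"
  proof (rule integrable_compact_support_real[where L="v + 1"])
    show "continuous_on UNIV f" unfolding f_def using nz by (intro continuous_intros) auto
    show "f x = 0" if "\<bar>x\<bar> > v + 1" for x
    proof -
      have "(v + 1)\<^sup>2 \<le> x\<^sup>2" using that assms power_mono[of "v+1" "\<bar>x\<bar>" 2] by simp
      moreover have "v \<le> (v + 1)\<^sup>2" using assms by (simp add: power2_eq_square algebra_simps)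
      ultimately show ?thesis by (simp add: f_def)
    qed
  qed
  have "(LINT t|lborel. 2 * sqrt (max 0 (v - t\<^sup>2)) * poisson s \<epsilon> t) = (LINT t|lborel. - 2 * Re (f t))"
  proof (rule Bochner_Integration.integral_cong[OF refl])
    fix t
    have "f t = of_real (2 * sqrt (max 0 (v - t\<^sup>2))) * (1 / (Complex s \<epsilon> - of_real t)\<^sup>2)" by (simp add: f_def)
    then have "Re (f t) = 2 * sqrt (max 0 (v - t\<^sup>2)) * Re (1 / (Complex s \<epsilon> - of_real t)\<^sup>2)"
      by (simp only: Re_complex_of_real Im_complex_of_real times_complex.sel)
    then show "2 * sqrt (max 0 (v - t\<^sup>2)) * poisson s \<epsilon> t = - 2 * Re (f t)" by (simp add: poisson_def)
  qed
  also have "\<dots> = - 2 * Re (LINT t|lborel. f t)" using integral_Re[OF fI] by simp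
  also have "Re (LINT t|lborel. f t) = 2 * pi * (reg_kernel s \<epsilon> v - 1)"
    unfolding f_def reg_kernel_def by (rule semicircle_integral) (use assms in auto)
  finally show ?thesis by simp
qed

text \<open>The constant term in \<open>semicircle_kernel\<close> drops out because the integral of \<open>p\<close> is \<open>0\<close>.\<close>

lemma regularised_p:
  assumes e: "\<epsilon> > 0"
  shows "(LINT t|lborel. q t * poisson s \<epsilon> t) = 4 * pi * (LINT v|lborel. p v * reg_kernel s \<epsilon> v)"
    and "integrable lborel (\<lambda>v. p v * reg_kernel s \<epsilon> v)"
proof -
  let ?g = "\<lambda>t v. p v * (2 * sqrt (max 0 (v - t\<^sup>2)) * poisson s \<epsilon> t)"
  have int: "integrable (lborel \<Otimes>\<^sub>M lborel) (\<lambda>(t, v). ?g t v)"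
    unfolding lborel_prod
  proof (rule integrable_compact_support)
    show "continuous_on UNIV (\<lambda>(t, v). ?g t v)"
      unfolding case_prod_unfold
      by (intro continuous_intros continuous_on_compose2[OF cont(2)] continuous_on_compose2[OF continuous_poisson[OF e]]) auto
    show "(case x of (t, v) \<Rightarrow> ?g t v) = 0" if x: "x \<notin> cbox (-L, a) (L, b)" for x
    proof (cases x)
      case (Pair t v)
      show ?thesis
      proof (cases "v < a \<or> v > b")
        case True then show ?thesis using vanish(2) Pair by auto
      next
        case False
        then have "\<bar>t\<bar> \<ge> L" using x Pair by (auto simp: cbox_Pair_eq)
        then have "v \<le> t\<^sup>2" using L(3)[of t] False by linarith
        then show ?thesis using Pair by simp
      qed
    qed
  qed
  have fv: "(LINT t|lborel. ?g t v) = - 4 * pi * (p v * reg_kernel s \<epsilon> v) + 4 * pi * p v" for v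
  proof (cases "v > 0")
    case True
    have "(LINT t|lborel. ?g t v) = p v * (LINT t|lborel. 2 * sqrt (max 0 (v - t\<^sup>2)) * poisson s \<epsilon> t)" by simp
    then show ?thesis unfolding semicircle_kernel[OF e True] by (simp add: algebra_simps)
  next
    case False
    then have "p v = 0" using vanish(2)[of v] ab by auto
    then show ?thesis by simp
  qed
  have "integrable lborel (\<lambda>v. LINT t|lborel. ?g t v)"
    by (rule lborel_pair.integrable_snd[OF int])
  then have "integrable lborel (\<lambda>v. - (1 / (4 * pi)) * ((- 4 * pi * (p v * reg_kernel s \<epsilon> v) + 4 * pi * p v) - 4 * pi * p v))"
    unfolding fv using p_total(1) by (intro integrable_mult_right Bochner_Integration.integrable_diff) auto
  then show i: "integrable lborel (\<lambda>v. p v * reg_kernel s \<epsilon> v)" by (simp add: algebra_simps)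
  have "(LINT t|lborel. q t * poisson s \<epsilon> t) = - (LINT t|lborel. LINT v|lborel. ?g t v)"
  proof -
    have "q t * poisson s \<epsilon> t = - (LINT v|lborel. ?g t v)" for t
    proof -
      have "(LINT v|lborel. ?g t v) = (LINT v|lborel. (p v * (2 * sqrt (max 0 (v - t\<^sup>2)))) * poisson s \<epsilon> t)"
        by (simp add: algebra_simps)
      then show ?thesis unfolding q_layer by simp
    qed
    then show ?thesis by simp
  qed
  also have "\<dots> = - (LINT v|lborel. LINT t|lborel. ?g t v)"
    using lborel_pair.Fubini_integral[OF int] by simp
  also have "\<dots> = 4 * pi * (LINT v|lborel. p v * reg_kernel s \<epsilon> v)"
    unfolding fv using i p_total by simp
  finally show "(LINT t|lborel. q t * poisson s \<epsilon> t) = 4 * pi * (LINT v|lborel. p v * reg_kernel s \<epsilon> v)" .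
qed

text \<open>The limit of \<open>reg_kernel\<close> as \<open>\<epsilon> \<rightarrow> 0\<close>, for \<open>v \<noteq> s\<^sup>2\<close>.\<close>

definition abel_kernel where "abel_kernel s v = (if v < s\<^sup>2 then \<bar>s\<bar> / sqrt (s\<^sup>2 - v) else 0)"

text \<open>With \<open>z = s + i \<epsilon>\<close> and \<open>c = sqrt v\<close>: \<open>|z\<^sup>2 - v| = |z - c| |z + c| \<ge> |s - c| |s + c| = |s\<^sup>2 - v|\<close>. Thus
  the singularity at \<open>v = s\<^sup>2\<close> is integrable uniformly in \<open>\<epsilon>\<close>.\<close>

lemma reg_kernel_bound:
  assumes "\<epsilon> > 0" "\<epsilon> \<le> 1" "v > 0" "v \<noteq> s\<^sup>2"
  shows "\<bar>reg_kernel s \<epsilon> v\<bar> \<le> (\<bar>s\<bar> + 1) / sqrt \<bar>s\<^sup>2 - v\<bar>"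
proof -
  define z where "z = Complex s \<epsilon>"
  define c where "c = sqrt v"
  have c: "c > 0" "v = c\<^sup>2" using assms by (auto simp: c_def)
  have "cmod (z - of_real w) \<ge> \<bar>s - w\<bar>" for w :: real
    using abs_Re_le_cmod[of "z - of_real w"] by (simp add: z_def)
  from this[of c] this[of "- c"] have "\<bar>s - c\<bar> * \<bar>s + c\<bar> \<le> cmod (z - of_real c) * cmod (z + of_real c)"
    by (intro mult_mono) auto
  also have "\<dots> = cmod (z\<^sup>2 - of_real v)"
    unfolding c(2) norm_mult[symmetric] by (simp add: power2_eq_square algebra_simps)
  also have "\<bar>s - c\<bar> * \<bar>s + c\<bar> = \<bar>s\<^sup>2 - v\<bar>" unfolding c(2) abs_mult[symmetric] by (simp add: power2_eq_square algebra_simps)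
  finally have d: "\<bar>s\<^sup>2 - v\<bar> \<le> cmod (z\<^sup>2 - of_real v)" .
  define l where "l = z\<^sup>2 / (z\<^sup>2 - of_real v)"
  have "0 \<le> norm l + Re l" using abs_Re_le_cmod[of l] by linarith
  then have reg_kernel: "\<bar>reg_kernel s \<epsilon> v\<bar> = sqrt ((norm l + Re l) / 2)" unfolding reg_kernel_def l_def z_def by simp
  also have "\<dots> \<le> sqrt (norm l)" using complex_Re_le_cmod[of l] by simp
  also have "norm l = (cmod z)\<^sup>2 / cmod (z\<^sup>2 - of_real v)" by (simp add: l_def norm_divide norm_power)
  also have "\<dots> \<le> (\<bar>s\<bar> + 1)\<^sup>2 / \<bar>s\<^sup>2 - v\<bar>"
  proof (rule frac_le)
    have "cmod z \<le> \<bar>s\<bar> + 1" using cmod_le[of z] assms by (simp add: z_def)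
    then show "(cmod z)\<^sup>2 \<le> (\<bar>s\<bar> + 1)\<^sup>2" by (intro power_mono) auto
  qed (use d assms(4) in auto)
  finally show ?thesis by (simp add: real_sqrt_divide)
qed

lemma integrable_p_abel_kernel: "integrable lborel (\<lambda>v. p v * abel_kernel s v)"
proof -
  obtain B where B: "B \<ge> 0" "\<And>x. norm (p x) \<le> B"
    using continuous_compact_support_bounded[OF cont(2), of a b] vanish(2) by (metis atLeastAtMost_iff box_real(2) not_le)
  have "integrable lborel (\<lambda>v. B * \<bar>s\<bar> * (indicator {0..b} v / sqrt \<bar>s\<^sup>2 - v\<bar>))"
    by (intro integrable_mult_right integrable_inverse_sqrt_shift)
  then show ?thesis
  proof (rule Bochner_Integration.integrable_bound)
    show "(\<lambda>v. p v * abel_kernel s v) \<in> borel_measurable lborel" unfolding abel_kernel_def by measurable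
    have "norm (p v * abel_kernel s v) \<le> norm (B * \<bar>s\<bar> * (indicator {0..b} v / sqrt \<bar>s\<^sup>2 - v\<bar>))" for v
    proof (cases "v \<in> {a..b} \<and> v < s\<^sup>2")
      case True
      have "norm (p v * abel_kernel s v) \<le> B * (\<bar>s\<bar> / sqrt \<bar>s\<^sup>2 - v\<bar>)"
        unfolding norm_mult using True B by (intro mult_mono) (auto simp: abel_kernel_def)
      then show ?thesis using True ab B(1) by (simp add: abs_mult)
    next
      case False
      then have z: "p v * abel_kernel s v = 0" using vanish(2)[of v] by (auto simp: abel_kernel_def)
      show ?thesis unfolding z by (simp only: norm_zero norm_ge_zero)
    qed
    then show "AE v in lborel. norm (p v * abel_kernel s v) \<le> norm (B * \<bar>s\<bar> * (indicator {0..b} v / sqrt \<bar>s\<^sup>2 - v\<bar>))" by simp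
  qed
qed

definition filtered where "filtered s = 1 / (2 * pi) * (LINT v|lborel. p v * abel_kernel s v)"

lemma filtered_eq_0: "s\<^sup>2 \<le> a \<Longrightarrow> filtered s = 0"
proof -
  assume "s\<^sup>2 \<le> a"
  then have z: "p v * abel_kernel s v = 0" for v using vanish(2)[of v] by (auto simp: abel_kernel_def)
  show ?thesis unfolding filtered_def z by simp
qed

text \<open>For \<open>0 < v < s\<^sup>2\<close> the kernel is at least \<open>1\<close>, and the integral of \<open>p\<close> over \<open>v < s\<^sup>2\<close> is \<open>P (s\<^sup>2)\<close>.\<close>

lemma filtered_ge: assumes "\<And>v. v < s\<^sup>2 \<Longrightarrow> p v \<ge> 0" shows "P (s\<^sup>2) / (2 * pi) \<le> filtered s"
proof -
  have i: "integrable lborel (\<lambda>v. p v * indicator {u..} v)" "integrable lborel (\<lambda>v. p v * indicator {..<u} v)" for u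
    using p_total(1) by (auto intro!: integrable_real_mult_indicator)
  have "P (s\<^sup>2) = (LINT v|lborel. p v) - (LINT v|lborel. p v * indicator {s\<^sup>2..} v)"
    using P_layer p_total(2) by simp
  also have "\<dots> = (LINT v|lborel. p v - p v * indicator {s\<^sup>2..} v)"
    using p_total(1) i by simp
  also have "\<dots> \<le> (LINT v|lborel. p v * abel_kernel s v)"
  proof (rule integral_mono[OF _ integrable_p_abel_kernel])
    show "integrable lborel (\<lambda>v. p v - p v * indicator {s\<^sup>2..} v)" using p_total(1) i by auto
    fix v
    show "p v - p v * indicator {s\<^sup>2..} v \<le> p v * abel_kernel s v"
    proof (cases "v < s\<^sup>2 \<and> v \<ge> a")
      case True
      then have "sqrt (s\<^sup>2 - v) \<le> sqrt (s\<^sup>2)" using ab by (intro real_sqrt_le_mono) simp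
      then have "abel_kernel s v \<ge> 1" using True by (simp add: abel_kernel_def)
      then have "p v * 1 \<le> p v * abel_kernel s v" using assms[of v] True by (intro mult_left_mono) auto
      then show ?thesis using True by simp
    next
      case False
      then show ?thesis using vanish(2)[of v] by (auto simp: abel_kernel_def)
    qed
  qed
  finally show ?thesis by (simp add: filtered_def divide_right_mono)
qed

lemma measurable_filtered [measurable]: "filtered \<in> borel_measurable borel"
  unfolding filtered_def abel_kernel_def by measurable

lemma reg_kernel_tendsto:
  assumes "v \<noteq> s\<^sup>2" "\<epsilon> \<longlonglongrightarrow> 0"
  shows "(\<lambda>n. reg_kernel s (\<epsilon> n) v) \<longlonglongrightarrow> abel_kernel s v"
proof -
  have nz: "(complex_of_real s)\<^sup>2 - of_real v \<noteq> 0"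
    using assms(1) by (metis eq_iff_diff_eq_0 of_real_eq_iff of_real_power)
  have z: "(\<lambda>n. Complex s (\<epsilon> n)) \<longlonglongrightarrow> of_real s"
    using tendsto_Complex[OF tendsto_const assms(2), of s] by (simp add: complex_of_real_def)
  define l where "l = s\<^sup>2 / (s\<^sup>2 - v)"
  have l: "(complex_of_real s)\<^sup>2 / ((of_real s)\<^sup>2 - of_real v) = of_real l" by (simp add: l_def)
  have "(\<lambda>n. reg_kernel s (\<epsilon> n) v) \<longlonglongrightarrow> sqrt ((norm ((complex_of_real s)\<^sup>2 / ((of_real s)\<^sup>2 - of_real v)) + Re ((of_real s)\<^sup>2 / ((of_real s)\<^sup>2 - of_real v))) / 2)"
    unfolding reg_kernel_def using nz by (intro tendsto_intros z) auto
  then have lim: "(\<lambda>n. reg_kernel s (\<epsilon> n) v) \<longlonglongrightarrow> sqrt ((\<bar>l\<bar> + l) / 2)"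
    unfolding l norm_of_real Re_complex_of_real .
  have "sqrt ((\<bar>l\<bar> + l) / 2) = abel_kernel s v"
  proof (cases "v < s\<^sup>2")
    case True
    then have "l \<ge> 0" by (simp add: l_def)
    then have "sqrt ((\<bar>l\<bar> + l) / 2) = sqrt l" by simp
    then show ?thesis using True by (simp add: l_def abel_kernel_def real_sqrt_divide)
  next
    case False
    then have "l \<le> 0" by (simp add: l_def divide_nonneg_nonpos)
    then show ?thesis using False by (simp add: abel_kernel_def)
  qed
  then show ?thesis using lim by simp
qed

text \<open>The layer \<open>v\<close> contributes the square root of \<open>z\<^sup>2 / (z\<^sup>2 - v)\<close> at \<open>z = s + i \<epsilon>\<close>, up to a constant. Its real part tends
  to \<open>|s| / sqrt (s\<^sup>2 - v)\<close> if \<open>v < s\<^sup>2\<close>, but to \<open>0\<close> if \<open>v > s\<^sup>2\<close>, where the root becomes imaginary: layers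
  outside the disc of radius \<open>|s|\<close> have no effect at \<open>s\<close>.\<close>

theorem riesz_radial: "riesz (radon \<psi>) (s, \<phi>) = of_real (filtered s)"
proof -
  define \<epsilon> where "\<epsilon> n = 1 / real (Suc n)" for n
  have e: "\<epsilon> n > 0" "\<epsilon> n \<le> 1" for n by (auto simp: \<epsilon>_def)
  have e0: "\<epsilon> \<longlonglongrightarrow> 0" unfolding \<epsilon>_def using LIMSEQ_inverse_real_of_nat by (simp add: inverse_eq_divide)
  obtain B where B: "B \<ge> 0" "\<And>x. norm (p x) \<le> B"
    using continuous_compact_support_bounded[OF cont(2), of a b] vanish(2) by (metis atLeastAtMost_iff box_real(2) not_le)
  have 1: "(\<lambda>n. LINT \<sigma>|lborel. of_real (\<bar>\<sigma>\<bar> * exp (- (\<epsilon> n * \<bar>\<sigma>\<bar>))) * q_hat \<sigma> * cis (\<sigma> * s))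
      \<longlonglongrightarrow> (LINT \<sigma>|lborel. of_real \<bar>\<sigma>\<bar> * q_hat \<sigma> * cis (\<sigma> * s))"
  proof (rule integral_dominated_convergence[OF _ _ integrable_q_hat])
    show "AE \<sigma> in lborel. (\<lambda>n. of_real (\<bar>\<sigma>\<bar> * exp (- (\<epsilon> n * \<bar>\<sigma>\<bar>))) * q_hat \<sigma> * cis (\<sigma> * s)) \<longlonglongrightarrow> of_real \<bar>\<sigma>\<bar> * q_hat \<sigma> * cis (\<sigma> * s)"
    proof (rule AE_I2)
      fix \<sigma>
      have "(\<lambda>n. of_real (\<bar>\<sigma>\<bar> * exp (- (\<epsilon> n * \<bar>\<sigma>\<bar>))) * q_hat \<sigma> * cis (\<sigma> * s)) \<longlonglongrightarrow> of_real (\<bar>\<sigma>\<bar> * exp (- (0 * \<bar>\<sigma>\<bar>))) * q_hat \<sigma> * cis (\<sigma> * s)"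
        by (intro tendsto_intros e0)
      then show "(\<lambda>n. of_real (\<bar>\<sigma>\<bar> * exp (- (\<epsilon> n * \<bar>\<sigma>\<bar>))) * q_hat \<sigma> * cis (\<sigma> * s)) \<longlonglongrightarrow> of_real \<bar>\<sigma>\<bar> * q_hat \<sigma> * cis (\<sigma> * s)" by simp
    qed
    show "AE \<sigma> in lborel. norm (of_real (\<bar>\<sigma>\<bar> * exp (- (\<epsilon> n * \<bar>\<sigma>\<bar>))) * q_hat \<sigma> * cis (\<sigma> * s)) \<le> \<bar>\<sigma>\<bar> * norm (q_hat \<sigma>)" for n
    proof (rule AE_I2)
      fix \<sigma> :: real
      have "exp (- (\<epsilon> n * \<bar>\<sigma>\<bar>)) \<le> 1" using e[of n] by simp
      then have "\<bar>\<sigma>\<bar> * exp (- (\<epsilon> n * \<bar>\<sigma>\<bar>)) * norm (q_hat \<sigma>) \<le> \<bar>\<sigma>\<bar> * 1 * norm (q_hat \<sigma>)"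
        by (intro mult_right_mono mult_left_mono) auto
      then show "norm (of_real (\<bar>\<sigma>\<bar> * exp (- (\<epsilon> n * \<bar>\<sigma>\<bar>))) * q_hat \<sigma> * cis (\<sigma> * s)) \<le> \<bar>\<sigma>\<bar> * norm (q_hat \<sigma>)"
        by (simp add: norm_mult)
    qed
  qed measurable
  have "(\<lambda>n. LINT v|lborel. p v * reg_kernel s (\<epsilon> n) v) \<longlonglongrightarrow> (LINT v|lborel. p v * abel_kernel s v)"
  proof (rule integral_dominated_convergence[where w="\<lambda>v. B * (\<bar>s\<bar> + 1) * (indicator {0..b} v / sqrt \<bar>s\<^sup>2 - v\<bar>)"])
    show "integrable lborel (\<lambda>v. B * (\<bar>s\<bar> + 1) * (indicator {0..b} v / sqrt \<bar>s\<^sup>2 - v\<bar>))"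
      by (intro integrable_mult_right integrable_inverse_sqrt_shift)
    show "AE v in lborel. (\<lambda>n. p v * reg_kernel s (\<epsilon> n) v) \<longlonglongrightarrow> p v * abel_kernel s v"
      using AE_lborel_singleton[of "s\<^sup>2"] by eventually_elim (intro tendsto_intros reg_kernel_tendsto e0, simp)
    show "AE v in lborel. norm (p v * reg_kernel s (\<epsilon> n) v) \<le> B * (\<bar>s\<bar> + 1) * (indicator {0..b} v / sqrt \<bar>s\<^sup>2 - v\<bar>)" for n
      using AE_lborel_singleton[of "s\<^sup>2"]
    proof eventually_elim
      case (elim v)
      show ?case
      proof (cases "v \<in> {a..b}")
        case True
        then have "norm (p v * reg_kernel s (\<epsilon> n) v) \<le> B * ((\<bar>s\<bar> + 1) / sqrt \<bar>s\<^sup>2 - v\<bar>)"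
          unfolding norm_mult using elim reg_kernel_bound[OF e(1)[of n] e(2)[of n], of v s] ab B by (intro mult_mono) auto
        then show ?thesis using True ab by simp
      next
        case False
        then have "p v = 0" using vanish(2)[of v] by auto
        then show ?thesis using B(1) by simp
      qed
    qed
    show "(\<lambda>v. p v * abel_kernel s v) \<in> borel_measurable lborel" unfolding abel_kernel_def by measurable
    show "(\<lambda>v. p v * reg_kernel s (\<epsilon> n) v) \<in> borel_measurable lborel" for n
      using regularised_p(2)[OF e(1)] by (rule borel_measurable_integrable)
  qed
  then have 2: "(\<lambda>n. complex_of_real (4 * pi * (LINT v|lborel. p v * reg_kernel s (\<epsilon> n) v))) \<longlonglongrightarrow> of_real (4 * pi * (LINT v|lborel. p v * abel_kernel s v))"
    by (intro tendsto_intros)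
  have "(LINT \<sigma>|lborel. of_real \<bar>\<sigma>\<bar> * q_hat \<sigma> * cis (\<sigma> * s)) = of_real (4 * pi * (LINT v|lborel. p v * abel_kernel s v))"
    using LIMSEQ_unique[OF 1] 2 unfolding regularised[OF e(1)] regularised_p(1)[OF e(1)] by blast
  then show ?thesis unfolding riesz_eq filtered_def by (simp add: power2_eq_square)
qed

lemma riesz_radial': "riesz (radon \<psi>) = (\<lambda>m. of_real (filtered (fst m)))"
  by (simp add: fun_eq_iff riesz_radial)

end

text \<open>Provides the hypotheses of \<open>riesz_radial\<close> and \<open>filtered_ge\<close> for the test function \<open>\<psi>(x / l)\<close>, where
  \<open>\<psi>(x) = annulus_profile \<delta> (|x|\<^sup>2)\<close>.\<close>

lemma radial_profile_rescaled:
  assumes "0 < \<delta>" "\<delta> \<le> 1" "0 < l"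
  obtains p p1 p2 where "radial_profile (\<lambda>u. annulus_profile \<delta> (u / l\<^sup>2)) p p1 p2 (l\<^sup>2) (5 * l\<^sup>2)"
    "\<And>u. u < 4 * l\<^sup>2 \<Longrightarrow> p u \<ge> 0"
proof -
  note pr = annulus_profile_props[OF assms(1,2)]
  define P where "P u = annulus_profile \<delta> (u / l\<^sup>2)" for u
  have sP: "smooth_on P UNIV" unfolding P_def by (rule smooth_rescale[OF pr(7)])
  obtain p where p: "\<And>u. (P has_real_derivative p u) (at u)" "smooth_on p UNIV" using smooth_derivative[OF sP] by blast
  obtain p1 where p1: "\<And>u. (p has_real_derivative p1 u) (at u)" "smooth_on p1 UNIV" using smooth_derivative[OF p(2)] by blast
  obtain p2 where p2: "\<And>u. (p1 has_real_derivative p2 u) (at u)" "smooth_on p2 UNIV" using smooth_derivative[OF p1(2)] by blast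
  have l: "l\<^sup>2 > 0" using assms by simp
  have "Ck_on 0 p2 UNIV" using p2(2) unfolding smooth_on_def by blast
  then have "continuous_on UNIV p2" by simp
  then have "radial_profile P p p1 p2 (l\<^sup>2) (5 * l\<^sup>2)"
    using p(1) p1(1) p2(1) l pr(1,2) by unfold_locales (auto simp: P_def field_simps)
  moreover have "p u \<ge> 0" if u: "u < 4 * l\<^sup>2" for u
  proof (rule ccontr)
    assume "\<not> p u \<ge> 0"
    then obtain e where e: "e > 0" "\<And>h. h > 0 \<Longrightarrow> h < e \<Longrightarrow> P (u + h) < P u"
      using DERIV_neg_dec_right[OF p(1)[of u]] by auto
    define h where "h = min (e/2) (4 * l\<^sup>2 - u)"
    have h: "0 < h" "h < e" "u + h \<le> 4 * l\<^sup>2" using e(1) u by (auto simp: h_def min_def)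
    have "P u \<le> P (u + h)" unfolding P_def using h l by (intro pr(6)) (auto simp: field_simps)
    then show False using e(2)[OF h(1,2)] by simp
  qed
  ultimately show ?thesis using that unfolding P_def by blast
qed

section \<open>Consequences of equal reconstructions\<close>

lemma test_function_continuous: "test_function f \<Longrightarrow> continuous_on UNIV f"
  unfolding test_function_def smooth_on_def by (metis Ck_on.simps(1))

lemma test_function_support:
  assumes "test_function f"
  obtains a where "\<And>x. x \<notin> cbox (-a) a \<Longrightarrow> f x = 0"
proof -
  have "bounded {x. f x \<noteq> 0}" using assms unfolding test_function_def by (simp add: compact_closure)
  then obtain a where "{x. f x \<noteq> 0} \<subseteq> cbox (-a) a" using bounded_subset_cbox_symmetric by blast
  then show ?thesis using that by blast
qed

lemma integrable_times_test_function:
  assumes "test_function f" "g \<in> borel_measurable borel" "\<And>x. norm (g x) \<le> B"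
  shows "integrable lborel (\<lambda>x. g x * f x)"
proof -
  obtain a where a: "\<And>x. x \<notin> cbox (-a) a \<Longrightarrow> f x = 0" using test_function_support[OF assms(1)] by blast
  have i: "integrable lborel f" by (rule integrable_compact_support[OF test_function_continuous[OF assms(1)] a])
  have "integrable lborel (\<lambda>x. B * norm (f x))" using i by (intro integrable_mult_right integrable_norm)
  then show ?thesis
  proof (rule Bochner_Integration.integrable_bound)
    show "(\<lambda>x. g x * f x) \<in> borel_measurable lborel"
      using assms(2) borel_measurable_integrable[OF i] by auto
    have "norm (g x * f x) \<le> norm (B * norm (f x))" for x
    proof -
      have "norm (g x * f x) \<le> B * norm (f x)" by (simp add: norm_mult mult_right_mono assms(3))
      also have "\<dots> \<le> norm (B * norm (f x))" unfolding real_norm_def by (rule abs_ge_self)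
      finally show ?thesis .
    qed
    then show "AE x in lborel. norm (g x * f x) \<le> norm (B * norm (f x))" by simp
  qed
qed

lemma continuous_times_test_function:
  assumes "test_function f" "continuous_on UNIV g"
  shows "integrable lborel (\<lambda>x. g x * f x)"
proof -
  obtain a where a: "\<And>x. x \<notin> cbox (-a) a \<Longrightarrow> f x = 0" using test_function_support[OF assms(1)] by blast
  show ?thesis
    by (rule integrable_compact_support[where a="-a" and b=a])
      (use a assms test_function_continuous in \<open>auto intro!: continuous_intros\<close>)
qed

text \<open>A polynomial without constant term, evaluated at the chord length, is bounded and vanishes for \<open>|s| \<ge> R\<close>.\<close>

lemma integrable_poly_chord:
  assumes D: "open D" "D \<subseteq> cball 0 R" and R: "R > 0" and Q0: "poly Q 0 = (0::complex)"
    and w: "w \<in> borel_measurable borel" "\<And>m. norm (w m) \<le> C"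
  shows "integrable lborel (\<lambda>m. indicator M_dom m *\<^sub>R (poly Q (of_real (chord D m)) * w m))"
proof -
  have "bounded ((\<lambda>x. poly Q (complex_of_real x)) ` {0..2 * R})"
    by (intro compact_imp_bounded compact_continuous_image compact_Icc continuous_intros)
  then obtain B where B: "\<And>x. x \<in> {0..2*R} \<Longrightarrow> norm (poly Q (complex_of_real x)) \<le> B"
    unfolding bounded_iff by blast
  have B0: "B \<ge> 0" using order_trans[OF norm_ge_zero B[of 0]] R by simp
  have C0: "C \<ge> 0" using w(2) norm_ge_zero order_trans by blast
  have [measurable]: "w \<in> borel_measurable borel" "D \<in> sets borel" using w D by auto
  note [measurable] = borel_measurable_chord[OF D(1)]
  have M [measurable]: "M_dom \<in> sets borel"
    unfolding M_dom_def borel_prod[symmetric] by measurable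
  have pm [measurable]: "poly Q \<in> borel_measurable borel"
    by (intro borel_measurable_continuous_onI continuous_intros)
  have "integrable lborel (\<lambda>m::real \<times> real. B * C * indicator (cbox (-R, -pi) (R, pi)) m)"
    by (intro integrable_mult_right integrable_real_indicator[OF _ emeasure_lborel_cbox_finite]) auto
  then show ?thesis
  proof (rule Bochner_Integration.integrable_bound)
    show "(\<lambda>m. indicator M_dom m *\<^sub>R (poly Q (of_real (chord D m)) * w m)) \<in> borel_measurable lborel"
      by measurable
    have "norm (indicator M_dom m *\<^sub>R (poly Q (of_real (chord D m)) * w m)) \<le> norm (B * C * indicator (cbox (-R, -pi) (R, pi)) m)" for m
    proof (cases m)
      case (Pair s \<phi>)
      show ?thesis
      proof (cases "\<bar>s\<bar> \<ge> R \<or> m \<notin> M_dom")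
        case True
        then have z: "indicator M_dom m *\<^sub>R (poly Q (of_real (chord D m)) * w m) = 0"
          using chord_eq_0[OF D, of s \<phi>] R Q0 Pair by auto
        show ?thesis unfolding z by (simp only: norm_zero norm_ge_zero)
      next
        case False
        then have m: "m \<in> cbox (-R, -pi) (R, pi)" using Pair by (auto simp: cbox_Pair_eq M_dom_def)
        have "sqrt (max 0 (R\<^sup>2 - s\<^sup>2)) \<le> sqrt (R\<^sup>2)" by (rule real_sqrt_le_mono) simp
        then have "chord D m \<le> 2 * sqrt (R\<^sup>2)"
          using chord_le[OF D, of s \<phi>] R Pair by simp
        then have "chord D m \<in> {0..2*R}" using chord_nonneg[of D m] R by auto
        then have "norm (poly Q (of_real (chord D m)) * w m) \<le> B * C"
          unfolding norm_mult using B w(2) B0 by (intro mult_mono) auto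
        then show ?thesis using m B0 C0 False by simp
      qed
    qed
    then show "AE m in lborel. norm (indicator M_dom m *\<^sub>R (poly Q (of_real (chord D m)) * w m))
       \<le> norm (B * C * indicator (cbox (-R, -pi) (R, pi)) m)" by simp
  qed
qed

text \<open>All the integrals converge absolutely, so the two pairings may be subtracted from each other; the
  term with \<open>\<chi>\<^sub>D\<close> cancels.\<close>

lemma equal_reconstructions:
  assumes D: "open D" "D \<subseteq> cball 0 R" and R: "R > 0" and Q0: "poly F 0 = 0" "poly F' 0 = 0"
    and h: "test_function h" "test_function h'" and \<psi>: "test_function \<psi>"
    and w: "riesz (radon \<psi>) \<in> borel_measurable borel" "\<And>m. norm (riesz (radon \<psi>) m) \<le> C"
    and eq: "same_distribution (f_CT D h F) (f_CT D h' F')"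
  shows "(LINT m|lborel. indicator M_dom m *\<^sub>R (poly (F - F') (of_real (chord D m)) * riesz (radon \<psi>) m))
       = (LINT x|lborel. (h' x - h x) * \<psi> x)"
proof -
  define I where "I Q = (LINT m|lborel. indicator M_dom m *\<^sub>R (poly Q (of_real (chord D m)) * riesz (radon \<psi>) m))" for Q
  have Dm: "D \<in> sets borel" using D by simp
  have iD: "integrable lborel (\<lambda>x. indicator D x * \<psi> x)"
    by (rule integrable_times_test_function[OF \<psi>, of _ 1]) (use Dm in \<open>auto simp: indicator_def\<close>)
  have ih: "integrable lborel (\<lambda>x. h x * \<psi> x)" "integrable lborel (\<lambda>x. h' x * \<psi> x)"
    using h \<psi> by (auto intro: continuous_times_test_function test_function_continuous)
  have CT: "f_CT D g Q \<psi> = (LINT x|lborel. g x * \<psi> x) + (LINT x|lborel. indicator D x * \<psi> x) + I Q"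
    if "integrable lborel (\<lambda>x. g x * \<psi> x)" for g Q
    unfolding f_CT_def radon_adjoint_def riesz_distr_def distr_on_def set_lebesgue_integral_def I_def radon_indicator
    using that iD by (simp add: distrib_right)
  have "f_CT D h F \<psi> = f_CT D h' F' \<psi>" using eq \<psi> unfolding same_distribution_def by blast
  then have "I F - I F' = (LINT x|lborel. h' x * \<psi> x) - (LINT x|lborel. h x * \<psi> x)"
    unfolding CT[OF ih(1)] CT[OF ih(2)] by (simp add: algebra_simps)
  moreover have "I F - I F' = I (F - F')"
    unfolding I_def
    by (subst Bochner_Integration.integral_diff[symmetric, OF integrable_poly_chord[OF D R Q0(1) w] integrable_poly_chord[OF D R Q0(2) w]])
      (simp add: algebra_simps)
  moreover have "(LINT x|lborel. h' x * \<psi> x) - (LINT x|lborel. h x * \<psi> x) = (LINT x|lborel. (h' x - h x) * \<psi> x)"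
    using ih by (simp add: left_diff_distrib)
  ultimately show ?thesis unfolding I_def by simp
qed

text \<open>Moves the dilation from the test function to \<open>H\<close>, which is the function to be differentiated in \<open>l\<close>.\<close>

lemma dilation_integral:
  fixes f :: "plane \<Rightarrow> complex"
  assumes "l > 0" "f \<in> borel_measurable borel"
  shows "(LINT y|lborel. f y) = l\<^sup>2 * (LINT x|lborel. f (l *\<^sub>R x))"
proof -
  have "lborel = density (distr lborel borel (\<lambda>x::plane. 0 + l *\<^sub>R x)) (\<lambda>_. ennreal (\<bar>l\<bar> ^ DIM(plane)))"
    using assms(1) by (intro lborel_affine) auto
  then have e: "lborel = density (distr lborel borel (\<lambda>x::plane. l *\<^sub>R x)) (\<lambda>_. ennreal (l\<^sup>2))"
    using assms(1) by (simp add: power2_eq_square)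
  have [measurable]: "f \<in> borel_measurable borel" by (rule assms(2))
  have "(LINT y|lborel. f y) = (LINT y|distr lborel borel (\<lambda>x::plane. l *\<^sub>R x). l\<^sup>2 *\<^sub>R f y)"
    by (subst e, subst integral_density) auto
  also have "\<dots> = (LINT x|lborel. l\<^sup>2 *\<^sub>R f (l *\<^sub>R x))"
    by (rule integral_distr) auto
  finally show ?thesis by (simp add: scaleR_conv_of_real)
qed

text \<open>If \<open>\<phi>\<close> differs from the polar angle of \<open>x\<close> by at most \<open>d\<close>, then the projection of \<open>x\<close> onto the direction
  \<open>\<phi>\<close> is \<open>|x|\<close> up to \<open>|x| d\<close>. Which side of the polar angle the window is placed on depends on the sign of
  the angle, so that the window fits into \<open>(-\<pi>, \<pi>)\<close> even if the angle is \<open>\<pi>\<close>.\<close>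

lemma angular_window:
  fixes x :: plane
  assumes d: "0 < d" "d \<le> 1"
  obtains \<alpha> where "{\<alpha>..\<alpha> + d / 2} \<subseteq> {-pi<..<pi}"
    "\<And>\<phi>. \<phi> \<in> {\<alpha>..\<alpha> + d / 2} \<Longrightarrow> \<bar>norm x - (fst x * cos \<phi> + snd x * sin \<phi>)\<bar> \<le> norm x * d"
proof -
  define z where "z = Complex (fst x) (snd x)"
  define t where "t = Arg z"
  have n: "cmod z = norm x" by (cases x) (simp add: z_def norm_Pair cmod_def)
  have x: "fst x = norm x * cos t" "snd x = norm x * sin t"
    using rcis_cmod_Arg[of z] unfolding n[symmetric] t_def by (metis Re_rcis complex.sel(1) z_def, metis Im_rcis complex.sel(2) z_def)
  have t: "-pi < t" "t \<le> pi" using Arg_bounded[of z] by (auto simp: t_def)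
  define \<alpha> where "\<alpha> = (if t > 0 then t - d else t + d / 2)"
  have "{\<alpha>..\<alpha> + d / 2} \<subseteq> {-pi<..<pi}"
    using t d pi_gt3 by (auto simp: \<alpha>_def split: if_splits)
  moreover have "\<bar>norm x - (fst x * cos \<phi> + snd x * sin \<phi>)\<bar> \<le> norm x * d" if "\<phi> \<in> {\<alpha>..\<alpha> + d / 2}" for \<phi>
  proof -
    have \<phi>: "\<bar>\<phi> - t\<bar> \<le> d" using that d by (auto simp: \<alpha>_def split: if_splits)
    have "fst x * cos \<phi> + snd x * sin \<phi> = norm x * cos (\<phi> - t)"
      unfolding cos_diff by (subst x(1), subst x(2)) (simp add: algebra_simps)
    then have "norm x - (fst x * cos \<phi> + snd x * sin \<phi>) = norm x * (1 - cos (\<phi> - t))" by (simp add: algebra_simps)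
    moreover have "1 - cos (\<phi> - t) = 2 * (sin ((\<phi> - t) / 2))\<^sup>2"
    proof -
      have "2 * ((\<phi> - t) / 2) = \<phi> - t" by simp
      then show ?thesis using cos_double_sin[of "(\<phi> - t) / 2"] by (simp only:)
    qed
    moreover have "2 * (sin ((\<phi> - t) / 2))\<^sup>2 \<le> d"
    proof -
      have "(sin ((\<phi> - t) / 2))\<^sup>2 = \<bar>sin ((\<phi> - t) / 2)\<bar> * \<bar>sin ((\<phi> - t) / 2)\<bar>" by (simp add: power2_eq_square)
      also have "\<dots> \<le> 1 * \<bar>(\<phi> - t) / 2\<bar>" by (intro mult_mono abs_sin_x_le_abs_x) auto
      finally show ?thesis using \<phi> by simp
    qed
    ultimately show ?thesis by (simp add: abs_mult mult_left_mono)
  qed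
  ultimately show ?thesis using that by blast
qed

text \<open>Division by the lowest coefficient makes the real part of the polynomial positive on \<open>(0, \<eta>]\<close>. This
  excludes cancellation when its values at different chord lengths are integrated.\<close>

lemma poly_low_order:
  fixes G :: "complex poly"
  assumes "G \<noteq> 0"
  obtains c k \<eta> where "c \<noteq> 0" "k = order 0 G" "\<eta> > 0"
    "\<And>x. 0 \<le> x \<Longrightarrow> x \<le> \<eta> \<Longrightarrow> x ^ k / 2 \<le> Re (poly G (of_real x) / c)"
proof -
  obtain G1 where G1: "G = [:- 0, 1:] ^ order 0 G * G1" "\<not> [:- 0, 1:] dvd G1" using order_decomp[OF assms, of 0] by blast
  define c where "c = poly G1 0"
  have c: "c \<noteq> 0" using G1(2) by (simp add: c_def dvd_iff_poly_eq_0)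
  have "continuous_on UNIV (\<lambda>x. Re (poly G1 (complex_of_real x) / c))"
    by (intro continuous_intros) (use c in auto)
  then have "isCont (\<lambda>x. Re (poly G1 (complex_of_real x) / c)) 0"
    by (simp add: continuous_on_eq_continuous_at)
  then have "(\<lambda>x. Re (poly G1 (complex_of_real x) / c)) \<midarrow>0\<rightarrow> 1" unfolding isCont_def using c by (simp add: c_def)
  then have "\<forall>\<^sub>F x in at 0. 1/2 < Re (poly G1 (complex_of_real x) / c)" by (rule order_tendstoD) simp
  then obtain d where d: "d > 0" "\<And>x. x \<noteq> 0 \<Longrightarrow> \<bar>x\<bar> < d \<Longrightarrow> 1/2 < Re (poly G1 (complex_of_real x) / c)"
    unfolding eventually_at by (auto simp: dist_real_def)
  have "x ^ order 0 G / 2 \<le> Re (poly G (of_real x) / c)" if x: "0 \<le> x" "x \<le> d / 2" for x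
  proof -
    have "1/2 \<le> Re (poly G1 (complex_of_real x) / c)"
      using d x c by (cases "x = 0") (auto simp: c_def less_imp_le)
    then have "x ^ order 0 G * (1/2) \<le> x ^ order 0 G * Re (poly G1 (complex_of_real x) / c)"
      using x by (intro mult_left_mono) auto
    also have "\<dots> = Re (of_real (x ^ order 0 G) * (poly G1 (complex_of_real x) / c))"
      by (simp only: times_complex.sel Re_complex_of_real Im_complex_of_real mult_zero_left diff_zero)
    also have "of_real (x ^ order 0 G) * (poly G1 (complex_of_real x) / c) = poly G (of_real x) / c"
      by (subst (2) G1(1)) simp
    finally show ?thesis by simp
  qed
  then show ?thesis using that[OF c refl, of "d/2"] d(1) by simp
qed

lemma diff_iter_integral:
  fixes H \<psi> :: "plane \<Rightarrow> complex"
  assumes H: "continuous_on UNIV H" and \<psi>: "test_function \<psi>"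
  shows "integrable lborel (\<lambda>x. diff_iter n \<tau> (\<lambda>l. H (l *\<^sub>R x)) l * \<psi> x)"
    and "diff_iter n \<tau> (\<lambda>l. LINT x|lborel. H (l *\<^sub>R x) * \<psi> x) l = (LINT x|lborel. diff_iter n \<tau> (\<lambda>l. H (l *\<^sub>R x)) l * \<psi> x)"
proof (induction n arbitrary: l)
  case 0
  case 1 show ?case
    using H by (auto intro!: continuous_times_test_function[OF \<psi>] continuous_on_compose2[OF H] continuous_intros)
  case 2 show ?case by simp
next
  case (Suc n)
  case 1 show ?case using Suc(1)[of "l + \<tau>"] Suc(1)[of l] by (simp add: left_diff_distrib)
  case 2 show ?case using Suc(1)[of "l + \<tau>"] Suc(1)[of l] Suc(2)[of "l + \<tau>"] Suc(2)[of l] by (simp add: left_diff_distrib)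
qed

text \<open>The equality of the reconstructions, tested against \<open>\<psi>(x / l)\<close>. The function \<open>W\<close> is the filtered Radon
  transform of that test function.\<close>

lemma radial_test_identity:
  fixes R \<delta> l :: real
  assumes D: "open D" "D \<subseteq> cball 0 R" and R: "R > 0" and Q0: "poly F 0 = 0" "poly F' 0 = 0"
    and h: "test_function h" "test_function h'"
    and eq: "same_distribution (f_CT D h F) (f_CT D h' F')"
    and \<delta>: "0 < \<delta>" "\<delta> \<le> 1" and l: "0 < l"
  obtains W where "W \<in> borel_measurable borel"
    "\<And>s. s\<^sup>2 \<le> l\<^sup>2 \<Longrightarrow> W s = 0"
    "\<And>s. s\<^sup>2 \<le> 4 * l\<^sup>2 \<Longrightarrow> annulus_profile \<delta> (s\<^sup>2 / l\<^sup>2) / (2 * pi) \<le> W s"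
    "integrable lborel (\<lambda>m. indicator M_dom m *\<^sub>R (poly (F - F') (of_real (chord D m)) * of_real (W (fst m))))"
    "(LINT m|lborel. indicator M_dom m *\<^sub>R (poly (F - F') (of_real (chord D m)) * of_real (W (fst m))))
      = of_real (l\<^sup>2) * (LINT x|lborel. (h' (l *\<^sub>R x) - h (l *\<^sub>R x)) * of_real (annulus_profile \<delta> ((norm x)\<^sup>2)))"
proof -
  obtain p p1 p2 where rp: "radial_profile (\<lambda>u. annulus_profile \<delta> (u / l\<^sup>2)) p p1 p2 (l\<^sup>2) (5 * l\<^sup>2)"
    and pos: "\<And>u. u < 4 * l\<^sup>2 \<Longrightarrow> p u \<ge> 0"
    using radial_profile_rescaled[OF \<delta> l] by blast
  interpret rp: radial_profile "\<lambda>u. annulus_profile \<delta> (u / l\<^sup>2)" p p1 p2 "l\<^sup>2" "5 * l\<^sup>2" by (rule rp)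
  note pr = annulus_profile_props[OF \<delta>]
  have tf: "test_function rp.\<psi>"
    unfolding rp.\<psi>_def[abs_def]
  proof (rule radial_test_function)
    show "smooth_on (\<lambda>u. annulus_profile \<delta> (u / l\<^sup>2)) UNIV" by (rule smooth_rescale[OF pr(7)])
    show "annulus_profile \<delta> (u / l\<^sup>2) = 0" if "u \<ge> 5 * l\<^sup>2" for u
      using that l by (intro pr(2)) (simp add: field_simps)
  qed
  have wm: "riesz (radon rp.\<psi>) \<in> borel_measurable borel"
    unfolding rp.riesz_radial' borel_prod[symmetric] by measurable
  obtain C where wb: "\<And>m. norm (riesz (radon rp.\<psi>) m) \<le> C" using rp.riesz_bounded by blast
  have H: "(\<lambda>y. (h' y - h y) * rp.\<psi> y) \<in> borel_measurable borel"
    using h tf by (intro borel_measurable_continuous_onI continuous_intros test_function_continuous)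
  have sc: "rp.\<psi> (l *\<^sub>R x) = of_real (annulus_profile \<delta> ((norm x)\<^sup>2))" for x
    using l by (simp add: rp.\<psi>_def power_mult_distrib)
  show ?thesis
  proof (rule that[of rp.filtered])
    show "rp.filtered \<in> borel_measurable borel" by measurable
    show "rp.filtered s = 0" if "s\<^sup>2 \<le> l\<^sup>2" for s by (rule rp.filtered_eq_0[OF that])
    show "annulus_profile \<delta> (s\<^sup>2 / l\<^sup>2) / (2 * pi) \<le> rp.filtered s" if "s\<^sup>2 \<le> 4 * l\<^sup>2" for s
      using that by (intro rp.filtered_ge pos) auto
    show "integrable lborel (\<lambda>m. indicator M_dom m *\<^sub>R (poly (F - F') (of_real (chord D m)) * of_real (rp.filtered (fst m))))"
      using integrable_poly_chord[OF D R _ wm wb, of "F - F'"] Q0 unfolding rp.riesz_radial' by simp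
    show "(LINT m|lborel. indicator M_dom m *\<^sub>R (poly (F - F') (of_real (chord D m)) * of_real (rp.filtered (fst m))))
      = of_real (l\<^sup>2) * (LINT x|lborel. (h' (l *\<^sub>R x) - h (l *\<^sub>R x)) * of_real (annulus_profile \<delta> ((norm x)\<^sup>2)))"
      using equal_reconstructions[OF D R Q0 h tf wm wb eq] dilation_integral[OF l H]
      unfolding rp.riesz_radial' sc of_real_power by (rule trans)
  qed
qed

text \<open>The integral, as a function of \<open>l = R - \<tau>\<close>, vanishes for \<open>l \<ge> R\<close>: there the filtered test function
  is \<open>0\<close> on \<open>|s| \<le> R\<close> and the chord length is \<open>0\<close> elsewhere. So its value at \<open>R - \<tau>\<close> equals, up to sign, its
  \<open>n\<close>-th difference with step \<open>\<tau>\<close>. The constant does not depend on \<open>\<delta>\<close> because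
  only the bound \<open>1\<close> on the test function enters; the steepness \<open>\<delta>\<close> may thus be chosen after \<open>\<tau>\<close>.\<close>

lemma radial_mean_decay:
  assumes D: "open D" "D \<subseteq> cball 0 R" and R: "R > 0" and Q0: "poly F 0 = 0" "poly F' 0 = 0"
    and h: "test_function h" "test_function h'"
    and eq: "same_distribution (f_CT D h F) (f_CT D h' F')"
  obtains C where "C \<ge> 0" "\<And>\<tau> \<delta>. 0 < \<tau> \<Longrightarrow> \<tau> \<le> 1 \<Longrightarrow> \<tau> < R \<Longrightarrow> 0 < \<delta> \<Longrightarrow> \<delta> \<le> 1 \<Longrightarrow>
    norm (LINT x|lborel. (h' ((R - \<tau>) *\<^sub>R x) - h ((R - \<tau>) *\<^sub>R x)) * of_real (annulus_profile \<delta> ((norm x)\<^sup>2))) \<le> C * \<tau> ^ n"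
proof -
  define H where "H x = h' x - h x" for x
  have sH: "smooth_on H UNIV"
  proof -
    have "Ck_on k (\<lambda>x. h' x + - h x) UNIV" for k
      using h unfolding test_function_def smooth_on_def
      by (intro Ck_on_add Ck_on_bounded_linear_compose[of uminus] bounded_linear_minus bounded_linear_ident) auto
    then show ?thesis by (simp add: smooth_on_def H_def[abs_def])
  qed
  have cH: "continuous_on UNIV H"
    unfolding H_def[abs_def] using h by (intro continuous_intros test_function_continuous)
  obtain C0 where C0: "\<forall>x l \<tau>. norm x \<le> 3 \<longrightarrow> 0 \<le> l \<longrightarrow> l \<le> R \<longrightarrow> 0 \<le> \<tau> \<longrightarrow> \<tau> \<le> 1 \<longrightarrow>
      norm (diff_iter n \<tau> (\<lambda>l. H (l *\<^sub>R x)) l) \<le> C0 * \<tau> ^ n"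
    using diff_iter_dilation_bound[OF sH, of 3 R n] by blast
  define C where "C = \<bar>C0\<bar> * measure lborel (cbox (-3, -3) (3, 3) :: plane set)"
  have "norm (LINT x|lborel. H ((R - \<tau>) *\<^sub>R x) * of_real (annulus_profile \<delta> ((norm x)\<^sup>2))) \<le> C * \<tau> ^ n"
    if \<tau>: "0 < \<tau>" "\<tau> \<le> 1" "\<tau> < R" and \<delta>: "0 < \<delta>" "\<delta> \<le> 1" for \<tau> \<delta>
  proof -
    note pr = annulus_profile_props[OF \<delta>]
    define \<psi> where "\<psi> x = complex_of_real (annulus_profile \<delta> ((norm x)\<^sup>2))" for x :: plane
    have tf: "test_function \<psi>" unfolding \<psi>_def[abs_def] by (rule radial_test_function[OF pr(7) pr(2)])
    define \<Phi> where "\<Phi> l = (LINT x|lborel. H (l *\<^sub>R x) * \<psi> x)" for l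
    have zero: "\<Phi> l = 0" if l: "l \<ge> R" for l
    proof -
      have l0: "0 < l" using l R by simp
      obtain W where W: "W \<in> borel_measurable borel" "\<And>s. s\<^sup>2 \<le> l\<^sup>2 \<Longrightarrow> W s = 0"
        "\<And>s. s\<^sup>2 \<le> 4 * l\<^sup>2 \<Longrightarrow> annulus_profile \<delta> (s\<^sup>2 / l\<^sup>2) / (2 * pi) \<le> W s"
        "integrable lborel (\<lambda>m. indicator M_dom m *\<^sub>R (poly (F - F') (of_real (chord D m)) * of_real (W (fst m))))" and
        id: "(LINT m|lborel. indicator M_dom m *\<^sub>R (poly (F - F') (of_real (chord D m)) * of_real (W (fst m))))
          = of_real (l\<^sup>2) * (LINT x|lborel. (h' (l *\<^sub>R x) - h (l *\<^sub>R x)) * of_real (annulus_profile \<delta> ((norm x)\<^sup>2)))"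
        by (rule radial_test_identity[OF D R Q0 h eq \<delta> l0]) (rule that; assumption)
      have z: "indicator M_dom m *\<^sub>R (poly (F - F') (of_real (chord D m)) * of_real (W (fst m))) = 0" for m
      proof (cases m)
        case (Pair s \<phi>)
        show ?thesis
        proof (cases "\<bar>s\<bar> \<ge> R")
          case True
          then show ?thesis using chord_eq_0[OF D _ True, of \<phi>] R Q0 Pair by simp
        next
          case False
          then have "s\<^sup>2 \<le> l\<^sup>2" using l R unfolding abs_le_square_iff[symmetric] by simp
          then show ?thesis using W(2) Pair by simp
        qed
      qed
      have "complex_of_real (l\<^sup>2) * \<Phi> l = 0" using id unfolding z \<Phi>_def \<psi>_def H_def by simp
      then show ?thesis using l0 by simp
    qed
    have "norm (\<Phi> (R - \<tau>)) = norm (diff_iter n \<tau> \<Phi> (R - \<tau>))"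
      by (rule norm_diff_iter_eq[symmetric]) (use zero \<tau> in auto)
    also have "diff_iter n \<tau> \<Phi> (R - \<tau>) = (LINT x|lborel. diff_iter n \<tau> (\<lambda>l. H (l *\<^sub>R x)) (R - \<tau>) * \<psi> x)"
      unfolding \<Phi>_def[abs_def] by (rule diff_iter_integral(2)[OF cH tf])
    also have "norm \<dots> \<le> (LINT x|lborel. norm (diff_iter n \<tau> (\<lambda>l. H (l *\<^sub>R x)) (R - \<tau>) * \<psi> x))"
      by (rule integral_norm_bound)
    also have "\<dots> \<le> (LINT x|lborel. \<bar>C0\<bar> * \<tau> ^ n * indicator (cbox (-3, -3) (3, 3) :: plane set) x)"
    proof (rule integral_mono)
      show "integrable lborel (\<lambda>x. norm (diff_iter n \<tau> (\<lambda>l. H (l *\<^sub>R x)) (R - \<tau>) * \<psi> x))"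
        by (intro integrable_norm diff_iter_integral(1)[OF cH tf])
      show "integrable lborel (\<lambda>x::plane. \<bar>C0\<bar> * \<tau> ^ n * indicator (cbox (-3, -3) (3, 3)) x)"
        by (intro integrable_mult_right integrable_real_indicator[OF _ emeasure_lborel_cbox_finite]) auto
      fix x :: plane
      show "norm (diff_iter n \<tau> (\<lambda>l. H (l *\<^sub>R x)) (R - \<tau>) * \<psi> x) \<le> \<bar>C0\<bar> * \<tau> ^ n * indicator (cbox (-3, -3) (3, 3)) x"
      proof (cases "norm x \<le> 3")
        case True
        have "norm (diff_iter n \<tau> (\<lambda>l. H (l *\<^sub>R x)) (R - \<tau>)) \<le> C0 * \<tau> ^ n" using C0[rule_format, of x "R - \<tau>" \<tau>] True \<tau> by simp
        also have "\<dots> \<le> \<bar>C0\<bar> * \<tau> ^ n" using \<tau> by (intro mult_right_mono) auto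
        finally have "norm (diff_iter n \<tau> (\<lambda>l. H (l *\<^sub>R x)) (R - \<tau>)) * norm (\<psi> x) \<le> \<bar>C0\<bar> * \<tau> ^ n * 1"
          using pr(4) \<tau> by (intro mult_mono) (auto simp: \<psi>_def)
        moreover have "x \<in> cbox (-3, -3) (3, 3)"
          using True norm_fst_le[of "fst x" "snd x"] norm_snd_le[of "snd x" "fst x"] by (cases x) (auto simp: cbox_Pair_eq)
        ultimately show ?thesis by (simp add: norm_mult)
      next
        case False
        then have "(norm x)\<^sup>2 \<ge> 3\<^sup>2" by (intro power_mono) auto
        then have "\<psi> x = 0" unfolding \<psi>_def using pr(2)[of "(norm x)\<^sup>2"] by simp
        then show ?thesis using \<tau> by simp
      qed
    qed
    also have "\<dots> = C * \<tau> ^ n" by (simp add: C_def)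
    finally show ?thesis unfolding \<Phi>_def \<psi>_def .
  qed
  moreover have "C \<ge> 0" by (simp add: C_def)
  ultimately show ?thesis using that unfolding H_def by blast
qed

section \<open>Uniqueness of the nonlinearity\<close>

theorem theorem2p1:
  fixes D1 D2 D :: "plane set"
    and h h' :: "plane \<Rightarrow> complex"
    and a a' :: "nat \<Rightarrow> complex" and J J' :: nat
    and F F' :: "complex poly"
  assumes "smooth_sc_domain D1" and "smooth_sc_domain D2"
    and "D1 \<inter> D2 = {}" and "D = D1 \<union> D2"
    and "strictly_convex D1" and "strictly_convex D2"
    and "test_function h" and "test_function h'"
    and "F = (\<Sum>j=2..J. monom (a j) j)" and "F' = (\<Sum>j=2..J'. monom (a' j) j)"
    and "same_distribution (f_CT D h F) (f_CT D h' F')"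
  shows "F = F'"
proof (rule ccontr)
  assume "F \<noteq> F'"
  then have G: "F - F' \<noteq> 0" by simp
  note h = assms(7,8) and eq = assms(11)
  have D: "open D" using assms(1,2,4) by (auto simp: smooth_sc_domain_def)
  have Q0: "poly F 0 = 0" "poly F' 0 = 0"
    unfolding assms(9,10) by (auto simp: poly_sum poly_monom intro!: sum.neutral)
  obtain R c r0 where R: "0 < R" and DR: "D \<subseteq> cball 0 R" and c: "0 < c" "c \<le> 1" and r0: "0 < r0"
    and balls: "\<And>r. 0 < r \<Longrightarrow> r < r0 \<Longrightarrow> \<exists>x. R - r \<le> norm x \<and> norm x \<le> R \<and> ball x (c * r) \<subseteq> D"
    using balls_near_farthest_point[OF assms(1,2,4)] by metis
  obtain g k \<eta> where g: "g \<noteq> 0" and \<eta>: "\<eta> > 0"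
    and low: "\<And>x. 0 \<le> x \<Longrightarrow> x \<le> \<eta> \<Longrightarrow> x ^ k / 2 \<le> Re (poly (F - F') (of_real x) / g)"
    using poly_low_order[OF G] by metis
  obtain C where C: "C \<ge> 0" and decay: "\<And>\<tau> \<delta>. 0 < \<tau> \<Longrightarrow> \<tau> \<le> 1 \<Longrightarrow> \<tau> < R \<Longrightarrow> 0 < \<delta> \<Longrightarrow> \<delta> \<le> 1 \<Longrightarrow>
    norm (LINT x|lborel. (h' ((R - \<tau>) *\<^sub>R x) - h ((R - \<tau>) *\<^sub>R x)) * of_real (annulus_profile \<delta> ((norm x)\<^sup>2))) \<le> C * \<tau> ^ (k + 3)"
    by (rule radial_mean_decay[OF D DR R Q0 h eq, where n="k + 3"]) (rule that; assumption)
  \<comment> \<open>Half of \<open>(c r)\<^sup>k\<close>, times \<open>1 / (2 \<pi>)\<close>, times the area of the window \<open>S\<close> below, without the power of \<open>r\<close>.\<close>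
  define A where "A = c ^ k * c * c / (64 * pi * R)"
  define B where "B = R\<^sup>2 * C * 4 ^ (k + 3) / norm g"
  have A0: "A > 0" using c R by (simp add: A_def)
  have B0: "B \<ge> 0" using C by (simp add: B_def)
  have main: "A * r ^ (k + 2) \<le> B * r ^ (k + 3)"
    if r: "0 < r" "r < r0" "8 * r \<le> R" "4 * r \<le> 1" "32 * R * r \<le> \<eta>\<^sup>2" for r
  proof -
    \<comment> \<open>The balls lie in \<open>|x| > R - 2 r = l + \<tau> / 2\<close>. There the test function has risen to \<open>1\<close>, because
      \<open>l\<^sup>2 (1 + \<delta>) = l\<^sup>2 + l \<tau> \<le> (l + \<tau> / 2)\<^sup>2\<close>.\<close>
    define \<tau> where "\<tau> = 4 * r"
    define l where "l = R - \<tau>"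
    define \<delta> where "\<delta> = \<tau> / l"
    have \<tau>: "0 < \<tau>" "\<tau> \<le> 1" "\<tau> < R" "2 * \<tau> \<le> R" using r R by (auto simp: \<tau>_def)
    have l: "0 < l" "\<tau> \<le> l" "R \<le> 2 * l" "l \<le> R" using \<tau> by (auto simp: l_def)
    have \<delta>: "0 < \<delta>" "\<delta> \<le> 1" using \<tau> l by (auto simp: \<delta>_def)
    note pr = annulus_profile_props[OF \<delta>]
    obtain W where W: "W \<in> borel_measurable borel" "\<And>s. s\<^sup>2 \<le> l\<^sup>2 \<Longrightarrow> W s = 0"
        "\<And>s. s\<^sup>2 \<le> 4 * l\<^sup>2 \<Longrightarrow> annulus_profile \<delta> (s\<^sup>2 / l\<^sup>2) / (2 * pi) \<le> W s"
      and int: "integrable lborel (\<lambda>m. indicator M_dom m *\<^sub>R (poly (F - F') (of_real (chord D m)) * of_real (W (fst m))))" (is "integrable _ ?I")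
      and id: "(LINT m|lborel. indicator M_dom m *\<^sub>R (poly (F - F') (of_real (chord D m)) * of_real (W (fst m))))
      = of_real (l\<^sup>2) * (LINT x|lborel. (h' (l *\<^sub>R x) - h (l *\<^sub>R x)) * of_real (annulus_profile \<delta> ((norm x)\<^sup>2)))"
      by (rule radial_test_identity[OF D DR R Q0 h eq \<delta> l(1)]) (rule that; assumption)
    obtain x where x: "R - r \<le> norm x" "norm x \<le> R" "ball x (c * r) \<subseteq> D" using balls[OF r(1,2)] by blast
    \<comment> \<open>So small that turning the direction by \<open>d\<close> moves the projection of \<open>x\<close> by at most a quarter of the radius \<open>c r\<close>.\<close>
    define d where "d = c * r / (4 * R)"
    have cr: "0 < c * r" "c * r \<le> r" using c r(1) by (auto simp: mult_left_le_one_le)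
    have d: "0 < d" "d \<le> 1"
    proof -
      have "c * r \<le> 4 * R" using cr(2) r(1,3) by linarith
      then show "d \<le> 1" using R by (simp add: d_def)
      show "0 < d" using cr(1) R by (simp add: d_def)
    qed
    obtain \<alpha> where \<alpha>: "{\<alpha>..\<alpha> + d / 2} \<subseteq> {-pi<..<pi}"
      "\<And>\<phi>. \<phi> \<in> {\<alpha>..\<alpha> + d / 2} \<Longrightarrow> \<bar>norm x - (fst x * cos \<phi> + snd x * sin \<phi>)\<bar> \<le> norm x * d"
      using angular_window[OF d, of x] by metis
    \<comment> \<open>Lines in \<open>S\<close> pass the centre \<open>x\<close> of the ball at distance at most \<open>c r / 2\<close>.\<close>
    define S where "S = cbox (norm x - c * r / 4, \<alpha>) (norm x + c * r / 4, \<alpha> + d / 2)"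
    define K where "K = (c * r) ^ k / 2 * (1 / (2 * pi))"
    have K0: "K \<ge> 0" using cr by (simp add: K_def)
    have chordS: "c * r \<le> chord D (s, \<phi>)" if "(s, \<phi>) \<in> S" for s \<phi>
    proof (rule chord_ge[OF D DR _ cr(1)])
      show "ball (fst x, snd x) (c * r) \<subseteq> D" using x(3) by simp
      have "norm x - c * r / 4 \<le> s" "s \<le> norm x + c * r / 4" using that by (auto simp: S_def cbox_Pair_eq)
      then have "\<bar>s - norm x\<bar> \<le> c * r / 4" by linarith
      moreover have "\<bar>norm x - (fst x * cos \<phi> + snd x * sin \<phi>)\<bar> \<le> c * r / 4"
      proof -
        have "\<bar>norm x - (fst x * cos \<phi> + snd x * sin \<phi>)\<bar> \<le> norm x * d"
          using that by (intro \<alpha>(2)) (auto simp: S_def cbox_Pair_eq)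
        also have "\<dots> \<le> R * d" using x(2) d by (intro mult_right_mono) auto
        also have "\<dots> = c * r / 4" using R by (simp add: d_def)
        finally show ?thesis .
      qed
      ultimately show "\<bar>s - (fst x * cos \<phi> + snd x * sin \<phi>)\<bar> \<le> c * r / 2" by linarith
    qed
    have pointwise: "K * indicator S m \<le> Re (?I m / g)" for m
    proof (cases m)
      case (Pair s \<phi>)
      have zero: "chord D m = 0" if "\<bar>s\<bar> \<ge> R" using chord_eq_0[OF D DR _ that] R Pair by simp
      show ?thesis
      proof (cases "m \<in> M_dom \<and> \<bar>s\<bar> < R \<and> l < \<bar>s\<bar>")
        case False
        have "m \<notin> S"
        proof
          assume mS: "m \<in> S"
          then have "m \<in> M_dom" using \<alpha>(1) Pair by (auto simp: S_def cbox_Pair_eq M_dom_def)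
          moreover have "\<bar>s\<bar> < R" using chordS[of s \<phi>] mS cr(1) zero Pair by force
          moreover have "norm x - c * r / 4 \<le> s" using mS Pair by (auto simp: S_def cbox_Pair_eq)
          then have "l < \<bar>s\<bar>" using x(1) cr r(1) unfolding l_def \<tau>_def by linarith
          ultimately show False using False by simp
        qed
        moreover have z: "?I m = 0"
        proof -
          consider "m \<notin> M_dom" | "\<bar>s\<bar> \<ge> R" | "\<bar>s\<bar> \<le> l" using False by linarith
          then show ?thesis
          proof cases
            case 3
            then have "s\<^sup>2 \<le> l\<^sup>2" using l unfolding abs_le_square_iff[symmetric] by simp
            then show ?thesis using W(2) Pair by simp
          qed (use zero Q0 in auto)
        qed
        ultimately show ?thesis unfolding z by simp
      next
        case True
        have s2: "s\<^sup>2 < R\<^sup>2" "l\<^sup>2 < s\<^sup>2"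
          using True power_strict_mono[of "\<bar>s\<bar>" R 2] power_strict_mono[of l "\<bar>s\<bar>" 2] l by auto
        have R4: "R\<^sup>2 \<le> 4 * l\<^sup>2" using power_mono[of R "2 * l" 2] R l by (simp add: power_mult_distrib)
        have u: "0 \<le> s\<^sup>2 / l\<^sup>2" "s\<^sup>2 / l\<^sup>2 \<le> 4" using s2 R4 l by (auto simp: field_simps)
        have Wpos: "0 \<le> W s"
          using W(3)[of s] pr(5)[OF u(2)] s2 R4 by (smt (verit) divide_nonneg_nonneg pi_ge_zero)
        define y where "y = chord D m"
        have y: "0 \<le> y" "y \<le> \<eta>"
        proof -
          show "0 \<le> y" by (simp add: y_def chord_nonneg)
          have "R\<^sup>2 - s\<^sup>2 \<le> R\<^sup>2 - l\<^sup>2" using s2 by simp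
          also have "\<dots> = (R + l) * \<tau>" by (simp add: l_def algebra_simps power2_eq_square)
          also have "\<dots> \<le> (2 * R) * \<tau>" using l \<tau> by (intro mult_right_mono) auto
          also have "\<dots> \<le> \<eta>\<^sup>2 / 4" using r(5) by (simp add: \<tau>_def)
          finally have "max 0 (R\<^sup>2 - s\<^sup>2) \<le> \<eta>\<^sup>2 / 4" using zero_le_power2[of \<eta>] by linarith
          then have "sqrt (max 0 (R\<^sup>2 - s\<^sup>2)) \<le> sqrt ((\<eta> / 2)\<^sup>2)"
            by (intro real_sqrt_le_mono) (simp only: power_divide, simp)
          then show "y \<le> \<eta>" using chord_le[OF D DR, of s \<phi>] R \<eta> Pair by (simp add: y_def)
        qed
        have "?I m / g = (poly (F - F') (of_real y) / g) * of_real (W s)"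
          using True Pair by (simp add: y_def)
        then have ReI: "Re (?I m / g) = Re (poly (F - F') (of_real y) / g) * W s"
          by (simp only: times_complex.sel Re_complex_of_real Im_complex_of_real mult_zero_right diff_zero)
        also have "\<dots> \<ge> y ^ k / 2 * W s" by (intro mult_right_mono low y Wpos)
        finally have ge: "y ^ k / 2 * W s \<le> Re (?I m / g)" .
        show ?thesis
        proof (cases "m \<in> S")
          case False
          have "0 \<le> y ^ k / 2 * W s" using y Wpos by simp
          then show ?thesis using ge False by simp
        next
          case mS: True
          have "norm x - c * r / 4 \<le> s" using mS Pair by (auto simp: S_def cbox_Pair_eq)
          then have "l + \<tau> / 2 \<le> s" using x(1) cr r(1) unfolding l_def \<tau>_def by linarith
          then have "(l + \<tau> / 2)\<^sup>2 \<le> s\<^sup>2" using l \<tau> by (intro power_mono) auto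
          moreover have "l\<^sup>2 + \<tau> * l \<le> (l + \<tau> / 2)\<^sup>2" by (simp add: power2_eq_square algebra_simps)
          moreover have "(1 + \<delta>) * l\<^sup>2 = l\<^sup>2 + \<tau> * l" using l(1) by (simp add: \<delta>_def field_simps power2_eq_square)
          ultimately have "1 + \<delta> \<le> s\<^sup>2 / l\<^sup>2" using l(1) by (simp add: pos_le_divide_eq)
          then have "annulus_profile \<delta> (s\<^sup>2 / l\<^sup>2) = 1" using u(2) by (rule pr(3))
          then have "1 / (2 * pi) \<le> W s" using W(3)[of s] s2 R4 by simp
          moreover have "(c * r) ^ k \<le> y ^ k" using chordS[of s \<phi>] mS Pair cr by (intro power_mono) (auto simp: y_def)
          ultimately have "K \<le> y ^ k / 2 * W s"
            unfolding K_def using y by (intro mult_mono) auto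
          then show ?thesis using ge mS by simp
        qed
      qed
    qed
    have "K * (c * r / 2 * (d / 2)) = (LINT m|lborel. K * indicator S m)"
    proof -
      have "measure lborel S = c * r / 2 * (d / 2)"
        unfolding S_def using cr d by (subst measure_lborel_cbox_eq) (auto simp: Basis_prod_def)
      then show ?thesis by (simp add: S_def)
    qed
    also have "\<dots> \<le> (LINT m|lborel. Re (?I m / g))"
    proof (rule integral_mono[OF _ _ pointwise])
      show "integrable lborel (\<lambda>m. K * indicator S m)"
        unfolding S_def by (intro integrable_mult_right integrable_real_indicator[OF _ emeasure_lborel_cbox_finite]) auto
      show "integrable lborel (\<lambda>m. Re (?I m / g))"
        by (intro integrable_Re Bochner_Integration.integrable_divide int)
    qed
    also have "\<dots> = Re ((LINT m|lborel. ?I m) / g)"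
      using integral_Re[OF Bochner_Integration.integrable_divide[OF int, of g]] by simp
    also have "\<dots> \<le> norm (LINT m|lborel. ?I m) / norm g"
      using complex_Re_le_cmod[of "(LINT m|lborel. ?I m) / g"] by (simp only: norm_divide)
    also have "\<dots> \<le> (R\<^sup>2 * (C * \<tau> ^ (k + 3))) / norm g"
    proof (rule divide_right_mono)
      have "l\<^sup>2 \<le> R\<^sup>2" using l by (intro power_mono) auto
      moreover have "norm (LINT x|lborel. (h' (l *\<^sub>R x) - h (l *\<^sub>R x)) * of_real (annulus_profile \<delta> ((norm x)\<^sup>2))) \<le> C * \<tau> ^ (k + 3)"
        unfolding l_def by (rule decay[OF \<tau>(1-3) \<delta>])
      ultimately show "norm (LINT m|lborel. ?I m) \<le> R\<^sup>2 * (C * \<tau> ^ (k + 3))"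
        unfolding id norm_mult norm_of_real by (intro mult_mono) auto
    qed simp
    also have "\<dots> = B * r ^ (k + 3)" by (simp add: B_def \<tau>_def power_mult_distrib)
    also have "K * (c * r / 2 * (d / 2)) = A * r ^ (k + 2)"
      using R by (simp add: K_def A_def d_def power_mult_distrib field_simps power_add power2_eq_square)
    finally show ?thesis .
  qed
  \<comment> \<open>The last entry makes \<open>A r\<^sup>k\<^sup>+\<^sup>2 \<le> B r\<^sup>k\<^sup>+\<^sup>3\<close> false; the others are required by \<open>main\<close>.\<close>
  define r where "r = Min {r0 / 2, R / 8, 1 / 4, \<eta>\<^sup>2 / (32 * R), A / (2 * (B + 1))}"
  have "0 < r" using r0 R \<eta> A0 B0 unfolding r_def by (auto simp: Min_gr_iff)
  moreover have "r \<le> r0 / 2" "r \<le> R / 8" "r \<le> 1 / 4" "r \<le> \<eta>\<^sup>2 / (32 * R)" "r \<le> A / (2 * (B + 1))"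
    unfolding r_def by (rule Min_le; simp)+
  ultimately have r: "0 < r" "r \<le> r0 / 2" "r \<le> R / 8" "r \<le> 1 / 4" "r \<le> \<eta>\<^sup>2 / (32 * R)" "r \<le> A / (2 * (B + 1))" .
  have "A * r ^ (k + 2) \<le> B * r ^ (k + 3)"
    using r r0 R by (intro main) (auto simp: field_simps)
  then have "A * r ^ (k + 2) \<le> (B * r) * r ^ (k + 2)" by (simp add: power_add power3_eq_cube power2_eq_square mult_ac)
  then have "A \<le> B * r" using r(1) by (simp add: mult_le_cancel_right)
  also have "\<dots> \<le> (B + 1) * r" using r(1) by simp
  also have "\<dots> \<le> A / 2" using r(6) B0 by (simp add: field_simps)
  finally show False using A0 by simp
qed

end
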